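(* Let $\Sigma$ be a convex entire spacelike surface in $\mathbb R^{2,1}$. If $\Sigma$ is complete at every $\theta\in\mathbb S^1$, then $\Sigma$ is complete.
   Context: $\mathbb R^{2,1}$ is $\mathbb R^3$ with the Lorentzian product $\langle(x,y,z),(x',y',z')\rangle=xx'+yy'-zz'$. A convex entire spacelike surface $\Sigma$ is the graph of a convex function $f:\mathbb R^2\to\mathbb R$ with $\|Df\|<1$ everywhere; surfaces are assumed to be of class $C^2$. "Complete" means that the induced Riemannian metric is complete. $\mathbb S^1=\mathbb R/2\pi\mathbb Z$ and $\vec\theta=(\cos\theta,\sin\theta,1)$. The null support function of $\Sigma$ is $\phi(\theta)=\sup_{p\in\Sigma}\langle p,\vec\theta\rangle\in\mathbb R\cup\{+\infty\}$. If $\phi(\theta)<+\infty$, the plane $\{p:\langle p,\vec\theta\rangle=\phi(\theta)\}$ is the (unique) null support plane of $\Sigma$ in the direction $\theta$; if $\phi(\theta)=+\infty$ there is none. A curve is asymptotic to an affine subspace $V$ (with parallel linear subspace $TV$) if it converges in the quotient $\mathbb R^{2,1}/TV$ to the point corresponding to $V$. $\Sigma$ is incomplete at $\theta$ if there is a proper finite-length geodesic $\gamma:[0,T)\to\Sigma$ (proper as a map into $\Sigma$) asymptotic to a null support plane of $\Sigma$ in the direction $\theta$; otherwise $\Sigma$ is complete at $\theta$. *)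

theory Defs
  imports "HOL-Analysis.Analysis"
begin

definition lorentz :: "real^3 \<Rightarrow> real^3 \<Rightarrow> real" where
  "lorentz p q = p$1 * q$1 + p$2 * q$2 - p$3 * q$3"

definition graph_surface :: "(real^2 \<Rightarrow> real) \<Rightarrow> (real^3) set" where
  "graph_surface f = range (\<lambda>u. vector [u$1, u$2, f u])"

definition C2_function :: "(real^2 \<Rightarrow> real) \<Rightarrow> bool" where
  "C2_function f \<longleftrightarrow>
     (\<exists>(f' :: real^2 \<Rightarrow> (real^2) \<Rightarrow>\<^sub>L real) (f'' :: real^2 \<Rightarrow> (real^2) \<Rightarrow>\<^sub>L ((real^2) \<Rightarrow>\<^sub>L real)).
        (\<forall>u. (f has_derivative blinfun_apply (f' u)) (at u)) \<and>
        (\<forall>u. (f' has_derivative blinfun_apply (f'' u)) (at u)) \<and>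
        continuous_on UNIV f'')"

text \<open>A graph with everywhere spacelike tangent planes is a \<open>C\<^sup>2\<close> surface iff the
  function is of class \<open>C\<^sup>2\<close>, by the implicit function theorem.\<close>

definition convex_entire_spacelike_surface :: "(real^3) set \<Rightarrow> bool" where
  "convex_entire_spacelike_surface S \<longleftrightarrow>
     (\<exists>f. S = graph_surface f \<and> C2_function f \<and> convex_on UNIV f \<and>
          (\<forall>u. onorm (frechet_derivative f (at u)) < 1))"

text \<open>The length with respect to the induced metric, \<open>\<integral>\<^sub>I \<langle>\<gamma>', \<gamma>'\<rangle>\<^sup>1\<^sup>/\<^sup>2\<close>.  It is extended real
  valued because \<open>I\<close> may be half-open, and because the derivative of a path that is piecewise
  \<open>C\<^sup>1\<close> in the sense of \<^const>\<open>valid_path\<close> may be unbounded near a break point.  Values of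
  \<^const>\<open>vector_derivative\<close> at break points and endpoints are immaterial.\<close>

definition lorentz_length :: "real set \<Rightarrow> (real \<Rightarrow> real^3) \<Rightarrow> ennreal" where
  "lorentz_length I \<gamma> =
     (\<integral>\<^sup>+t\<in>I. ennreal (sqrt (lorentz (vector_derivative \<gamma> (at t)) (vector_derivative \<gamma> (at t)))) \<partial>lborel)"

text \<open>The Riemannian distance.  The infimum is finite on the surfaces considered here, which are
  \<open>C\<^sup>2\<close> and connected.\<close>

definition induced_dist :: "(real^3) set \<Rightarrow> real^3 \<Rightarrow> real^3 \<Rightarrow> real" where
  "induced_dist S p q =
     enn2real (INF \<gamma> \<in> {\<gamma>. valid_path \<gamma> \<and> path_image \<gamma> \<subseteq> S \<and> pathstart \<gamma> = p \<and> pathfinish \<gamma> = q}.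
                 lorentz_length {0..1} \<gamma>)"

definition complete_surface :: "(real^3) set \<Rightarrow> bool" where
  "complete_surface S \<longleftrightarrow> Metric_space.mcomplete S (induced_dist S)"

definition tangent_space_at :: "(real^3) set \<Rightarrow> real^3 \<Rightarrow> (real^3) set" where
  "tangent_space_at S p =
     {v. \<exists>c :: real \<Rightarrow> real^3. range c \<subseteq> S \<and> c 0 = p \<and> (c has_vector_derivative v) (at 0)}"

text \<open>The Levi-Civita connection of the induced metric is the tangential part of the flat
  ambient connection, so a curve in \<open>S\<close> is a geodesic iff its acceleration is orthogonal to \<open>S\<close>
  with respect to the Lorentzian product.\<close>

definition geodesic_in :: "(real^3) set \<Rightarrow> real \<Rightarrow> (real \<Rightarrow> real^3) \<Rightarrow> bool" where
  "geodesic_in S T \<gamma> \<longleftrightarrow>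
     \<gamma> ` {0..<T} \<subseteq> S \<and>
     (\<exists>\<gamma>' \<gamma>''.
        (\<forall>t\<in>{0..<T}. (\<gamma> has_vector_derivative \<gamma>' t) (at t within {0..<T})) \<and>
        (\<forall>t\<in>{0..<T}. (\<gamma>' has_vector_derivative \<gamma>'' t) (at t within {0..<T})) \<and>
        continuous_on {0..<T} \<gamma>'' \<and>
        (\<forall>t\<in>{0..<T}. \<forall>v\<in>tangent_space_at S (\<gamma> t). lorentz (\<gamma>'' t) v = 0))"

definition null_vec :: "real \<Rightarrow> real^3" where
  "null_vec \<theta> = vector [cos \<theta>, sin \<theta>, 1]"

definition null_support :: "(real^3) set \<Rightarrow> real \<Rightarrow> ereal" where
  "null_support S \<theta> = (SUP p\<in>S. ereal (lorentz p (null_vec \<theta>)))"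

definition is_null_support_plane :: "(real^3) set \<Rightarrow> real \<Rightarrow> (real^3) set \<Rightarrow> bool" where
  "is_null_support_plane S \<theta> P \<longleftrightarrow>
     null_support S \<theta> < \<infinity> \<and> P = {p. ereal (lorentz p (null_vec \<theta>)) = null_support S \<theta>}"

definition parallel_subspace :: "(real^3) set \<Rightarrow> (real^3) set" where
  "parallel_subspace V = {p - q |p q. p \<in> V \<and> q \<in> V}"

definition coset_of :: "(real^3) set \<Rightarrow> real^3 \<Rightarrow> (real^3) set" where
  "coset_of W p = (+) p ` W"

text \<open>The quotient of the ambient space by a linear subspace \<open>W\<close>; its points are the cosets
  of \<open>W\<close>, so an affine subspace parallel to \<open>W\<close> is itself a point of the quotient.\<close>

definition quotient_topology :: "(real^3) set \<Rightarrow> (real^3) set topology" where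
  "quotient_topology W = topology (\<lambda>U. U \<subseteq> range (coset_of W) \<and> open (coset_of W -` U))"

lemma openin_quotient_topology:
  "openin (quotient_topology W) U \<longleftrightarrow> U \<subseteq> range (coset_of W) \<and> open (coset_of W -` U)"
proof -
  have "istopology (\<lambda>U. U \<subseteq> range (coset_of W) \<and> open (coset_of W -` U))"
    unfolding istopology_def by (auto simp: vimage_Union intro!: open_UN)
  then show ?thesis
    by (simp add: quotient_topology_def)
qed

definition asymptotic_to :: "(real \<Rightarrow> real^3) \<Rightarrow> real \<Rightarrow> (real^3) set \<Rightarrow> bool" where
  "asymptotic_to \<gamma> T V \<longleftrightarrow>
     limitin (quotient_topology (parallel_subspace V))
       (\<lambda>t. coset_of (parallel_subspace V) (\<gamma> t)) V (at_left T)"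

text \<open>A geodesic has constant speed, so a proper one of finite length has a finite life time \<open>T\<close>.\<close>

definition incomplete_at :: "(real^3) set \<Rightarrow> real \<Rightarrow> bool" where
  "incomplete_at S \<theta> \<longleftrightarrow>
     (\<exists>T>0. \<exists>\<gamma> P.
        geodesic_in S T \<gamma> \<and>
        proper_map (top_of_set {0..<T}) (top_of_set S) \<gamma> \<and>
        lorentz_length {0..<T} \<gamma> < \<infinity> \<and>
        is_null_support_plane S \<theta> P \<and>
        asymptotic_to \<gamma> T P)"

definition complete_at :: "(real^3) set \<Rightarrow> real \<Rightarrow> bool" where
  "complete_at S \<theta> \<longleftrightarrow> \<not> incomplete_at S \<theta>"

end

theory Submission
  imports Defs "HOL-Complex_Analysis.Great_Picard"
begin

text \<open>
  Two points of the graph of \<open>f\<close> are spacelike separated. By the reversed triangle inequality in the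
  vertical plane through them, subdividing their chord does not increase the Lorentzian length.
  If the surface is incomplete, then for some base point and some \<open>D\<close> every disc \<open>\<bar>u\<bar> \<le> R\<close> is left
  by inscribed polygons of chord length at most \<open>D\<close>. The minimisers of the chord energy among such
  polygons have second differences orthogonal to the surface and, by convexity, future directed;
  this also bounds their velocities on compact sets. As \<open>R\<close> grows and the mesh shrinks, they
  subconverge on some \<open>[0, T)\<close> to a geodesic that leaves every compact set.

  The acceleration of this geodesic \<open>\<gamma>\<close> is future causal, so \<open>\<langle>\<gamma>', n\<rangle>\<close> decreases for each future null
  vector \<open>n\<close>. The vertical velocity tends to infinity, and compactness yields a null direction \<open>n\<close> with
  \<open>\<langle>\<gamma>', n\<rangle> \<ge> 0\<close> for all time, hence \<open>\<langle>\<gamma>, n\<rangle>\<close> converges. By convexity \<open>\<langle>p - \<gamma>, \<gamma>'\<rangle>\<close> decreases for each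
  point \<open>p\<close> of the surface. Dividing by the vertical velocity shows that the limit bounds \<open>\<langle>p, n\<rangle>\<close>,
  so \<open>\<gamma>\<close> is asymptotic to the null support plane.
\<close>

section \<open>Sequences and curves\<close>

text \<open>Since the surface is not known to be complete, Hopf-Rinow cannot supply minimising
  geodesics, so the geodesic is built from finitely many points at a time: a minimiser of the chord
  energy exists by compactness, and its critical equation is an exact algebraic identity. Energy is
  preferred to length because it also fixes the parametrisation: near equality in Cauchy-Schwarz
  makes all chords almost equal, so vertex \<open>j\<close> can be read as the position at time
  \<open>j * h n\<close>. The life time \<open>T\<close> is the supremum over \<open>r\<close> of
  the infimal chord length needed to leave the disc of radius \<open>r\<close>. Before a time below
  \<open>T\<close> the polygons cannot have left some fixed disc, and a polygon that is still in a
  given disc has a definite length left to travel; hence the limit lives on \<open>[0, T)\<close>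
  and is proper. Convergence of discrete derivatives is never proved directly. The discrete
  estimates have errors quadratic in the elapsed time; such estimates survive pointwise limits and
  then force differentiability.\<close>

lemma sum_lessThan_add:
  fixes F :: "nat \<Rightarrow> 'b::comm_monoid_add"
  shows "(\<Sum>j<m + n. F j) = (\<Sum>j<m. F j) + (\<Sum>j<n. F (m + j))"
  by (induction n) (auto simp: add.assoc)

lemma crossing_point:
  fixes a b :: "'a::real_normed_vector"
  assumes "norm a < r" "r \<le> norm b"
  obtains s where "0 \<le> s" "s \<le> 1" "norm (a + s *\<^sub>R (b - a)) = r"
proof -
  have "continuous_on {0..1} (\<lambda>s. norm (a + s *\<^sub>R (b - a)))" by (intro continuous_intros)
  then obtain s where "0 \<le> s" "s \<le> 1" "norm (a + s *\<^sub>R (b - a)) = r"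
    using IVT'[of "\<lambda>s. norm (a + s *\<^sub>R (b - a))" 0 r 1] assms by auto
  then show ?thesis by (rule that)
qed

text \<open>A discrete Gronwall inequality: the increment bound makes \<open>d i / d j\<close> at most \<open>exp (4 M B)\<close>, so
  every term is comparable with the average.\<close>

lemma discrete_growth:
  fixes d :: "nat \<Rightarrow> real"
  assumes d0: "\<And>i. i \<le> m \<Longrightarrow> 0 \<le> d i" and M: "0 < M" and small: "\<And>i. i \<le> m \<Longrightarrow> M * d i \<le> 1/2"
    and inc: "\<And>i. i < m \<Longrightarrow> \<bar>d (Suc i) - d i\<bar> \<le> M * ((d i)\<^sup>2 + (d (Suc i))\<^sup>2)"
    and B: "(\<Sum>i\<le>m. d i) \<le> B" and "i \<le> m"
  shows "real (Suc m) * d i \<le> B * exp (4 * M * B)"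
proof -
  \<comment> \<open>The hypothesis reads \<open>y * (1 - M * y) \<le> x * (1 + M * x)\<close>, and
    \<open>1 \<le> (1 - z) * (1 + 2 * z)\<close> for \<open>0 \<le> z \<le> 1/2\<close>.\<close>
  have one: "y \<le> x * exp (2 * M * (x + y))"
    if "0 \<le> x" "0 \<le> y" "M * y \<le> 1/2" "y - x \<le> M * (x\<^sup>2 + y\<^sup>2)" for x y
  proof -
    have "1 \<le> (1 - M * y) * (1 + 2 * (M * y))"
      using that M mult_right_mono[of "M * y" "1/2" "M * y"] by (simp add: algebra_simps)
    also have "\<dots> \<le> (1 - M * y) * exp (2 * (M * y))"
      using that by (intro mult_left_mono exp_ge_add_one_self) auto
    finally have "y * 1 \<le> y * ((1 - M * y) * exp (2 * (M * y)))"
      using that by (intro mult_left_mono)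
    also have "\<dots> = (y - M * y\<^sup>2) * exp (2 * (M * y))"
      by (simp add: power2_eq_square algebra_simps)
    also have "\<dots> \<le> (x + M * x\<^sup>2) * exp (2 * (M * y))"
      using that by (intro mult_right_mono) (auto simp: algebra_simps)
    also have "\<dots> \<le> (x * exp (2 * (M * x))) * exp (2 * (M * y))"
    proof (intro mult_right_mono)
      have "x * (1 + M * x) \<le> x * exp (2 * (M * x))"
      proof (rule mult_left_mono)
        have "0 \<le> M * x" using that M by simp
        then show "1 + M * x \<le> exp (2 * (M * x))" using exp_ge_add_one_self[of "2 * (M * x)"] by linarith
      qed (use that in simp)
      then show "x + M * x\<^sup>2 \<le> x * exp (2 * (M * x))" by (simp add: power2_eq_square algebra_simps)
    qed auto
    finally show ?thesis by (simp add: mult_exp_exp algebra_simps)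
  qed
  \<comment> \<open>\<open>D j - D i\<close> bounds the logarithm of the ratio of \<open>d i\<close>
    and \<open>d j\<close>, in either order. Every \<open>d k\<close> enters at most twice with
    factor \<open>2 * M\<close>, whence \<open>4 * M * B\<close>.\<close>
  define D where "D i = (\<Sum>k<i. 2 * M * (d k + d (Suc k)))" for i
  have Suc_D: "D (Suc i) = D i + 2 * M * (d i + d (Suc i))" for i by (simp add: D_def)
  have cmp: "d j \<le> d i * exp (D j - D i) \<and> d i \<le> d j * exp (D j - D i)" if "i \<le> j" "j \<le> m" for i j
    using that
  proof (induction j rule: dec_induct)
    case base
    then show ?case by simp
  next
    case (step j)
    have a: "d (Suc j) \<le> d j * exp (2 * M * (d j + d (Suc j)))"
      using inc[of j] small[of "Suc j"] d0[of j] d0[of "Suc j"] step.prems by (intro one) auto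
    have b: "d j \<le> d (Suc j) * exp (2 * M * (d (Suc j) + d j))"
      using inc[of j] small[of j] d0[of j] d0[of "Suc j"] step.prems by (intro one) (auto simp: add.commute)
    have e: "exp (D (Suc j) - D i) = exp (D j - D i) * exp (2 * M * (d j + d (Suc j)))"
      by (simp add: Suc_D mult_exp_exp algebra_simps)
    have IH: "d j \<le> d i * exp (D j - D i)" "d i \<le> d j * exp (D j - D i)"
      using step by auto
    have "d (Suc j) \<le> (d i * exp (D j - D i)) * exp (2 * M * (d j + d (Suc j)))"
      by (rule order_trans[OF a]) (intro mult_right_mono IH, simp)
    moreover have "d i \<le> (d (Suc j) * exp (2 * M * (d (Suc j) + d j))) * exp (D j - D i)"
      by (rule order_trans[OF IH(2)]) (intro mult_right_mono b, simp)
    ultimately show ?case by (simp add: e mult_ac add.commute)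
  qed
  have "D j - D i \<le> 4 * M * B" if "i \<le> j" "j \<le> m" for i j
  proof -
    have "D j \<le> 4 * M * B"
    proof -
      have "(\<Sum>k<j. d k) \<le> (\<Sum>i\<le>m. d i)" using that d0 by (intro sum_mono2) auto
      moreover have "(\<Sum>k<j. d (Suc k)) = (\<Sum>k\<in>Suc ` {..<j}. d k)" by (simp add: sum.reindex)
      moreover have "(\<Sum>k\<in>Suc ` {..<j}. d k) \<le> (\<Sum>i\<le>m. d i)" using that d0 by (intro sum_mono2) auto
      ultimately have "2 * M * ((\<Sum>k<j. d k) + (\<Sum>k<j. d (Suc k))) \<le> 2 * M * (B + B)"
        using B M by (intro mult_left_mono) auto
      then show ?thesis by (simp add: D_def sum.distrib flip: sum_distrib_left)
    qed
    moreover have "0 \<le> D i" unfolding D_def using that d0 M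
      by (intro sum_nonneg mult_nonneg_nonneg add_nonneg_nonneg) auto
    ultimately show ?thesis by linarith
  qed
  then have E: "d j * exp (D y - D x) \<le> d j * exp (4 * M * B)" if "j \<le> m" "x \<le> y" "y \<le> m" for j x y
    using that d0 by (intro mult_left_mono) auto
  have le: "d i \<le> d j * exp (4 * M * B)" if "j \<le> m" for j
  proof (cases "i \<le> j")
    case True
    then show ?thesis using cmp[of i j] E[of j i j] that by auto
  next
    case False
    then show ?thesis using cmp[of j i] E[of j j i] that \<open>i \<le> m\<close> by auto
  qed
  have "real (Suc m) * d i = (\<Sum>j\<le>m. d i)" by simp
  also have "\<dots> \<le> (\<Sum>j\<le>m. d j * exp (4 * M * B))" using le by (intro sum_mono) auto
  also have "\<dots> \<le> B * exp (4 * M * B)"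
    unfolding sum_distrib_right[symmetric] using B by (intro mult_right_mono) auto
  finally show ?thesis .
qed

text \<open>Near equality in Cauchy--Schwarz forces the steps of a near-optimal polygon to be almost equal.\<close>

lemma partial_sum_deviation:
  fixes c :: "nat \<Rightarrow> real"
  assumes "0 < N" "t \<le> (\<Sum>j<N. c j)" "0 < t" "real N * (\<Sum>j<N. (c j)\<^sup>2) \<le> (t + \<epsilon>)\<^sup>2" "i \<le> N"
  shows "\<bar>(\<Sum>j<i. c j) - real i * (t / real N)\<bar> \<le> sqrt (2 * t * \<epsilon> + \<epsilon>\<^sup>2)"
proof -
  define h where "h = t / real N"
  have Nh: "real N * h = t" using assms(1) by (simp add: h_def)
  have "(\<Sum>j<i. (c j - h)\<^sup>2) \<le> (\<Sum>j<N. (c j - h)\<^sup>2)"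
    using assms(5) by (intro sum_mono2) auto
  then have "(\<Sum>j<i. (c j - h)\<^sup>2) * real i \<le> (\<Sum>j<N. (c j - h)\<^sup>2) * real N"
    using assms(5) by (intro mult_mono) (auto intro: sum_nonneg)
  \<comment> \<open>The variance is expanded exactly. With \<open>N * h = t\<close> the hypotheses
    leave \<open>(t + \<epsilon>)^2 - 2 * t * t + t^2\<close>, and Cauchy-Schwarz on the first
    \<open>i\<close> terms then gives the deviation.\<close>
  moreover have "(\<Sum>j<N. (c j - h)\<^sup>2) * real N
      = real N * (\<Sum>j<N. (c j)\<^sup>2) - 2 * (real N * h) * (\<Sum>j<N. c j) + (real N * h)\<^sup>2"
    by (simp add: power2_diff sum.distrib sum_subtractf power2_eq_square algebra_simps
        flip: sum_distrib_left sum_distrib_right)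
  moreover have "\<dots> \<le> 2 * t * \<epsilon> + \<epsilon>\<^sup>2"
  proof -
    have "t * t \<le> t * sum c {..<N}" using assms(2,3) by (intro mult_left_mono) auto
    then show ?thesis using assms(4) unfolding Nh by (simp add: power2_eq_square algebra_simps)
  qed
  moreover have "((\<Sum>j<i. c j) - real i * h)\<^sup>2 \<le> (\<Sum>j<i. (c j - h)\<^sup>2) * real i"
    using sum_squared_le_sum_of_squares[of "\<lambda>j. c j - h" "{..<i}"] by (simp add: sum_subtractf)
  ultimately show ?thesis
    unfolding h_def[symmetric] by (intro real_le_rsqrt) simp
qed

text \<open>An Arzela-Ascoli argument for step functions, which are equicontinuous only up to an
  error \<open>e n\<close> tending to 0: a diagonal subsequence converges on the rationals, and the
  values at a nearby rational make it Cauchy at every other time.\<close>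

lemma pointwise_convergent_subsequence:
  fixes F :: "nat \<Rightarrow> real \<Rightarrow> 'b::euclidean_space"
  assumes e: "e \<longlonglongrightarrow> 0"
    and F: "\<And>\<tau>. 0 < \<tau> \<Longrightarrow> \<tau> < T \<Longrightarrow> \<exists>B K. 0 < K \<and> (\<forall>\<^sub>F n in sequentially. \<forall>s t. 0 \<le> s \<longrightarrow> s \<le> t \<longrightarrow> t \<le> \<tau> \<longrightarrow>
      norm (F n t) \<le> B \<and> norm (F n t - F n s) \<le> K * (t - s + e n))"
  obtains \<phi> G where "strict_mono \<phi>" "\<And>t. 0 \<le> t \<Longrightarrow> t < T \<Longrightarrow> (\<lambda>n. F (\<phi> n) t) \<longlonglongrightarrow> G t"
proof -
  define S where "S = \<rat> \<inter> {0..<T}"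
  have "\<exists>M>0. \<forall>n. norm (F n x) \<le> M" if x: "x \<in> S" for x
  proof -
    have "0 < (x + T) / 2" "(x + T) / 2 < T" "0 \<le> x" "x \<le> (x + T) / 2" using x by (auto simp: S_def)
    then obtain B where "\<forall>\<^sub>F n in sequentially. norm (F n x) \<le> B"
      using F[of "(x + T) / 2"] by (fastforce elim: eventually_mono)
    then have "Bseq (\<lambda>n. F n x)" by (rule BfunI)
    then show ?thesis unfolding Bseq_def by blast
  qed
  then have "\<forall>x\<in>S. \<exists>M>0. \<forall>n. norm (F n x) \<le> M" by blast
  then obtain M where "\<forall>x\<in>S. 0 < M x \<and> (\<forall>n. norm (F n x) \<le> M x)" by (rule bchoice[THEN exE])
  then have M: "\<And>x. x \<in> S \<Longrightarrow> 0 < M x" "\<And>x n. x \<in> S \<Longrightarrow> norm (F n x) \<le> M x" by auto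
  have "countable S" unfolding S_def by (intro countable_Int1 countable_rat)
  \<comment> \<open>The bounds \<open>M x\<close> depend on the point, while the diagonal argument
    asks for one common bound; hence the rescaling, undone below.\<close>
  moreover have "norm (F n x /\<^sub>R M x) \<le> 1" if "x \<in> S" for n x
    using M[OF that] by (simp add: field_simps)
  ultimately obtain k where k: "strict_mono (k::nat\<Rightarrow>nat)" "\<And>x. x \<in> S \<Longrightarrow> \<exists>l. (\<lambda>n. F (k n) x /\<^sub>R M x) \<longlonglongrightarrow> l"
    by (rule function_convergent_subsequence[of S "\<lambda>n x. F n x /\<^sub>R M x" 1]) (assumption, rule that, assumption, blast)
  have kS: "convergent (\<lambda>n. F (k n) x)" if x: "x \<in> S" for x
  proof -
    obtain l where "(\<lambda>n. F (k n) x /\<^sub>R M x) \<longlonglongrightarrow> l" using k(2)[OF x] by blast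
    then have "(\<lambda>n. M x *\<^sub>R (F (k n) x /\<^sub>R M x)) \<longlonglongrightarrow> M x *\<^sub>R l" by (intro tendsto_intros)
    then show ?thesis using M(1)[OF x] by (auto simp: convergent_def)
  qed
  have ek: "(\<lambda>n. e (k n)) \<longlonglongrightarrow> 0" using LIMSEQ_subseq_LIMSEQ[OF e k(1)] by (simp add: o_def)
  have "convergent (\<lambda>n. F (k n) t)" if t: "0 \<le> t" "t < T" for t
    unfolding Cauchy_convergent_iff[symmetric]
  proof (rule metric_CauchyI)
    fix \<epsilon> :: real assume \<epsilon>: "0 < \<epsilon>"
    define \<tau> where "\<tau> = (t + T) / 2"
    have \<tau>: "0 < \<tau>" "\<tau> < T" "t < \<tau>" using t by (auto simp: \<tau>_def)
    obtain B K where K: "0 < K" "\<forall>\<^sub>F n in sequentially. \<forall>s t. 0 \<le> s \<longrightarrow> s \<le> t \<longrightarrow> t \<le> \<tau> \<longrightarrow>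
      norm (F n t) \<le> B \<and> norm (F n t - F n s) \<le> K * (t - s + e n)"
      using F[OF \<tau>(1,2)] by blast
    have Kk: "\<forall>\<^sub>F n in sequentially. \<forall>s t. 0 \<le> s \<longrightarrow> s \<le> t \<longrightarrow> t \<le> \<tau> \<longrightarrow>
      norm (F (k n) t) \<le> B \<and> norm (F (k n) t - F (k n) s) \<le> K * (t - s + e (k n))"
      using eventually_subseq[OF k(1) K(2)] .
    obtain s where s: "s \<in> \<rat>" "t < s" "s < min \<tau> (t + \<epsilon> / (8 * K))"
      using Rats_dense_in_real[of t "min \<tau> (t + \<epsilon> / (8 * K))"] \<tau> K \<epsilon> by auto
    have "s \<in> S" using s t \<tau> by (auto simp: S_def)
    then have "Cauchy (\<lambda>n. F (k n) s)" using kS Cauchy_convergent_iff by blast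
    then obtain n1 where n1: "\<And>m n. m \<ge> n1 \<Longrightarrow> n \<ge> n1 \<Longrightarrow> dist (F (k m) s) (F (k n) s) < \<epsilon> / 4"
      using \<epsilon> metric_CauchyD[of "\<lambda>n. F (k n) s" "\<epsilon> / 4"] by auto
    have "\<forall>\<^sub>F n in sequentially. e (k n) < \<epsilon> / (8 * K)"
      using ek K \<epsilon> by (intro order_tendstoD) auto
    with Kk have "\<forall>\<^sub>F n in sequentially. dist (F (k n) s) (F (k n) t) < \<epsilon> / 4"
    proof eventually_elim
      case (elim n)
      have "norm (F (k n) s - F (k n) t) \<le> K * (s - t + e (k n))" using elim(1) s t by auto
      also have "\<dots> < K * (\<epsilon> / (8 * K) + \<epsilon> / (8 * K))"
        using s elim(2) K by (intro mult_strict_left_mono) auto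
      also have "\<dots> = \<epsilon> / 4" using K by (simp add: field_simps)
      finally show ?case by (simp add: dist_norm)
    qed
    then obtain n2 where n2: "\<And>n. n \<ge> n2 \<Longrightarrow> dist (F (k n) s) (F (k n) t) < \<epsilon> / 4"
      by (auto simp: eventually_sequentially)
    show "\<exists>M. \<forall>m\<ge>M. \<forall>n\<ge>M. dist (F (k m) t) (F (k n) t) < \<epsilon>"
    proof (intro exI[of _ "max n1 n2"] allI impI)
      fix m n assume mn: "max n1 n2 \<le> m" "max n1 n2 \<le> n"
      have "dist (F (k m) t) (F (k n) t) \<le> dist (F (k m) s) (F (k m) t) + dist (F (k m) s) (F (k n) s) + dist (F (k n) s) (F (k n) t)"
        using dist_triangle[of "F (k m) t" "F (k n) t" "F (k m) s"] dist_triangle[of "F (k m) s" "F (k n) t" "F (k n) s"]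
          dist_commute[of "F (k m) t" "F (k m) s"] by linarith
      then show "dist (F (k m) t) (F (k n) t) < \<epsilon>"
        using n1[of m n] n2[of m] n2[of n] mn \<epsilon> by auto
    qed
  qed
  then show ?thesis
    using that[OF k(1), of "\<lambda>t. lim (\<lambda>n. F (k n) t)"] by (simp add: convergent_LIMSEQ_iff)
qed

text \<open>This recovers derivatives of a limit curve from estimates that pass to pointwise limits.
  For \<open>t\<close> inside \<open>S\<close> the bound is asked on both sides of
  \<open>t\<close>.\<close>

lemma has_vector_derivative_of_quadratic_bound:
  fixes F :: "real \<Rightarrow> 'b::real_normed_vector"
  assumes "t < \<tau>"
    and bound: "\<And>s. s \<in> S \<Longrightarrow> s \<le> \<tau> \<Longrightarrow> norm (F s - F t - (s - t) *\<^sub>R F') \<le> C * (s - t)\<^sup>2"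
  shows "(F has_vector_derivative F') (at t within S)"
  unfolding has_vector_derivative_def has_derivative_within_alt
proof (intro conjI allI impI bounded_linear_scaleR_left)
  fix e :: real assume e: "0 < e"
  define d where "d = min (\<tau> - t) (e / (\<bar>C\<bar> + 1))"
  have d: "0 < d" using assms(1) e by (simp add: d_def)
  show "\<exists>d>0. \<forall>y\<in>S. norm (y - t) < d \<longrightarrow> norm (F y - F t - (y - t) *\<^sub>R F') \<le> e * norm (y - t)"
  proof (intro exI[of _ d] conjI d ballI impI)
    fix s assume s: "s \<in> S" "norm (s - t) < d"
    then have st: "s \<le> \<tau>" "\<bar>s - t\<bar> \<le> e / (\<bar>C\<bar> + 1)" by (auto simp: d_def)
    have "norm (F s - F t - (s - t) *\<^sub>R F') \<le> C * (s - t)\<^sup>2" using bound s st by blast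
    also have "\<dots> \<le> (\<bar>C\<bar> + 1) * (s - t)\<^sup>2" by (intro mult_right_mono) auto
    also have "\<dots> = ((\<bar>C\<bar> + 1) * \<bar>s - t\<bar>) * \<bar>s - t\<bar>"
      by (simp add: power2_eq_square abs_mult_self_eq mult.assoc)
    also have "\<dots> \<le> e * \<bar>s - t\<bar>"
      using st(2) by (intro mult_right_mono) (auto simp: pos_le_divide_eq mult.commute)
    finally show "norm (F s - F t - (s - t) *\<^sub>R F') \<le> e * norm (s - t)" by simp
  qed
qed

section \<open>Chords of convex spacelike graphs\<close>

text \<open>\<open>g\<close> is the gradient and \<open>H\<close> the Hessian, as a linear map.
  Convexity is stated as the support plane inequality, the form in which every estimate applies it;
  \<open>continuous_hessian\<close> is what makes the acceleration of the geodesic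
  continuous.\<close>

locale convex_spacelike_graph =
  fixes f :: "'a::euclidean_space \<Rightarrow> real" and g :: "'a \<Rightarrow> 'a" and H :: "'a \<Rightarrow> 'a \<Rightarrow> 'a"
  assumes has_gradient: "(f has_derivative (\<lambda>h. g u \<bullet> h)) (at u)"
    and has_hessian: "(g has_derivative H u) (at u)"
    and gradient_lipschitz: "\<exists>L>0. \<forall>x\<in>cball 0 r. \<forall>y\<in>cball 0 r. norm (g x - g y) \<le> L * norm (x - y)"
    and continuous_hessian: "continuous_on UNIV (\<lambda>p. H (fst p) (snd p))"
    and spacelike: "norm (g u) < 1"
    and convex: "f x + g x \<bullet> (y - x) \<le> f y"
begin

text \<open>The Lorentzian square of the vector from \<open>(a, f a)\<close> to
  \<open>(b, f b)\<close>.\<close>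

definition chord2 :: "'a \<Rightarrow> 'a \<Rightarrow> real" where
  "chord2 a b = (norm (b - a))\<^sup>2 - (f b - f a)\<^sup>2"

text \<open>The Euler--Lagrange equation of the chord energy: in the ambient space, the second difference of
  the three lifted points is normal to the surface at the middle one.\<close>

definition stationary :: "'a \<Rightarrow> 'a \<Rightarrow> 'a \<Rightarrow> bool" where
  "stationary a x b \<longleftrightarrow> a + b - 2 *\<^sub>R x = (f a + f b - 2 * f x) *\<^sub>R g x"

definition chord :: "'a \<Rightarrow> 'a \<Rightarrow> real" where
  "chord a b = sqrt (chord2 a b)"

abbreviation energy :: "nat \<Rightarrow> (nat \<Rightarrow> 'a) \<Rightarrow> real" where
  "energy N u \<equiv> \<Sum>j<N. chord2 (u j) (u (Suc j))"

abbreviation polygon_length :: "nat \<Rightarrow> (nat \<Rightarrow> 'a) \<Rightarrow> real" where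
  "polygon_length N u \<equiv> \<Sum>j<N. chord (u j) (u (Suc j))"

text \<open>An inscribed polygon remembered only by its end points and its total chord length, so
  that concatenations and infima need no indexing of vertices.\<close>

inductive chain :: "'a \<Rightarrow> 'a \<Rightarrow> real \<Rightarrow> bool" where
  chain_refl: "chain a a 0"
| chain_step: "chain a b L \<Longrightarrow> chain a c (L + chord b c)"

lemma continuous_on_f [continuous_intros]:
  "continuous_on A h \<Longrightarrow> continuous_on A (\<lambda>x. f (h x))"
  by (rule continuous_on_compose2[of UNIV f])
    (auto intro: has_derivative_continuous_on has_gradient)

lemma continuous_on_g [continuous_intros]:
  "continuous_on A h \<Longrightarrow> continuous_on A (\<lambda>x. g (h x))"
  by (rule continuous_on_compose2[of UNIV g])
    (auto intro: has_derivative_continuous_on has_hessian)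

text \<open>By compactness the slope attains a maximum \<open>l < 1\<close> on the disc, and
  \<open>\<kappa>^2 = 1 - l^2\<close>. The constant degenerates as \<open>r\<close> grows, which is
  how incompleteness becomes possible.\<close>

lemma disc_bound:
  obtains \<kappa> where "0 < \<kappa>" "\<kappa> \<le> 1"
    "\<And>a b. a \<in> cball 0 r \<Longrightarrow> b \<in> cball 0 r \<Longrightarrow> \<kappa>\<^sup>2 * (norm (b - a))\<^sup>2 \<le> chord2 a b"
    "\<And>a. a \<in> cball 0 r \<Longrightarrow> \<kappa>\<^sup>2 \<le> 1 - (norm (g a))\<^sup>2"
proof (cases "r < 0")
  case True
  then show ?thesis by (intro that[of 1]) auto
next
  case False
  then have "cball (0::'a) r \<noteq> {}" by auto
  moreover have "continuous_on (cball 0 r) (\<lambda>x. norm (g x))"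
    by (intro continuous_intros)
  ultimately obtain m where m: "m \<in> cball 0 r" "\<And>x. x \<in> cball 0 r \<Longrightarrow> norm (g x) \<le> norm (g m)"
    using continuous_attains_sup[of "cball (0::'a) r" "\<lambda>x. norm (g x)"] by auto
  define l where "l = norm (g m)"
  have l: "0 \<le> l" "l < 1" using spacelike by (auto simp: l_def)
  then have l2: "l\<^sup>2 < 1" by (simp add: power_less_one_iff abs_square_less_1)
  have sq: "(sqrt (1 - l\<^sup>2))\<^sup>2 = 1 - l\<^sup>2" using l2 by simp
  show ?thesis
  proof (intro that[of "sqrt (1 - l\<^sup>2)"])
    show "0 < sqrt (1 - l\<^sup>2)" "sqrt (1 - l\<^sup>2) \<le> 1" using l2 by auto
    show "(sqrt (1 - l\<^sup>2))\<^sup>2 * (norm (b - a))\<^sup>2 \<le> chord2 a b"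
      if ab: "a \<in> cball 0 r" "b \<in> cball 0 r" for a b
    proof -
      have "norm (f b - f a) \<le> l * norm (b - a)"
      proof (rule differentiable_bound[of "cball 0 r" f "\<lambda>u h. g u \<bullet> h"])
        fix x assume x: "x \<in> cball (0::'a) r"
        show "(f has_derivative (\<bullet>) (g x)) (at x within cball 0 r)"
          using has_gradient has_derivative_at_withinI by blast
        show "onorm ((\<bullet>) (g x)) \<le> l"
        proof (rule onorm_le)
          fix h
          have "\<bar>g x \<bullet> h\<bar> \<le> norm (g x) * norm h" by (rule Cauchy_Schwarz_ineq2)
          also have "\<dots> \<le> l * norm h"
            using m(2)[OF x] unfolding l_def by (intro mult_right_mono) auto
          finally show "norm (g x \<bullet> h) \<le> l * norm h" by simp
        qed
      qed (use ab in auto)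
      then have "(f b - f a)\<^sup>2 \<le> (l * norm (b - a))\<^sup>2"
        by (metis abs_le_square_iff abs_of_nonneg l(1) mult_nonneg_nonneg norm_ge_zero real_norm_def)
      then show ?thesis unfolding sq chord2_def by (simp add: power_mult_distrib algebra_simps)
    qed
    show "(sqrt (1 - l\<^sup>2))\<^sup>2 \<le> 1 - (norm (g a))\<^sup>2" if "a \<in> cball 0 r" for a
      using m(2)[OF that] unfolding sq by (simp add: l_def power_mono)
  qed
qed

lemma chord2_nonneg: "0 \<le> chord2 a b"
proof -
  obtain \<kappa> where "0 < \<kappa>"
    "\<And>x y. x \<in> cball 0 (max (norm a) (norm b)) \<Longrightarrow> y \<in> cball 0 (max (norm a) (norm b))
      \<Longrightarrow> \<kappa>\<^sup>2 * (norm (y - x))\<^sup>2 \<le> chord2 x y"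
    by (rule disc_bound) blast
  then have "\<kappa>\<^sup>2 * (norm (b - a))\<^sup>2 \<le> chord2 a b" by auto
  then show ?thesis by (meson mult_nonneg_nonneg order_trans zero_le_power2)
qed

lemma chord_nonneg: "0 \<le> chord a b"
  by (simp add: chord_def chord2_nonneg)

lemma chord_power2: "(chord a b)\<^sup>2 = chord2 a b"
  by (simp add: chord_def chord2_nonneg)

lemma f_diff_le: "\<bar>f b - f a\<bar> \<le> norm (b - a)"
  using chord2_nonneg[of a b] unfolding chord2_def
  by (metis abs_le_square_iff abs_norm_cancel diff_ge_0_iff_ge)

lemma chord_le_norm: "chord a b \<le> norm (b - a)"
  by (rule power2_le_imp_le) (simp_all add: chord_power2 chord2_def)

text \<open>The difference of the squared heights factors into a difference and a sum, and
  \<open>f\<close> being 1-Lipschitz bounds each factor by its horizontal counterpart. The lemma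
  allows a chord to be cut where it crosses a circle.\<close>

lemma chord_segment_le:
  assumes "0 \<le> s" "s \<le> 1"
  shows "chord2 a (a + s *\<^sub>R (b - a)) \<le> chord2 a b"
proof -
  define x where "x = a + s *\<^sub>R (b - a)"
  have nx: "norm (x - a) = s * norm (b - a)" "norm (b - x) = (1 - s) * norm (b - a)"
  proof -
    have "b - x = (1 - s) *\<^sub>R (b - a)" by (simp add: x_def algebra_simps)
    then show "norm (b - x) = (1 - s) * norm (b - a)" using assms by simp
  qed (use assms in \<open>simp add: x_def\<close>)
  have "\<bar>f b - f x\<bar> * \<bar>(f b - f a) + (f x - f a)\<bar> \<le> ((1 - s) * norm (b - a)) * (norm (b - a) + s * norm (b - a))"
    using f_diff_le[of b x] f_diff_le[of b a] f_diff_le[of x a] nx assms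
    by (intro mult_mono) (auto simp: norm_minus_commute)
  moreover have "(f b - f a)\<^sup>2 - (f x - f a)\<^sup>2 \<le> \<bar>f b - f x\<bar> * \<bar>(f b - f a) + (f x - f a)\<bar>"
    unfolding abs_mult[symmetric] by (rule order_trans[OF _ abs_ge_self]) (simp add: power2_eq_square algebra_simps)
  ultimately show ?thesis
    unfolding x_def[symmetric] chord2_def nx by (simp add: power2_eq_square algebra_simps)
qed

text \<open>The horizontal part is exactly \<open>(norm (b - a))^2 / n\<close>, while the height
  part is at least \<open>(f b - f a)^2 / n\<close> by Cauchy-Schwarz and enters with a minus sign.
  This is the reversed triangle inequality in its energy form.\<close>

lemma chord2_subdivide:
  assumes "0 < n"
  shows "(\<Sum>j<n. chord2 (a + (real j / real n) *\<^sub>R (b - a)) (a + (real (Suc j) / real n) *\<^sub>R (b - a)))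
    \<le> chord2 a b / real n"
proof -
  define x where "x j = a + (real j / real n) *\<^sub>R (b - a)" for j
  have x0: "x 0 = a" and xn: "x n = b" using assms by (auto simp: x_def)
  have "x (Suc j) - x j = (1 / real n) *\<^sub>R (b - a)" for j
    by (simp add: x_def add_divide_distrib algebra_simps)
  then have nx: "norm (x (Suc j) - x j) = norm (b - a) / real n" for j
    by simp
  have "(\<Sum>j<n. f (x (Suc j)) - f (x j)) = f b - f a"
    using sum_lessThan_telescope[of "\<lambda>j. f (x j)" n] x0 xn by (simp del: sum_lessThan_telescope)
  then have "(f b - f a)\<^sup>2 \<le> (\<Sum>j<n. (f (x (Suc j)) - f (x j))\<^sup>2) * real n"
    using sum_squared_le_sum_of_squares[of "\<lambda>j. f (x (Suc j)) - f (x j)" "{..<n}"] by simp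
  then have "(f b - f a)\<^sup>2 / real n \<le> (\<Sum>j<n. (f (x (Suc j)) - f (x j))\<^sup>2)"
    using assms by (simp add: divide_le_eq)
  moreover have "energy n x = (norm (b - a))\<^sup>2 / real n - (\<Sum>j<n. (f (x (Suc j)) - f (x j))\<^sup>2)"
    using assms unfolding chord2_def nx by (simp add: sum_subtractf power_divide power2_eq_square)
  ultimately show ?thesis
    unfolding x_def[symmetric] by (simp add: chord2_def diff_divide_distrib)
qed

section \<open>Chains: concatenation, lower length bounds and conversion to polygons\<close>

lemma chain_nonneg: "chain a b L \<Longrightarrow> 0 \<le> L"
  by (induction rule: chain.induct) (auto simp: chord_nonneg add_nonneg_nonneg)

lemma chain_trans: "chain b c L' \<Longrightarrow> chain a b L \<Longrightarrow> chain a c (L + L')"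
  by (induction arbitrary: L rule: chain.induct) (auto simp flip: add.assoc intro: chain_step)

lemma chain_single: "chain a b (chord a b)"
  using chain_step[OF chain_refl] by simp

lemma chain_of_polygon:
  "i \<le> j \<Longrightarrow> chain (u i) (u j) (\<Sum>k\<in>{i..<j}. chord (u k) (u (Suc k)))"
  by (induction j rule: dec_induct) (auto intro: chain_refl chain_step)

text \<open>Chords are comparable with Euclidean ones in the disc of radius \<open>r + 1\<close>,
  but one chord may jump far beyond it, where no uniform bound holds. Such a chord is cut at the
  boundary circle, which is at distance at least 1 from \<open>a\<close>.\<close>

lemma chain_lower_bound:
  obtains \<kappa> where "0 < \<kappa>"
    "\<And>a b L. chain a b L \<Longrightarrow> norm a \<le> r \<Longrightarrow> \<kappa> * min 1 (norm (b - a)) \<le> L"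
proof -
  obtain \<kappa> where \<kappa>: "0 < \<kappa>" and *:
    "\<And>a b. a \<in> cball 0 (r + 1) \<Longrightarrow> b \<in> cball 0 (r + 1) \<Longrightarrow> \<kappa>\<^sup>2 * (norm (b - a))\<^sup>2 \<le> chord2 a b"
    by (rule disc_bound[of "r + 1"]) blast
  have le: "\<kappa> * norm (b - a) \<le> chord a b" if "norm a \<le> r + 1" "norm b \<le> r + 1" for a b
    using *[of a b] that \<kappa> unfolding chord_def
    by (intro real_le_rsqrt) (simp add: power_mult_distrib)
  \<comment> \<open>The induction needs a dichotomy: either the chain still ends in the larger disc
    and the linear bound holds, or it has already paid \<open>\<kappa>\<close> and may go
    anywhere.\<close>
  have "(norm b \<le> r + 1 \<and> \<kappa> * norm (b - a) \<le> L) \<or> \<kappa> \<le> L"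
    if "chain a b L" "norm a \<le> r" for a b L using that
  proof (induction rule: chain.induct)
    case (chain_refl a)
    then show ?case by simp
  next
    case (chain_step a b L c)
    show ?case
    proof (cases "\<kappa> \<le> L")
      case True
      then show ?thesis using chord_nonneg[of b c] by linarith
    next
      case False
      then have b: "norm b \<le> r + 1" "\<kappa> * norm (b - a) \<le> L" using chain_step by auto
      have add: "\<kappa> * norm (x - a) \<le> L + \<kappa> * norm (x - b)" for x
      proof -
        have "\<kappa> * norm (x - a) \<le> \<kappa> * (norm (x - b) + norm (b - a))"
          using norm_triangle_ineq[of "x - b" "b - a"] \<kappa> by (intro mult_left_mono) auto
        then show ?thesis using b(2) by (simp add: distrib_left)
      qed
      show ?thesis
      proof (cases "norm c \<le> r + 1")
        case True
        then show ?thesis using add[of c] le[OF b(1) True] by simp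
      next
        case False
        have "\<exists>s. 0 \<le> s \<and> s \<le> 1 \<and> norm (b + s *\<^sub>R (c - b)) = r + 1"
        proof (cases "norm b < r + 1")
          case True
          then show ?thesis using crossing_point[of b "r + 1" c] False by (metis linear)
        next
          case False
          then show ?thesis using b(1) by (intro exI[of _ 0]) auto
        qed
        then obtain s where s: "0 \<le> s" "s \<le> 1" "norm (b + s *\<^sub>R (c - b)) = r + 1" by blast
        define x where "x = b + s *\<^sub>R (c - b)"
        have "norm x = r + 1" using s x_def by simp
        then have "1 \<le> norm (x - a)" using chain_step.prems norm_triangle_ineq2[of x a] by linarith
        then have "\<kappa> \<le> \<kappa> * norm (x - a)" using \<kappa> by simp
        also have "\<dots> \<le> L + chord b x" using add[of x] le[OF b(1), of x] \<open>norm x = r + 1\<close> by simp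
        also have "chord b x \<le> chord b c"
          unfolding chord_def x_def using chord_segment_le[OF s(1,2)] by simp
        finally show ?thesis by simp
      qed
    qed
  qed
  moreover have "\<kappa> * min 1 t \<le> \<kappa>" "\<kappa> * min 1 t \<le> \<kappa> * t" for t
    using \<kappa> by (auto simp: mult_left_mono mult_le_cancel_left1)
  ultimately show ?thesis using that[OF \<kappa>] by (meson order_trans)
qed

text \<open>Every chord is cut into pieces of chord length about \<open>h\<close>. \<open>M\<close>
  counts the chords, each costing at most one surplus piece by rounding; it is independent of
  \<open>h\<close>, so \<open>N * energy\<close> exceeds \<open>L^2\<close> by at most
  \<open>M * h * L\<close>.\<close>

lemma chain_polygon:
  "chain a b L \<Longrightarrow> \<exists>M::nat. \<forall>h>0. \<exists>N u. u 0 = a \<and> u N = b \<and>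
     energy N u \<le> h * L \<and> real N * h \<le> L + real M * h"
proof (induction a b L rule: chain.induct)
  case (chain_refl a)
  show ?case by (rule exI[of _ 0], intro allI impI, rule exI[of _ 0], rule exI[of _ "\<lambda>_. a"]) auto
next
  case (chain_step a b L c)
  then obtain M :: nat where M: "\<And>h. h > 0 \<Longrightarrow> \<exists>N u. u 0 = a \<and> u N = b \<and>
     energy N u \<le> h * L \<and> real N * h \<le> L + real M * h" by blast
  show ?case
  proof (rule exI[of _ "Suc M"], intro allI impI)
    fix h :: real assume h: "h > 0"
    obtain N u where u: "u 0 = a" "u N = b" "energy N u \<le> h * L"
      "real N * h \<le> L + real M * h" using M[OF h] by blast
    \<comment> \<open>The successor makes \<open>n\<close> positive even for a chord of length 0 and
      places \<open>chord b c / h\<close> between \<open>n - 1\<close> and \<open>n\<close>.\<close>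
    define n where "n = Suc (nat \<lfloor>chord b c / h\<rfloor>)"
    have n0: "0 < n" by (simp add: n_def)
    have "0 \<le> chord b c / h" using chord_nonneg h by simp
    then have n: "chord b c / h \<le> real n" "real n \<le> chord b c / h + 1"
      unfolding n_def by linarith+
    define u' where "u' j = (if j \<le> N then u j else b + (real (j - N) / real n) *\<^sub>R (c - b))" for j
    have u'N: "u' (N + j) = b + (real j / real n) *\<^sub>R (c - b)" for j
      using u(2) by (cases j) (auto simp: u'_def)
    have "chord2 b c / real n \<le> h * chord b c"
    proof -
      have "chord2 b c = chord b c * chord b c" by (simp add: chord_power2 flip: power2_eq_square)
      also have "\<dots> \<le> chord b c * (h * real n)"
        using n(1) h by (intro mult_left_mono chord_nonneg) (simp add: field_simps)
      finally show ?thesis using n0 by (simp add: divide_le_eq mult_ac)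
    qed
    moreover have "(\<Sum>j<n. chord2 (u' (N + j)) (u' (Suc (N + j)))) \<le> chord2 b c / real n"
      using chord2_subdivide[OF n0, of b c] unfolding u'N add_Suc_right[symmetric] by simp
    moreover have "energy N u' = energy N u"
      by (intro sum.cong) (auto simp: u'_def)
    ultimately have "energy (N + n) u' \<le> h * (L + chord b c)"
      using u(3) by (simp add: sum_lessThan_add algebra_simps)
    moreover have "u' 0 = a" using u by (simp add: u'_def)
    moreover have "u' (N + n) = c" unfolding u'N using n0 by simp
    moreover have "real (N + n) * h \<le> L + chord b c + real (Suc M) * h"
      using u(4) n(2) h by (simp add: field_simps)
    ultimately show "\<exists>N u. u 0 = a \<and> u N = c \<and>
     energy N u \<le> h * (L + chord b c) \<and> real N * h \<le> L + chord b c + real (Suc M) * h"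
      by blast
  qed
qed

section \<open>Minimisers of the chord energy\<close>

lemma critical_point:
  assumes "norm x < R"
    and min: "\<And>y. norm y < R \<Longrightarrow> chord2 a x + chord2 x b \<le> chord2 a y + chord2 y b"
  shows "stationary a x b"
proof -
  define v where "v = (f a + f b - 2 * f x) *\<^sub>R g x - (a + b - 2 *\<^sub>R x)"
  have "((\<lambda>y. chord2 a y + chord2 y b) has_derivative (\<lambda>h. 2 * (v \<bullet> h))) (at x)"
    unfolding chord2_def power2_norm_eq_inner
    by (rule derivative_eq_intros has_gradient refl | simp)+
      (simp add: v_def fun_eq_iff inner_simps inner_commute algebra_simps)
  then have "(\<lambda>h. 2 * (v \<bullet> h)) = (\<lambda>h. 0)"
    by (rule differential_zero_maxmin[of x "ball 0 R", rotated 2]) (use assms in auto)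
  then have "v \<bullet> v = 0" by (metis mult_eq_0_iff zero_neq_numeral)
  then show ?thesis by (simp add: v_def stationary_def)
qed

text \<open>The competitors start at \<open>a\<close>, stay in the closed disc and end on its
  boundary, a compact set. Vertices on the boundary cannot be varied freely, so the minimiser is cut
  at its first boundary vertex; all earlier ones are interior, hence critical.\<close>

lemma energy_minimizer:
  assumes "norm a < R" "u 0 = a" "R \<le> norm (u N)"
  obtains N' v where "0 < N'" "v 0 = a" "norm (v N') = R"
    "\<And>j. j < N' \<Longrightarrow> norm (v j) < R" "N' \<le> N"
    "energy N' v \<le> energy N u"
    "\<And>j. Suc j < N' \<Longrightarrow> stationary (v j) (v (Suc j)) (v (Suc (Suc j)))"
proof -
  define E where "E v = energy N v" for v :: "nat \<Rightarrow> 'a"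
  \<comment> \<open>Sequences indexed by all naturals make compactness Tychonoff's theorem; the
    indices beyond \<open>N\<close> do not enter \<open>E\<close>.\<close>
  define A where "A j = (if j = 0 then {a} else if j < N then cball (0::'a) R else sphere 0 R)" for j
  define K where "K = Pi\<^sub>E UNIV A"
  have "N \<noteq> 0" using assms by (metis linorder_not_less)
  have "compact K"
  proof -
    have "compactin (product_topology (\<lambda>i. euclidean) UNIV) (Pi\<^sub>E UNIV A)"
      by (subst compactin_PiE) (auto simp: A_def)
    then show ?thesis by (simp add: K_def euclidean_product_topology)
  qed
  define j0 where "j0 = (LEAST j. R \<le> norm (u j))"
  have j0: "R \<le> norm (u j0)" "\<And>i. i < j0 \<Longrightarrow> norm (u i) < R" "j0 \<le> N"
    unfolding j0_def using assms(3) by (auto intro: LeastI Least_le dest: not_less_Least)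
  have "j0 \<noteq> 0" using j0(1) assms(1,2) by (metis linorder_not_less)
  then obtain j1 where j1: "j0 = Suc j1" using not0_implies_Suc by blast
  obtain s where s: "0 \<le> s" "s \<le> 1" "norm (u j1 + s *\<^sub>R (u j0 - u j1)) = R"
    using crossing_point[of "u j1" R "u j0"] j0 j1 by auto
  \<comment> \<open>The given polygon is cut where it first meets the circle and then rests there;
    resting has chords of length 0, so the number of edges need not change.\<close>
  define u' where "u' i = (if i < j0 then u i else u j1 + s *\<^sub>R (u j0 - u j1))" for i
  have u'K: "u' \<in> K"
    unfolding K_def A_def u'_def using \<open>j0 \<noteq> 0\<close> \<open>N \<noteq> 0\<close> j0 assms s by (auto simp: less_imp_le)
  have "E u' \<le> E u"
    unfolding E_def
  proof (rule sum_mono)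
    fix i
    consider "Suc i < j0" | "i = j1" | "i \<ge> j0" using j1 by linarith
    then show "chord2 (u' i) (u' (Suc i)) \<le> chord2 (u i) (u (Suc i))"
    proof cases
      case 2
      then show ?thesis using chord_segment_le[OF s(1,2), of "u j1" "u j0"] j1 by (simp add: u'_def)
    next
      case 3
      then show ?thesis using chord2_nonneg by (simp add: u'_def chord2_def[of x x for x])
    qed (simp add: u'_def)
  qed
  have "continuous_on K E"
    unfolding E_def chord2_def
    by (intro continuous_intros continuous_on_subset[OF continuous_on_product_coordinates]) auto
  then obtain v where v: "v \<in> K" "\<And>w. w \<in> K \<Longrightarrow> E v \<le> E w"
    using continuous_attains_inf[of K E] \<open>compact K\<close> u'K by auto
  \<comment> \<open>The minimiser may reach the circle before index \<open>N\<close>; dropping the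
    later edges does not increase the energy.\<close>
  define N' where "N' = (LEAST j. R \<le> norm (v j))"
  have vK: "v i \<in> A i" for i using v(1) by (auto simp: K_def)
  have v0: "v 0 = a" using vK[of 0] by (simp add: A_def)
  have vN: "R \<le> norm (v N)" using vK[of N] \<open>N \<noteq> 0\<close> by (simp add: A_def)
  have vR: "norm (v i) \<le> R" for i
    using vK[of i] assms by (auto simp: A_def split: if_splits)
  have N': "R \<le> norm (v N')" "\<And>i. i < N' \<Longrightarrow> norm (v i) < R" "N' \<le> N"
    unfolding N'_def using vN by (auto intro: LeastI Least_le dest: not_less_Least)
  have "N' \<noteq> 0" using N'(1) assms(1) v0 by (metis linorder_not_less)
  show ?thesis
  proof (rule that[of N' v])
    show "norm (v N') = R" using N'(1) vR by (simp add: antisym)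
    have "energy N' v \<le> E v"
      unfolding E_def using N'(3) chord2_nonneg by (intro sum_mono2) auto
    then show "energy N' v \<le> energy N u"
      using v(2)[OF u'K] \<open>E u' \<le> E u\<close> by (simp add: E_def)
    show "stationary (v j) (v (Suc j)) (v (Suc (Suc j)))" if j: "Suc j < N'" for j
    proof (rule critical_point[of _ R])
      show "norm (v (Suc j)) < R" using N' j by simp
      fix y :: 'a assume y: "norm y < R"
      define w where "w = v(Suc j := y)"
      have "w \<in> K"
        unfolding K_def
      proof (rule PiE_I)
        show "w i \<in> A i" for i
        proof (cases "i = Suc j")
          case True
          then show ?thesis using y j N'(3) by (simp add: w_def A_def)
        qed (use vK in \<open>simp add: w_def\<close>)
      qed simp
      then have "E v \<le> E w" by (rule v(2))
      moreover have split: "E x = chord2 (x j) (x (Suc j)) + chord2 (x (Suc j)) (x (Suc (Suc j)))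
          + (\<Sum>i\<in>{..<N} - {j, Suc j}. chord2 (x i) (x (Suc i)))" for x
      proof -
        have "E x = (\<Sum>i\<in>{j, Suc j}. chord2 (x i) (x (Suc i))) + (\<Sum>i\<in>{..<N} - {j, Suc j}. chord2 (x i) (x (Suc i)))"
          unfolding E_def using j N'(3) by (subst sum.subset_diff[of "{j, Suc j}"]) (auto simp: add.commute)
        then show ?thesis by simp
      qed
      moreover have "(\<Sum>i\<in>{..<N} - {j, Suc j}. chord2 (w i) (w (Suc i)))
          = (\<Sum>i\<in>{..<N} - {j, Suc j}. chord2 (v i) (v (Suc i)))"
        by (intro sum.cong) (auto simp: w_def)
      ultimately show "chord2 (v j) (v (Suc j)) + chord2 (v (Suc j)) (v (Suc (Suc j)))
          \<le> chord2 (v j) y + chord2 y (v (Suc (Suc j)))"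
        by (simp add: w_def)
    qed
  qed (use N' \<open>N' \<noteq> 0\<close> v0 in auto)
qed

text \<open>The support inequality at \<open>b\<close> bounds the remainder by
  \<open>(g b - g x) \<bullet> (b - x)\<close>, so the Lipschitz bound on \<open>g\<close> replaces
  a Taylor expansion.\<close>

lemma first_order_remainder:
  assumes L: "\<And>x y. x \<in> cball 0 r \<Longrightarrow> y \<in> cball 0 r \<Longrightarrow> norm (g x - g y) \<le> L * norm (x - y)"
    and "norm x \<le> r" "norm b \<le> r"
  shows "f b - f x - g x \<bullet> (b - x) \<le> L * (norm (b - x))\<^sup>2"
proof -
  have "f b - f x - g x \<bullet> (b - x) \<le> (g b - g x) \<bullet> (b - x)"
    using convex[of b x] by (simp add: inner_diff_left inner_diff_right)
  also have "\<dots> \<le> norm (g b - g x) * norm (b - x)" by (rule norm_cauchy_schwarz)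
  also have "\<dots> \<le> L * norm (b - x) * norm (b - x)"
    using L[of b x] assms(2,3) by (intro mult_right_mono) auto
  finally show ?thesis by (simp add: power2_eq_square)
qed

text \<open>Pairing the critical equation with \<open>g x\<close> gives
  \<open>k * (1 - (norm (g x))^2)\<close> as the sum of the two first order remainders at
  \<open>x\<close>. These are nonnegative by convexity and quadratic in the steps, and the factor is
  at least \<open>\<kappa>^2\<close>. The sign of \<open>k\<close> is the future direction of the
  acceleration.\<close>

lemma second_difference_bound:
  obtains M where "0 < M"
    "\<And>a x b. norm a \<le> r \<Longrightarrow> norm x \<le> r \<Longrightarrow> norm b \<le> r \<Longrightarrow> stationary a x b \<Longrightarrow>
       0 \<le> f a + f b - 2 * f x \<and>
       f a + f b - 2 * f x \<le> M * ((norm (x - a))\<^sup>2 + (norm (b - x))\<^sup>2)"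
proof -
  obtain \<kappa> where \<kappa>: "0 < \<kappa>" "\<And>a. a \<in> cball 0 r \<Longrightarrow> \<kappa>\<^sup>2 \<le> 1 - (norm (g a))\<^sup>2"
    by (rule disc_bound[of r]) blast
  obtain L where L: "L > 0" "\<And>x y. x \<in> cball 0 r \<Longrightarrow> y \<in> cball 0 r \<Longrightarrow> norm (g x - g y) \<le> L * norm (x - y)"
    using gradient_lipschitz[of r] by blast
  show ?thesis
  proof (rule that[of "L / \<kappa>\<^sup>2"])
    show "0 < L / \<kappa>\<^sup>2" using L \<kappa> by simp
    fix a x b :: 'a
    assume r: "norm a \<le> r" "norm x \<le> r" "norm b \<le> r" and st: "stationary a x b"
    define k where "k = f a + f b - 2 * f x"
    have eq: "a + b - 2 *\<^sub>R x = k *\<^sub>R g x" using st by (simp add: stationary_def k_def)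
    have "k * (norm (g x))\<^sup>2 = g x \<bullet> (a + b - 2 *\<^sub>R x)"
      unfolding eq by (simp add: power2_norm_eq_inner)
    also have "\<dots> = g x \<bullet> (b - x) + g x \<bullet> (a - x)" by (simp add: inner_simps)
    finally have *: "k * (1 - (norm (g x))\<^sup>2) = (f b - f x - g x \<bullet> (b - x)) + (f a - f x - g x \<bullet> (a - x))"
      by (simp add: k_def algebra_simps)
    have low: "\<kappa>\<^sup>2 \<le> 1 - (norm (g x))\<^sup>2" using \<kappa>(2) r by auto
    have "0 < \<kappa>\<^sup>2" using \<kappa> by simp
    have "0 \<le> k * (1 - (norm (g x))\<^sup>2)" unfolding * using convex[of x b] convex[of x a] by simp
    then have "0 \<le> k" using low \<open>0 < \<kappa>\<^sup>2\<close> by (simp add: zero_le_mult_iff)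
    have "k * \<kappa>\<^sup>2 \<le> k * (1 - (norm (g x))\<^sup>2)" using low \<open>0 \<le> k\<close> by (rule mult_left_mono)
    also have "\<dots> \<le> L * ((norm (x - a))\<^sup>2 + (norm (b - x))\<^sup>2)"
      unfolding * using first_order_remainder[of r L x b, OF L(2)] first_order_remainder[of r L x a, OF L(2)] r
      by (simp add: norm_minus_commute algebra_simps)
    finally show "0 \<le> f a + f b - 2 * f x \<and>
        f a + f b - 2 * f x \<le> L / \<kappa>\<^sup>2 * ((norm (x - a))\<^sup>2 + (norm (b - x))\<^sup>2)"
      unfolding k_def[symmetric] using \<open>0 \<le> k\<close> \<open>0 < \<kappa>\<^sup>2\<close> by (simp add: field_simps)
  qed
qed

text \<open>The chain version of the intrinsic distance from \<open>a\<close> to the exterior of the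
  disc of radius \<open>r\<close>.\<close>

definition exit_length :: "'a \<Rightarrow> real \<Rightarrow> real" where
  "exit_length a r = Inf {L. \<exists>b. chain a b L \<and> r \<le> norm b}"

lemma exit_length_le:
  assumes "chain a b L" "r \<le> norm b"
  shows "exit_length a r \<le> L"
  unfolding exit_length_def
  using assms chain_nonneg by (intro cInf_lower bdd_belowI[of _ 0]) auto

lemma exit_set_nonempty: "{L. \<exists>b. chain a b L \<and> r \<le> norm b} \<noteq> {}"
proof -
  obtain b :: 'a where "norm b = \<bar>r\<bar>" using vector_choose_size[of "\<bar>r\<bar>"] by auto
  then have "r \<le> norm b" by linarith
  then show ?thesis using chain_single[of a b] by blast
qed

lemma exit_length_approx:
  assumes "exit_length a r < l"
  obtains b L where "chain a b L" "r \<le> norm b" "L < l"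
proof -
  have "bdd_below {L. \<exists>b. chain a b L \<and> r \<le> norm b}"
    using chain_nonneg by (intro bdd_belowI[of _ 0]) auto
  then show ?thesis
    using assms that cInf_less_iff[OF exit_set_nonempty] unfolding exit_length_def by blast
qed

lemma exit_length_mono: "r \<le> r' \<Longrightarrow> exit_length a r \<le> exit_length a r'"
  unfolding exit_length_def[of a r']
  by (intro cInf_greatest exit_set_nonempty) (auto intro: exit_length_le order_trans)

lemma exit_length_pos: "norm a + 1 \<le> r \<Longrightarrow> 0 < exit_length a r"
proof -
  assume r: "norm a + 1 \<le> r"
  obtain \<kappa> where \<kappa>: "0 < \<kappa>"
    "\<And>x b L. chain x b L \<Longrightarrow> norm x \<le> norm a \<Longrightarrow> \<kappa> * min 1 (norm (b - x)) \<le> L"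
    by (rule chain_lower_bound[of "norm a"]) blast
  have "\<kappa> \<le> exit_length a r"
    unfolding exit_length_def
  proof (intro cInf_greatest exit_set_nonempty)
    fix L assume "L \<in> {L. \<exists>b. chain a b L \<and> r \<le> norm b}"
    then obtain b where b: "chain a b L" "r \<le> norm b" by blast
    then have "1 \<le> norm (b - a)" using r norm_triangle_ineq2[of b a] by linarith
    then show "\<kappa> \<le> L" using \<kappa>(2)[OF b(1)] by simp
  qed
  then show ?thesis using \<kappa>(1) by linarith
qed

text \<open>The bound on the energy alone makes every single chord short; the bound on
  \<open>N * energy\<close> says that Cauchy-Schwarz and the minimality of the length are both
  equalities up to \<open>\<epsilon>\<close>.\<close>

definition near_optimal :: "'a \<Rightarrow> real \<Rightarrow> real \<Rightarrow> nat \<Rightarrow> (nat \<Rightarrow> 'a) \<Rightarrow> bool" where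
  "near_optimal a R \<epsilon> N u \<longleftrightarrow> 0 < N \<and> u 0 = a \<and> norm (u N) = R \<and>
    energy N u \<le> \<epsilon> \<and>
    real N * energy N u \<le> (exit_length a R + \<epsilon>)\<^sup>2 \<and>
    (\<forall>j. Suc j < N \<longrightarrow> stationary (u j) (u (Suc j)) (u (Suc (Suc j))))"

lemma near_optimal_polygon:
  assumes "norm a < R" "0 < \<epsilon>"
  shows "\<exists>N u. near_optimal a R \<epsilon> N u"
proof -
  obtain b L where L: "chain a b L" "R \<le> norm b" "L < exit_length a R + \<epsilon> / 2"
    using exit_length_approx[of a R "exit_length a R + \<epsilon> / 2"] assms(2) by auto
  obtain M :: nat where M: "\<And>h. h > 0 \<Longrightarrow> \<exists>N u. u 0 = a \<and> u N = b \<and>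
     energy N u \<le> h * L \<and> real N * h \<le> L + real M * h"
    using chain_polygon[OF L(1)] by blast
  have L0: "0 \<le> L" using chain_nonneg[OF L(1)] .
  \<comment> \<open>The first entry keeps the energy \<open>h * L\<close> below
    \<open>\<epsilon>\<close>; the second keeps the rounding term \<open>M * h\<close> below
    \<open>\<epsilon> / 2\<close>, the other half having been spent on \<open>L\<close>.\<close>
  define h where "h = min (\<epsilon> / (L + 1)) (\<epsilon> / (2 * (real M + 1)))"
  have h: "0 < h" using assms L0 by (simp add: h_def)
  have "h \<le> \<epsilon> / (L + 1)" by (simp add: h_def)
  then have "h * (L + 1) \<le> \<epsilon>" using L0 by (subst (asm) pos_le_divide_eq) auto
  then have hL: "h * L \<le> \<epsilon>" using h by (simp add: algebra_simps)
  have "h \<le> \<epsilon> / (2 * (real M + 1))" by (simp add: h_def)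
  then have "h * (2 * (real M + 1)) \<le> \<epsilon>" by (subst (asm) pos_le_divide_eq) auto
  then have hM: "real M * h \<le> \<epsilon> / 2" using h by (simp add: algebra_simps)
  obtain N u where u: "u 0 = a" "u N = b" "energy N u \<le> h * L"
      "real N * h \<le> L + real M * h" using M[OF h] by blast
  have "R \<le> norm (u N)" using u L by simp
  then obtain N' v where v:
    "0 < N'" "v 0 = a" "norm (v N') = R" "\<And>j. j < N' \<Longrightarrow> norm (v j) < R" "N' \<le> N"
    "energy N' v \<le> energy N u"
    "\<And>j. Suc j < N' \<Longrightarrow> stationary (v j) (v (Suc j)) (v (Suc (Suc j)))"
    using energy_minimizer[of a R u N] assms(1) u(1) by blast
  define E where "E = energy N' v"
  have E: "E \<le> h * L" "0 \<le> E" using v(6) u(3) by (auto simp: E_def intro: sum_nonneg chord2_nonneg)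
  have "real N' * E \<le> real N * (h * L)"
    using E v(5) by (intro mult_mono) auto
  also have "\<dots> \<le> (L + real M * h) * L"
    using mult_right_mono[OF u(4) L0] by (simp add: mult.assoc)
  also have "\<dots> \<le> (exit_length a R + \<epsilon>) * (exit_length a R + \<epsilon>)"
    using L L0 hM h assms by (intro mult_mono) auto
  finally have "real N' * E \<le> (exit_length a R + \<epsilon>)\<^sup>2" by (simp add: power2_eq_square)
  moreover have "E \<le> \<epsilon>" using E hL by simp
  ultimately show ?thesis using v unfolding E_def near_optimal_def by blast
qed

text \<open>An integrated geodesic equation: \<open>y\<close> is Lipschitz and is the velocity of
  \<open>x\<close>, its change is normal to the surface up to second order, and the change of the
  lifted velocity is future causal. Only closed inequalities between values occur, so the property
  passes to pointwise limits.\<close>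

definition geodesic_increment :: "real \<Rightarrow> (real \<Rightarrow> 'a) \<Rightarrow> (real \<Rightarrow> 'a) \<Rightarrow> real \<Rightarrow> real \<Rightarrow> bool" where
  "geodesic_increment K x y s t \<longleftrightarrow>
     norm (y t - y s) \<le> K * (t - s) \<and>
     norm (x t - x s - (t - s) *\<^sub>R y s) \<le> K * (t - s)\<^sup>2 \<and>
     norm (y t - y s - (g (x t) \<bullet> y t - g (x s) \<bullet> y s) *\<^sub>R g (x s)) \<le> K * (t - s)\<^sup>2 \<and>
     norm (y t - y s) \<le> g (x t) \<bullet> y t - g (x s) \<bullet> y s"

end

section \<open>Limits of energy minimising polygons\<close>

text \<open>Vertex \<open>j\<close> of the \<open>n\<close>-th polygon stands for time
  \<open>j * h n\<close>. \<open>stays_bounded\<close> gives compactness before each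
  \<open>\<tau> < T\<close>; \<open>escapes\<close> is what forces the limit to leave every
  disc.\<close>

locale geodesic_approximation = convex_spacelike_graph f g H
  for f :: "'a::euclidean_space \<Rightarrow> real" and g H +
  fixes T D :: real and N :: "nat \<Rightarrow> nat" and u :: "nat \<Rightarrow> nat \<Rightarrow> 'a" and h e :: "nat \<Rightarrow> real"
  assumes T_pos: "0 < T" and h_pos: "\<And>n. 0 < h n" and h_lim: "h \<longlonglongrightarrow> 0"
    and critical: "\<And>n j. Suc j < N n \<Longrightarrow> stationary (u n j) (u n (Suc j)) (u n (Suc (Suc j)))"
    and stays_bounded: "\<And>\<tau>. \<tau> < T \<Longrightarrow>
       \<exists>r. \<forall>\<^sub>F n in sequentially. \<forall>j. real j * h n \<le> \<tau> \<longrightarrow> j < N n \<and> norm (u n j) \<le> r"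
    and escapes: "\<And>r. \<exists>\<delta>>0. \<forall>\<^sub>F n in sequentially. \<forall>j\<le>N n. norm (u n j) \<le> r \<longrightarrow> real j * h n \<le> T - \<delta>"
    and length_bound: "\<And>n. polygon_length (N n) (u n) \<le> D"
    and e_lim: "e \<longlonglongrightarrow> 0" and small_steps: "\<And>n j. j < N n \<Longrightarrow> chord2 (u n j) (u n (Suc j)) \<le> e n"
begin

definition du :: "nat \<Rightarrow> nat \<Rightarrow> 'a" where "du n j = u n (Suc j) - u n j"
definition df :: "nat \<Rightarrow> nat \<Rightarrow> real" where "df n j = f (u n (Suc j)) - f (u n j)"

lemma second_difference: "Suc j < N n \<Longrightarrow> du n (Suc j) - du n j = (df n (Suc j) - df n j) *\<^sub>R g (u n (Suc j))"
  using critical[of j n] by (simp add: stationary_def du_def df_def algebra_simps scaleR_2)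

text \<open>\<open>V\<close> bounds the velocity and \<open>M\<close> the acceleration. The last
  clause is guarded because it concerns the step after the next vertex, which may lie beyond
  \<open>\<tau>\<close>.\<close>

definition controlled_step :: "nat \<Rightarrow> real \<Rightarrow> real \<Rightarrow> real \<Rightarrow> real \<Rightarrow> nat \<Rightarrow> bool" where
  "controlled_step n \<tau> r V M j \<longleftrightarrow>
     Suc j < N n \<and> norm (u n j) \<le> r \<and> norm (u n (Suc j)) \<le> r \<and> norm (du n j) \<le> V * h n \<and>
     (real (Suc j) * h n \<le> \<tau> \<longrightarrow> 0 \<le> df n (Suc j) - df n j \<and> df n (Suc j) - df n j \<le> M * (h n)\<^sup>2)"

text \<open>The total length controls only the average step. Since a critical polygon changes its
  step by at most a quadratic amount, \<open>discrete_growth\<close> turns the average bound into a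
  pointwise one.\<close>

lemma velocity_bound:
  assumes \<tau>: "0 < \<tau>" "\<tau> < T"
  obtains r V M where "0 \<le> V" "0 \<le> M"
    "\<forall>\<^sub>F n in sequentially. \<forall>j. real j * h n \<le> \<tau> \<longrightarrow> controlled_step n \<tau> r V M j"
proof -
  \<comment> \<open>The margin up to \<open>\<tau>'\<close> keeps the vertex after the last one
    before \<open>\<tau>\<close> in the same disc.\<close>
  define \<tau>' where "\<tau>' = (\<tau> + T) / 2"
  have \<tau>': "\<tau> < \<tau>'" "\<tau>' < T" using \<tau> by (auto simp: \<tau>'_def)
  obtain r where r: "\<forall>\<^sub>F n in sequentially. \<forall>j. real j * h n \<le> \<tau>' \<longrightarrow> j < N n \<and> norm (u n j) \<le> r"
    using stays_bounded[OF \<tau>'(2)] by blast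
  obtain \<kappa> where \<kappa>: "0 < \<kappa>"
    "\<And>a b. a \<in> cball 0 r \<Longrightarrow> b \<in> cball 0 r \<Longrightarrow> \<kappa>\<^sup>2 * (norm (b - a))\<^sup>2 \<le> chord2 a b"
    by (rule disc_bound[of r]) blast
  obtain M where M: "0 < M"
    "\<And>a x b. norm a \<le> r \<Longrightarrow> norm x \<le> r \<Longrightarrow> norm b \<le> r \<Longrightarrow> stationary a x b \<Longrightarrow>
       0 \<le> f a + f b - 2 * f x \<and>
       f a + f b - 2 * f x \<le> M * ((norm (x - a))\<^sup>2 + (norm (b - x))\<^sup>2)"
    by (rule second_difference_bound[of r]) blast
  define B where "B = D / \<kappa>"
  \<comment> \<open>\<open>B\<close> bounds the Euclidean length of the base polygon.
    \<open>discrete_growth\<close> bounds a step by \<open>B * exp (4 * M * B) / Suc m\<close>, and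
    \<open>Suc m * h n\<close> exceeds \<open>\<tau>\<close>.\<close>
  define V where "V = B * exp (4 * M * B) / \<tau>"
  have D0: "0 \<le> D" by (rule order_trans[OF sum_nonneg length_bound[of 0]]) (simp add: chord_nonneg)
  have V0: "0 \<le> V" unfolding V_def B_def using D0 \<kappa> \<tau> by simp
  have "\<forall>\<^sub>F n in sequentially. h n < \<tau>' - \<tau>"
    using h_lim \<tau>' by (intro order_tendstoD) auto
  \<comment> \<open>This threshold makes every step satisfy the smallness hypothesis
    \<open>M * d i \<le> 1/2\<close> of \<open>discrete_growth\<close>.\<close>
  moreover have "\<forall>\<^sub>F n in sequentially. e n < (\<kappa> / (2 * M))\<^sup>2"
    using e_lim \<kappa> M by (intro order_tendstoD) auto
  ultimately have "\<forall>\<^sub>F n in sequentially. \<forall>j. real j * h n \<le> \<tau> \<longrightarrow> controlled_step n \<tau> r V (2 * M * V\<^sup>2) j"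
    using r
  proof eventually_elim
    case (elim n)
    define m where "m = nat \<lfloor>\<tau> / h n\<rfloor>"
    have m: "real j * h n \<le> \<tau> \<longleftrightarrow> j \<le> m" for j
      using h_pos[of n] \<tau> unfolding m_def
      by (simp add: le_nat_iff le_floor_iff pos_le_divide_eq)
    have "\<tau> < real (Suc m) * h n" using m[of "Suc m"] by simp
    have in_disc: "Suc j < N n \<and> norm (u n j) \<le> r \<and> norm (u n (Suc j)) \<le> r" if "j \<le> m" for j
    proof -
      have "real j * h n \<le> \<tau>" using that m by blast
      then have "real (Suc j) * h n \<le> \<tau>'" "real j * h n \<le> \<tau>'"
        using elim(1) h_pos[of n] by (auto simp: algebra_simps)
      then show ?thesis using elim(3) by blast
    qed
    have d_chord: "\<kappa> * norm (du n j) \<le> chord (u n j) (u n (Suc j))" if "j \<le> m" for j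
      unfolding chord_def du_def using in_disc[OF that] \<kappa>(2)[of "u n j" "u n (Suc j)"]
      by (intro real_le_rsqrt) (simp add: power_mult_distrib)
    have small: "M * norm (du n j) \<le> 1/2" if "j \<le> m" for j
    proof -
      have "(chord (u n j) (u n (Suc j)))\<^sup>2 \<le> (\<kappa> / (2 * M))\<^sup>2"
        using small_steps[of j n] in_disc[OF that] elim(2) by (simp add: chord_power2)
      then have "chord (u n j) (u n (Suc j)) \<le> \<kappa> / (2 * M)"
        by (rule power2_le_imp_le) (use \<kappa> M in simp)
      then have "\<kappa> * norm (du n j) \<le> \<kappa> / (2 * M)" using d_chord[OF that] by linarith
      then show ?thesis using \<kappa> M by (simp add: field_simps)
    qed
    have k: "0 \<le> df n (Suc j) - df n j"
      "df n (Suc j) - df n j \<le> M * ((norm (du n j))\<^sup>2 + (norm (du n (Suc j)))\<^sup>2)" if "Suc j \<le> m" for j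
      using M(2)[of "u n j" "u n (Suc j)" "u n (Suc (Suc j))", OF _ _ _ critical[of j n]]
        in_disc[of j] in_disc[of "Suc j"] that by (auto simp: df_def du_def)
    have "\<bar>norm (du n (Suc j)) - norm (du n j)\<bar> \<le> M * ((norm (du n j))\<^sup>2 + (norm (du n (Suc j)))\<^sup>2)"
      if "Suc j \<le> m" for j
    proof -
      have "\<bar>norm (du n (Suc j)) - norm (du n j)\<bar> \<le> norm (du n (Suc j) - du n j)"
        by (rule norm_triangle_ineq3)
      also have "\<dots> = (df n (Suc j) - df n j) * norm (g (u n (Suc j)))"
        using second_difference[of j n] in_disc[of j] that k(1)[OF that] by simp
      also have "\<dots> \<le> (df n (Suc j) - df n j) * 1"
        using spacelike[of "u n (Suc j)"] k(1)[OF that] by (intro mult_left_mono) auto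
      also have "\<dots> \<le> M * ((norm (du n j))\<^sup>2 + (norm (du n (Suc j)))\<^sup>2)"
        using k(2)[OF that] by simp
      finally show ?thesis .
    qed
    moreover have "(\<Sum>j\<le>m. norm (du n j)) \<le> B"
    proof -
      have "\<kappa> * (\<Sum>j\<le>m. norm (du n j)) \<le> (\<Sum>j\<le>m. chord (u n j) (u n (Suc j)))"
        unfolding sum_distrib_left using d_chord by (intro sum_mono) auto
      also have "\<dots> \<le> polygon_length (N n) (u n)"
        using in_disc by (intro sum_mono2) (auto simp: chord_nonneg dest: Suc_lessD)
      finally have "\<kappa> * (\<Sum>j\<le>m. norm (du n j)) \<le> D" using length_bound[of n] by linarith
      then show ?thesis using \<kappa> by (simp add: B_def field_simps)
    qed
    ultimately have growth: "real (Suc m) * norm (du n j) \<le> B * exp (4 * M * B)" if "j \<le> m" for j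
      using M small that by (intro discrete_growth[of m "\<lambda>j. norm (du n j)"]) auto
    have vel: "norm (du n j) \<le> V * h n" if "j \<le> m" for j
    proof -
      have "\<tau> * norm (du n j) \<le> real (Suc m) * h n * norm (du n j)"
        using \<open>\<tau> < real (Suc m) * h n\<close> by (intro mult_right_mono) auto
      also have "\<dots> \<le> h n * (B * exp (4 * M * B))"
        using mult_left_mono[OF growth[OF that], of "h n"] h_pos[of n] by (simp add: mult_ac)
      finally show ?thesis using \<tau> by (simp add: V_def field_simps)
    qed
    have acc: "df n (Suc j) - df n j \<le> 2 * M * V\<^sup>2 * (h n)\<^sup>2" if "Suc j \<le> m" for j
    proof -
      have "(norm (du n j))\<^sup>2 \<le> (V * h n)\<^sup>2" "(norm (du n (Suc j)))\<^sup>2 \<le> (V * h n)\<^sup>2"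
        using vel that by (auto intro!: power_mono)
      then have "M * ((norm (du n j))\<^sup>2 + (norm (du n (Suc j)))\<^sup>2) \<le> M * (2 * (V * h n)\<^sup>2)"
        using M by (intro mult_left_mono) auto
      then show ?thesis using k(2)[OF that] by (simp add: power_mult_distrib)
    qed
    show ?case unfolding m controlled_step_def using in_disc vel k(1) acc by blast
  qed
  then show ?thesis using that[of V "2 * M * V\<^sup>2" r] V0 M(1) by simp
qed

text \<open>The discrete form of \<open>geodesic_increment\<close>. As \<open>du\<close> is the
  velocity times the time step, the velocity clauses carry an extra factor \<open>h n\<close>; the
  last clause identifies the vertical velocity with \<open>g \<bullet> y\<close> in the
  limit.\<close>

definition near_geodesic :: "nat \<Rightarrow> real \<Rightarrow> real \<Rightarrow> nat \<Rightarrow> nat \<Rightarrow> bool" where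
  "near_geodesic n r K i j \<longleftrightarrow>
     norm (u n j) \<le> r \<and> norm (du n j) \<le> K * h n \<and>
     norm (u n j - u n i) \<le> K * (real (j - i) * h n) \<and>
     norm (du n j - du n i) \<le> K * h n * (real (j - i) * h n) \<and>
     norm (u n j - u n i - real (j - i) *\<^sub>R du n i) \<le> K * (real (j - i) * h n)\<^sup>2 \<and>
     norm (du n j - du n i - (df n j - df n i) *\<^sub>R g (u n i)) \<le> K * h n * (real (j - i) * h n)\<^sup>2 \<and>
     norm (du n j - du n i) \<le> df n j - df n i \<and>
     \<bar>df n j - g (u n j) \<bullet> du n j\<bar> \<le> K * (h n)\<^sup>2"

text \<open>Each step adds \<open>k\<close> times the gradient at the new vertex, with
  \<open>0 \<le> k \<le> M * (h n)^2\<close>. Summing from \<open>i\<close> bounds the change of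
  velocity, as gradients have norm below 1; replacing them by the gradient at vertex
  \<open>i\<close> costs \<open>k\<close> times the Lipschitz constant times the
  displacement.\<close>

lemma discrete_bounds:
  assumes \<tau>: "0 < \<tau>" "\<tau> < T"
  obtains r K where "0 < K"
    "\<forall>\<^sub>F n in sequentially. \<forall>i j. i \<le> j \<longrightarrow> real j * h n \<le> \<tau> \<longrightarrow> near_geodesic n r K i j"
proof -
  obtain r V M where VM: "0 \<le> V" "0 \<le> M" and ev:
    "\<forall>\<^sub>F n in sequentially. \<forall>j. real j * h n \<le> \<tau> \<longrightarrow> controlled_step n \<tau> r V M j"
    by (rule velocity_bound[OF \<tau>])
  obtain L where L: "L > 0" "\<And>x y. x \<in> cball 0 r \<Longrightarrow> y \<in> cball 0 r \<Longrightarrow> norm (g x - g y) \<le> L * norm (x - y)"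
    using gradient_lipschitz[of r] by blast
  define K where "K = V + M + M * L * V + L * V\<^sup>2 + 1"
  have nonneg: "0 \<le> M * L * V" "0 \<le> L * V\<^sup>2" using VM L by auto
  then have K: "0 < K" "V \<le> K" "M \<le> K" "M * L * V \<le> K" "L * V\<^sup>2 \<le> K"
    unfolding K_def using VM by linarith+
  show ?thesis
  proof (rule that[OF K(1)], rule eventually_mono[OF ev], intro allI impI)
    fix n i j
    assume *: "\<forall>j. real j * h n \<le> \<tau> \<longrightarrow> controlled_step n \<tau> r V M j"
      and ij: "i \<le> j" and j: "real j * h n \<le> \<tau>"
    have hn: "0 < h n" by (rule h_pos)
    have le: "real l * h n \<le> \<tau>" if "l \<le> j" for l
      using mult_right_mono[of "real l" "real j" "h n"] that hn j by linarith
    have k: "0 \<le> df n (Suc l) - df n l" "df n (Suc l) - df n l \<le> M * (h n)\<^sup>2"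
      "du n (Suc l) - du n l = (df n (Suc l) - df n l) *\<^sub>R g (u n (Suc l))" if "Suc l \<le> j" for l
      using *[rule_format, of l, unfolded controlled_step_def] le[of l] le[of "Suc l"] second_difference[of l n] that by auto
    have main: "i \<le> l \<Longrightarrow> l \<le> j \<Longrightarrow>
       norm (u n l - u n i) \<le> V * (real (l - i) * h n) \<and>
       df n l - df n i \<le> M * h n * (real (l - i) * h n) \<and>
       norm (du n l - du n i) \<le> df n l - df n i \<and>
       norm (u n l - u n i - real (l - i) *\<^sub>R du n i) \<le> M * (real (l - i) * h n)\<^sup>2 \<and>
       norm (du n l - du n i - (df n l - df n i) *\<^sub>R g (u n i)) \<le> (M * L * V) * h n * (real (l - i) * h n)\<^sup>2" for l
    proof (induction l rule: dec_induct)
      case base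
      then show ?case by simp
    next
      case (step l)
      define d where "d = real (l - i)"
      have d: "0 \<le> d" "real (Suc l - i) = d + 1" using step.hyps by (auto simp: d_def of_nat_diff)
      define k where "k = df n (Suc l) - df n l"
      have kk: "0 \<le> k" "k \<le> M * (h n)\<^sup>2" "du n (Suc l) = du n l + k *\<^sub>R g (u n (Suc l))"
        using k[of l] step.prems unfolding k_def by (auto simp: algebra_simps)
      have u': "u n (Suc l) = u n l + du n l" by (simp add: du_def)
      have df': "df n (Suc l) = df n l + k" by (simp add: k_def)
      note IH = step.IH[OF Suc_leD[OF step.prems], folded d_def]
      have vl: "norm (du n l) \<le> V * h n" and rl: "norm (u n (Suc l)) \<le> r" "norm (u n i) \<le> r"
        using *[rule_format, of l, unfolded controlled_step_def] *[rule_format, of i, unfolded controlled_step_def] le[of l] le[of i] step.prems step.hyps by auto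
      have 1: "norm (u n (Suc l) - u n i) \<le> V * ((d + 1) * h n)"
      proof -
        have "norm (u n (Suc l) - u n i) \<le> norm (u n l - u n i) + norm (du n l)"
          unfolding u' using norm_triangle_ineq[of "u n l - u n i" "du n l"] by (simp add: algebra_simps)
        also have "\<dots> \<le> V * (d * h n) + V * h n" using IH vl by (intro add_mono) auto
        finally show ?thesis by (simp add: algebra_simps)
      qed
      have 2: "df n (Suc l) - df n i \<le> M * h n * ((d + 1) * h n)"
        using IH kk unfolding df' by (simp add: power2_eq_square algebra_simps)
      have 3: "norm (du n (Suc l) - du n i) \<le> df n (Suc l) - df n i"
      proof -
        have "norm (du n (Suc l) - du n i) \<le> norm (du n l - du n i) + norm (k *\<^sub>R g (u n (Suc l)))"
          unfolding kk(3) using norm_triangle_ineq[of "du n l - du n i" "k *\<^sub>R g (u n (Suc l))"]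
          by (simp add: algebra_simps)
        moreover have "norm (k *\<^sub>R g (u n (Suc l))) \<le> k * 1"
          using kk(1) spacelike[of "u n (Suc l)"] by (simp add: mult_left_le)
        ultimately show ?thesis using IH unfolding df' by linarith
      qed
      have 4: "norm (u n (Suc l) - u n i - (d + 1) *\<^sub>R du n i) \<le> M * ((d + 1) * h n)\<^sup>2"
      proof -
        have "norm (u n (Suc l) - u n i - (d + 1) *\<^sub>R du n i)
            \<le> norm (u n l - u n i - d *\<^sub>R du n i) + norm (du n l - du n i)"
          unfolding u' using norm_triangle_ineq[of "u n l - u n i - d *\<^sub>R du n i" "du n l - du n i"]
          by (simp add: algebra_simps)
        also have "\<dots> \<le> M * (d * h n)\<^sup>2 + M * h n * (d * h n)"
          using IH by (intro add_mono) auto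
        also have "\<dots> \<le> M * ((d + 1) * h n)\<^sup>2"
          using VM d hn by (simp add: power2_eq_square algebra_simps)
        finally show ?thesis .
      qed
      have 5: "norm (du n (Suc l) - du n i - (df n (Suc l) - df n i) *\<^sub>R g (u n i))
          \<le> (M * L * V) * h n * ((d + 1) * h n)\<^sup>2"
      proof -
        have "norm (k *\<^sub>R (g (u n (Suc l)) - g (u n i))) = k * norm (g (u n (Suc l)) - g (u n i))"
          using kk(1) by simp
        also have "\<dots> \<le> (M * (h n)\<^sup>2) * (L * (V * ((d + 1) * h n)))"
        proof (intro mult_mono)
          have "norm (g (u n (Suc l)) - g (u n i)) \<le> L * norm (u n (Suc l) - u n i)"
            using L(2) rl by simp
          also have "\<dots> \<le> L * (V * ((d + 1) * h n))" using 1 L(1) by (intro mult_left_mono) auto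
          finally show "norm (g (u n (Suc l)) - g (u n i)) \<le> L * (V * ((d + 1) * h n))" .
        qed (use kk VM in auto)
        finally have a: "norm (k *\<^sub>R (g (u n (Suc l)) - g (u n i))) \<le> (M * L * V) * h n * ((d + 1) * (h n)\<^sup>2)"
          by (simp add: power2_eq_square mult_ac)
        have "norm (du n (Suc l) - du n i - (df n (Suc l) - df n i) *\<^sub>R g (u n i))
          \<le> norm (du n l - du n i - (df n l - df n i) *\<^sub>R g (u n i)) + norm (k *\<^sub>R (g (u n (Suc l)) - g (u n i)))"
          unfolding kk(3) df'
          using norm_triangle_ineq[of "du n l - du n i - (df n l - df n i) *\<^sub>R g (u n i)" "k *\<^sub>R (g (u n (Suc l)) - g (u n i))"]
          by (simp add: algebra_simps)
        also have "\<dots> \<le> (M * L * V) * h n * (d * h n)\<^sup>2 + (M * L * V) * h n * ((d + 1) * (h n)\<^sup>2)"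
          using IH a by (intro add_mono) auto
        also have "\<dots> = (M * L * V) * h n * (((d * h n)\<^sup>2 + (d + 1) * (h n)\<^sup>2))" by (simp add: algebra_simps)
        also have "\<dots> \<le> (M * L * V) * h n * ((d + 1) * h n)\<^sup>2"
        proof (rule mult_left_mono)
          show "(d * h n)\<^sup>2 + (d + 1) * (h n)\<^sup>2 \<le> ((d + 1) * h n)\<^sup>2"
            using hn d by (simp add: power2_eq_square algebra_simps)
          show "0 \<le> M * L * V * h n" using nonneg(1) hn by (simp only: mult_nonneg_nonneg less_imp_le)
        qed
        finally show ?thesis .
      qed
      show ?case unfolding d(2) using 1 2 3 4 5 by blast
    qed
    have sd: "0 \<le> real (j - i) * h n" using hn by simp
    have "V * (real (j - i) * h n) \<le> K * (real (j - i) * h n)"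
      using K sd by (intro mult_right_mono)
    moreover have "M * h n * (real (j - i) * h n) \<le> K * h n * (real (j - i) * h n)"
      using K sd hn by (intro mult_right_mono) auto
    moreover have "M * (real (j - i) * h n)\<^sup>2 \<le> K * (real (j - i) * h n)\<^sup>2"
      using K by (intro mult_right_mono) auto
    moreover have "(M * L * V) * h n * (real (j - i) * h n)\<^sup>2 \<le> K * h n * (real (j - i) * h n)\<^sup>2"
      using K hn by (intro mult_right_mono) auto
    moreover have "V * h n \<le> K * h n" using K hn by (intro mult_right_mono) auto
    moreover have r: "norm (u n j) \<le> r" "norm (u n (Suc j)) \<le> r" and v: "norm (du n j) \<le> V * h n"
      using *[rule_format, OF j, unfolded controlled_step_def] by blast+
    moreover have "\<bar>df n j - g (u n j) \<bullet> du n j\<bar> \<le> K * (h n)\<^sup>2"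
    proof -
      have "df n j - g (u n j) \<bullet> du n j \<le> L * (norm (du n j))\<^sup>2"
        unfolding df_def du_def by (rule first_order_remainder[OF L(2)]) (use r in auto)
      also have "\<dots> \<le> L * (V * h n)\<^sup>2" using v L by (intro mult_left_mono power_mono) auto
      also have "\<dots> \<le> K * (h n)\<^sup>2"
        using K(5) mult_right_mono[of "L * V\<^sup>2" K "(h n)\<^sup>2"] by (simp add: power_mult_distrib mult.assoc)
      finally show ?thesis using convex[of "u n j" "u n (Suc j)"] by (simp add: df_def du_def)
    qed
    ultimately show "near_geodesic n r K i j"
      unfolding near_geodesic_def using main[OF ij order_refl] by (elim conjE, intro conjI; linarith)
  qed
qed

text \<open>\<open>U\<close>, \<open>Y\<close> and \<open>W\<close> are position, horizontal
  velocity and vertical velocity read off at the last grid time up to \<open>t\<close>. As step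
  functions they inherit the discrete estimates verbatim.\<close>

definition idx :: "nat \<Rightarrow> real \<Rightarrow> nat" where "idx n t = nat \<lfloor>t / h n\<rfloor>"
definition U :: "nat \<Rightarrow> real \<Rightarrow> 'a" where "U n t = u n (idx n t)"
definition Y :: "nat \<Rightarrow> real \<Rightarrow> 'a" where "Y n t = (1 / h n) *\<^sub>R du n (idx n t)"
definition W :: "nat \<Rightarrow> real \<Rightarrow> real" where "W n t = df n (idx n t) / h n"
definition grid :: "nat \<Rightarrow> real \<Rightarrow> real" where "grid n t = real (idx n t) * h n"

lemma grid_bounds:
  assumes "0 \<le> t" shows "grid n t \<le> t" "t - h n \<le> grid n t"
proof -
  have "0 \<le> t / h n" using assms h_pos[of n] by simp
  then have "real (idx n t) \<le> t / h n" "t / h n \<le> real (idx n t) + 1" unfolding idx_def by linarith+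
  then show "grid n t \<le> t" "t - h n \<le> grid n t"
    using h_pos[of n] by (auto simp: grid_def field_simps)
qed

lemma idx_mono: "s \<le> t \<Longrightarrow> idx n s \<le> idx n t"
  unfolding idx_def using h_pos[of n] by (intro nat_mono floor_mono divide_right_mono) auto

lemma grid_tendsto:
  assumes "0 \<le> t" shows "(\<lambda>n. grid n t) \<longlonglongrightarrow> t"
proof (rule tendsto_sandwich[of "\<lambda>n. t - h n" _ _ "\<lambda>_. t"])
  show "(\<lambda>n. t - h n) \<longlonglongrightarrow> t" using tendsto_diff[OF tendsto_const h_lim, of t] by simp
qed (auto simp: grid_bounds assms)

text \<open>Elapsed time is measured between grid times, so no rounding error appears here; it
  disappears in the limit by \<open>grid_tendsto\<close>.\<close>

definition near_geodesic_at :: "nat \<Rightarrow> real \<Rightarrow> real \<Rightarrow> real \<Rightarrow> real \<Rightarrow> bool" where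
  "near_geodesic_at n r K s t \<longleftrightarrow>
     norm (U n t) \<le> r \<and> norm (Y n t) \<le> K \<and>
     norm (U n t - U n s) \<le> K * (grid n t - grid n s) \<and>
     norm (Y n t - Y n s) \<le> K * (grid n t - grid n s) \<and>
     norm (U n t - U n s - (grid n t - grid n s) *\<^sub>R Y n s) \<le> K * (grid n t - grid n s)\<^sup>2 \<and>
     norm (Y n t - Y n s - (W n t - W n s) *\<^sub>R g (U n s)) \<le> K * (grid n t - grid n s)\<^sup>2 \<and>
     norm (Y n t - Y n s) \<le> W n t - W n s \<and>
     \<bar>W n t - g (U n t) \<bullet> Y n t\<bar> \<le> K * h n"

lemma step_bounds:
  assumes "0 < \<tau>" "\<tau> < T"
  obtains r K where "0 < K"
    "\<forall>\<^sub>F n in sequentially. \<forall>s t. 0 \<le> s \<longrightarrow> s \<le> t \<longrightarrow> t \<le> \<tau> \<longrightarrow> near_geodesic_at n r K s t"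
proof -
  obtain r K where K: "0 < K" and ev:
    "\<forall>\<^sub>F n in sequentially. \<forall>i j. i \<le> j \<longrightarrow> real j * h n \<le> \<tau> \<longrightarrow> near_geodesic n r K i j"
    by (rule discrete_bounds[OF assms])
  show ?thesis
  proof (rule that[OF K], rule eventually_mono[OF ev], intro allI impI)
    fix n s t
    assume *: "\<forall>i j. i \<le> j \<longrightarrow> real j * h n \<le> \<tau> \<longrightarrow> near_geodesic n r K i j"
      and st: "0 \<le> s" "s \<le> t" "t \<le> \<tau>"
    define i j where "i = idx n s" and "j = idx n t"
    have hn: "0 < h n" by (rule h_pos)
    have ij: "i \<le> j" unfolding i_def j_def using st by (intro idx_mono)
    have "real j * h n \<le> \<tau>" using grid_bounds(1)[of t n] st by (simp add: grid_def j_def)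
    note B = *[rule_format, OF ij this, unfolded near_geodesic_def]
    have gr: "real (j - i) * h n = grid n t - grid n s"
      using ij by (simp add: grid_def i_def j_def of_nat_diff algebra_simps)
    have du': "du n i = h n *\<^sub>R Y n s" "du n j = h n *\<^sub>R Y n t"
      using hn by (auto simp: Y_def i_def j_def)
    have df': "df n i = h n * W n s" "df n j = h n * W n t"
      using hn by (auto simp: W_def i_def j_def)
    have U': "u n i = U n s" "u n j = U n t" by (auto simp: U_def i_def j_def)
    have "norm (h n *\<^sub>R Y n t) \<le> K * h n" using B du' by simp
    then have 1: "norm (Y n t) \<le> K" using hn by (simp add: mult.commute)
    have "norm (h n *\<^sub>R (Y n t - Y n s)) \<le> h n * (K * (grid n t - grid n s))"
      using B unfolding du' gr by (simp add: scaleR_diff_right mult_ac)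
    then have 2: "norm (Y n t - Y n s) \<le> K * (grid n t - grid n s)" using hn by simp
    have "real (j - i) *\<^sub>R du n i = (grid n t - grid n s) *\<^sub>R Y n s" unfolding du' gr[symmetric] by simp
    then have 3: "norm (U n t - U n s - (grid n t - grid n s) *\<^sub>R Y n s) \<le> K * (grid n t - grid n s)\<^sup>2"
      using B unfolding U' gr by simp
    have "du n j - du n i - (df n j - df n i) *\<^sub>R g (u n i) = h n *\<^sub>R (Y n t - Y n s - (W n t - W n s) *\<^sub>R g (U n s))"
      unfolding du' df' U' by (simp add: algebra_simps)
    then have "norm (h n *\<^sub>R (Y n t - Y n s - (W n t - W n s) *\<^sub>R g (U n s))) \<le> h n * (K * (grid n t - grid n s)\<^sup>2)"
      using B unfolding gr by (simp add: mult_ac)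
    then have 4: "norm (Y n t - Y n s - (W n t - W n s) *\<^sub>R g (U n s)) \<le> K * (grid n t - grid n s)\<^sup>2"
      using hn by simp
    have "norm (h n *\<^sub>R (Y n t - Y n s)) \<le> h n * (W n t - W n s)"
      using B unfolding du' df' by (simp add: scaleR_diff_right right_diff_distrib)
    then have 5: "norm (Y n t - Y n s) \<le> W n t - W n s" using hn by simp
    have "\<bar>h n * (W n t - g (U n t) \<bullet> Y n t)\<bar> \<le> h n * (K * h n)"
      using B unfolding du' df' U' by (simp add: right_diff_distrib power2_eq_square mult_ac)
    then have 6: "\<bar>W n t - g (U n t) \<bullet> Y n t\<bar> \<le> K * h n" using hn by (simp add: abs_mult)
    have "norm (U n t) \<le> r" "norm (U n t - U n s) \<le> K * (grid n t - grid n s)"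
      using B unfolding U' gr by auto
    then show "near_geodesic_at n r K s t"
      unfolding near_geodesic_at_def using 1 2 3 4 5 6 by blast
  qed
qed

text \<open>Positions and velocities converge along one subsequence, and all inequalities are
  preserved.\<close>

lemma limit_curve:
  obtains x y where
    "\<And>\<tau>. 0 < \<tau> \<Longrightarrow> \<tau> < T \<Longrightarrow> \<exists>K. \<forall>s t. 0 \<le> s \<longrightarrow> s \<le> t \<longrightarrow> t \<le> \<tau> \<longrightarrow> geodesic_increment K x y s t"
    "\<And>r. \<exists>\<delta>>0. \<forall>t. 0 \<le> t \<longrightarrow> T - \<delta> < t \<longrightarrow> t < T \<longrightarrow> r \<le> norm (x t)"
proof -
  have bd: "\<exists>B K. 0 < K \<and> (\<forall>\<^sub>F n in sequentially. \<forall>s t. 0 \<le> s \<longrightarrow> s \<le> t \<longrightarrow> t \<le> \<tau> \<longrightarrow>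
      norm (U n t, Y n t) \<le> B \<and> norm ((U n t, Y n t) - (U n s, Y n s)) \<le> K * (t - s + h n))"
    if \<tau>: "0 < \<tau>" "\<tau> < T" for \<tau>
  proof -
    obtain r K where K: "0 < K" and ev:
      "\<forall>\<^sub>F n in sequentially. \<forall>s t. 0 \<le> s \<longrightarrow> s \<le> t \<longrightarrow> t \<le> \<tau> \<longrightarrow> near_geodesic_at n r K s t"
      by (rule step_bounds[OF \<tau>])
    have "\<forall>\<^sub>F n in sequentially. \<forall>s t. 0 \<le> s \<longrightarrow> s \<le> t \<longrightarrow> t \<le> \<tau> \<longrightarrow>
      norm (U n t, Y n t) \<le> r + K \<and> norm ((U n t, Y n t) - (U n s, Y n s)) \<le> (2 * K) * (t - s + h n)"
      using ev
    proof (rule eventually_mono, intro allI impI)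
      fix n s t
      assume *: "\<forall>s t. 0 \<le> s \<longrightarrow> s \<le> t \<longrightarrow> t \<le> \<tau> \<longrightarrow> near_geodesic_at n r K s t" and st: "0 \<le> s" "s \<le> t" "t \<le> \<tau>"
      note B = *[rule_format, OF st, unfolded near_geodesic_at_def]
      have "K * (grid n t - grid n s) \<le> K * (t - s + h n)"
        using grid_bounds[of t n] grid_bounds[of s n] st K by (intro mult_left_mono) auto
      moreover have "norm (U n t, Y n t) \<le> norm (U n t) + norm (Y n t)" by (rule norm_Pair_le)
      moreover have "norm ((U n t, Y n t) - (U n s, Y n s)) \<le> norm (U n t - U n s) + norm (Y n t - Y n s)"
        using norm_Pair_le[of "U n t - U n s" "Y n t - Y n s"] by simp
      ultimately show "norm (U n t, Y n t) \<le> r + K \<and> norm ((U n t, Y n t) - (U n s, Y n s)) \<le> (2 * K) * (t - s + h n)"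
        using B by (simp only: mult.assoc) linarith
    qed
    then show ?thesis using K by (intro exI[of _ "r + K"] exI[of _ "2 * K"]) simp
  qed
  obtain k G where k: "strict_mono k"
    and G: "\<And>t. 0 \<le> t \<Longrightarrow> t < T \<Longrightarrow> (\<lambda>n. (U (k n) t, Y (k n) t)) \<longlonglongrightarrow> G t"
    by (rule pointwise_convergent_subsequence[where F = "\<lambda>n t. (U n t, Y n t)", OF h_lim bd])
      (assumption, assumption, rule that, assumption, blast)
  define x where "x t = fst (G t)" for t
  define y where "y t = snd (G t)" for t
  define w where "w t = g (x t) \<bullet> y t" for t
  have xlim: "(\<lambda>n. U (k n) t) \<longlonglongrightarrow> x t" and ylim: "(\<lambda>n. Y (k n) t) \<longlonglongrightarrow> y t" if "0 \<le> t" "t < T" for t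
    using tendsto_fst[OF G[OF that]] tendsto_snd[OF G[OF that]] by (auto simp: x_def y_def)
  have glim: "(\<lambda>n. g (U (k n) t)) \<longlonglongrightarrow> g (x t)" if "0 \<le> t" "t < T" for t
    by (rule isCont_tendsto_compose[OF has_derivative_continuous[OF has_hessian] xlim[OF that]])
  have dlim: "(\<lambda>n. grid (k n) t) \<longlonglongrightarrow> t" if "0 \<le> t" for t
    using LIMSEQ_subseq_LIMSEQ[OF grid_tendsto[OF that] k] by (simp add: o_def)
  have hlim: "(\<lambda>n. h (k n)) \<longlonglongrightarrow> 0"
    using LIMSEQ_subseq_LIMSEQ[OF h_lim k] by (simp add: o_def)
  have main: "\<exists>K. \<forall>s t. 0 \<le> s \<longrightarrow> s \<le> t \<longrightarrow> t \<le> \<tau> \<longrightarrow> geodesic_increment K x y s t" if \<tau>: "0 < \<tau>" "\<tau> < T" for \<tau>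
  proof -
    obtain r K where K: "0 < K" and ev:
      "\<forall>\<^sub>F n in sequentially. \<forall>s t. 0 \<le> s \<longrightarrow> s \<le> t \<longrightarrow> t \<le> \<tau> \<longrightarrow> near_geodesic_at n r K s t"
      by (rule step_bounds[OF \<tau>])
    note evk = eventually_subseq[OF k ev]
    \<comment> \<open>The vertical velocity needs no compactness of its own: it differs from
      \<open>g \<bullet> y\<close> by at most a multiple of \<open>h\<close>.\<close>
    have wlim: "(\<lambda>n. W (k n) t) \<longlonglongrightarrow> w t" if t: "0 \<le> t" "t \<le> \<tau>" for t
    proof -
      have "(\<lambda>n. W (k n) t - g (U (k n) t) \<bullet> Y (k n) t) \<longlonglongrightarrow> 0"
      proof (rule Lim_null_comparison)
        show "\<forall>\<^sub>F n in sequentially. norm (W (k n) t - g (U (k n) t) \<bullet> Y (k n) t) \<le> K * h (k n)"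
          using evk by eventually_elim (use t in \<open>auto simp: near_geodesic_at_def\<close>)
        show "(\<lambda>n. K * h (k n)) \<longlonglongrightarrow> 0" using tendsto_mult_left[OF hlim, of K] by simp
      qed
      moreover have "(\<lambda>n. g (U (k n) t) \<bullet> Y (k n) t) \<longlonglongrightarrow> w t"
        unfolding w_def using t \<tau> by (intro tendsto_inner glim ylim) auto
      ultimately have "(\<lambda>n. (W (k n) t - g (U (k n) t) \<bullet> Y (k n) t) + g (U (k n) t) \<bullet> Y (k n) t) \<longlonglongrightarrow> 0 + w t"
        by (rule tendsto_add)
      then show ?thesis by simp
    qed
    show ?thesis
    proof (intro exI[of _ K] allI impI)
      fix s t assume st: "0 \<le> s" "s \<le> t" "t \<le> \<tau>"
      have 0: "0 \<le> t" "t < T" "s < T" "s \<le> \<tau>" using st \<tau> by auto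
      note L = xlim[OF st(1) 0(3)] xlim[OF 0(1,2)] ylim[OF st(1) 0(3)] ylim[OF 0(1,2)]
        wlim[OF st(1) 0(4)] wlim[OF 0(1) st(3)] glim[OF st(1) 0(3)] dlim[OF st(1)] dlim[OF 0(1)]
      note le = tendsto_le[OF trivial_limit_sequentially]
      have "\<forall>\<^sub>F n in sequentially. near_geodesic_at (k n) r K s t"
        using evk by eventually_elim (use st in blast)
      then have ev: "\<forall>\<^sub>F n in sequentially. norm (Y (k n) t - Y (k n) s) \<le> K * (grid (k n) t - grid (k n) s)"
        "\<forall>\<^sub>F n in sequentially. norm (U (k n) t - U (k n) s - (grid (k n) t - grid (k n) s) *\<^sub>R Y (k n) s)
          \<le> K * (grid (k n) t - grid (k n) s)\<^sup>2"
        "\<forall>\<^sub>F n in sequentially. norm (Y (k n) t - Y (k n) s - (W (k n) t - W (k n) s) *\<^sub>R g (U (k n) s))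
          \<le> K * (grid (k n) t - grid (k n) s)\<^sup>2"
        "\<forall>\<^sub>F n in sequentially. norm (Y (k n) t - Y (k n) s) \<le> W (k n) t - W (k n) s"
        unfolding near_geodesic_at_def by (auto elim: eventually_mono)
      have 1: "norm (y t - y s) \<le> K * (t - s)"
        by (rule le[OF _ _ ev(1)]) (intro tendsto_intros L)+
      have 2: "norm (x t - x s - (t - s) *\<^sub>R y s) \<le> K * (t - s)\<^sup>2"
        by (rule le[OF _ _ ev(2)]) (intro tendsto_intros L)+
      have 3: "norm (y t - y s - (w t - w s) *\<^sub>R g (x s)) \<le> K * (t - s)\<^sup>2"
        by (rule le[OF _ _ ev(3)]) (intro tendsto_intros L)+
      have 4: "norm (y t - y s) \<le> w t - w s"
        by (rule le[OF _ _ ev(4)]) (intro tendsto_intros L)+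
      show "geodesic_increment K x y s t"
        unfolding geodesic_increment_def w_def[symmetric] using 1 2 3 4 by blast
    qed
  qed
  have esc: "\<exists>\<delta>>0. \<forall>t. 0 \<le> t \<longrightarrow> T - \<delta> < t \<longrightarrow> t < T \<longrightarrow> r \<le> norm (x t)" for r
  proof -
    obtain \<delta> where \<delta>: "\<delta> > 0"
      "\<forall>\<^sub>F n in sequentially. \<forall>j\<le>N n. norm (u n j) \<le> r \<longrightarrow> real j * h n \<le> T - \<delta>"
      using escapes[of r] by blast
    show ?thesis
    proof (intro exI[of _ \<delta>] conjI allI impI \<delta>(1), rule ccontr)
      fix t assume t: "0 \<le> t" "T - \<delta> < t" "t < T" "\<not> r \<le> norm (x t)"
      \<comment> \<open>If the limit were in the disc at such a late time, so would be the vertices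
        at grid times tending to \<open>t > T - \<delta>\<close>, contrary to
        \<open>escapes\<close>.\<close>
      have "\<forall>\<^sub>F n in sequentially. norm (U (k n) t) < r"
        using t by (intro order_tendstoD(2)[OF tendsto_norm[OF xlim]]) auto
      moreover obtain r' where "\<forall>\<^sub>F n in sequentially. \<forall>j. real j * h n \<le> t \<longrightarrow> j < N n \<and> norm (u n j) \<le> r'"
        using stays_bounded[OF t(3)] by blast
      note eventually_subseq[OF k this] eventually_subseq[OF k \<delta>(2)]
      ultimately have "\<forall>\<^sub>F n in sequentially. grid (k n) t \<le> T - \<delta>"
      proof eventually_elim
        case (elim n)
        then show ?case
          using grid_bounds(1)[OF t(1), of "k n"] by (auto simp: U_def grid_def less_imp_le)
      qed
      then have "t \<le> T - \<delta>"
        by (intro tendsto_upperbound[OF dlim[OF t(1)]]) auto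
      then show False using t by simp
    qed
  qed
  show ?thesis
    by (rule that[of x y]) (use main esc in auto)
qed

end

section \<open>The null support plane of an escaping geodesic\<close>

text \<open>The acceleration of the lifted curve is \<open>\<rho>\<close> times
  \<open>(g, 1)\<close>, the Lorentzian normal of the graph; \<open>dy\<close> and \<open>dw\<close>
  are its horizontal and vertical parts.\<close>

locale escaping_geodesic = convex_spacelike_graph f g H
  for f :: "'a::euclidean_space \<Rightarrow> real" and g H +
  fixes T :: real and x y :: "real \<Rightarrow> 'a" and \<rho> :: "real \<Rightarrow> real"
  assumes T_pos: "0 < T"
    and dx: "\<And>t. t \<in> {0..<T} \<Longrightarrow> (x has_vector_derivative y t) (at t within {0..<T})"
    and dy: "\<And>t. t \<in> {0..<T} \<Longrightarrow> (y has_vector_derivative \<rho> t *\<^sub>R g (x t)) (at t within {0..<T})"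
    and dw: "\<And>t. t \<in> {0..<T} \<Longrightarrow> ((\<lambda>t. g (x t) \<bullet> y t) has_vector_derivative \<rho> t) (at t within {0..<T})"
    and continuous_\<rho>: "continuous_on {0..<T} \<rho>"
    and future: "\<And>s t. 0 \<le> s \<Longrightarrow> s \<le> t \<Longrightarrow> t < T \<Longrightarrow> norm (y t - y s) \<le> g (x t) \<bullet> y t - g (x s) \<bullet> y s"
    and escape: "\<And>r. \<exists>\<delta>>0. \<forall>t. 0 \<le> t \<longrightarrow> T - \<delta> < t \<longrightarrow> t < T \<longrightarrow> r \<le> norm (x t)"
begin

text \<open>\<open>(y, w)\<close> is the velocity of the lifted curve, \<open>\<sigma>2\<close> its squared Lorentzian speed.\<close>

definition w :: "real \<Rightarrow> real" where "w t = g (x t) \<bullet> y t"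
definition \<sigma>2 :: real where "\<sigma>2 = (norm (y 0))\<^sup>2 - (w 0)\<^sup>2"

lemma dw': "t \<in> {0..<T} \<Longrightarrow> (w has_vector_derivative \<rho> t) (at t within {0..<T})"
  using dw by (simp add: w_def[abs_def])

lemma dfx: "t \<in> {0..<T} \<Longrightarrow> ((\<lambda>t. f (x t)) has_vector_derivative w t) (at t within {0..<T})"
  using has_derivative_compose[OF dx[unfolded has_vector_derivative_def] has_gradient[of "x t"]]
  by (simp add: has_vector_derivative_def w_def)

lemma interior_derivative:
  assumes "(F has_vector_derivative D) (at t within {0..<T})" "0 < t" "t < T"
  shows "(F has_vector_derivative D) (at t)"
  using assms at_within_interior[of t "{0..<T}"] by (simp add: interior_atLeastLessThan)

lemma w_mono: "0 \<le> s \<Longrightarrow> s \<le> t \<Longrightarrow> t < T \<Longrightarrow> w s \<le> w t"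
  using future[of s t] norm_ge_zero[of "y t - y s"] unfolding w_def by linarith

lemma constant_speed: "t \<in> {0..<T} \<Longrightarrow> (norm (y t))\<^sup>2 - (w t)\<^sup>2 = \<sigma>2"
proof -
  assume t: "t \<in> {0..<T}"
  have "((\<lambda>t. y t \<bullet> y t - w t * w t) has_vector_derivative 0) (at s within {0..<T})" if s: "s \<in> {0..<T}" for s
  proof -
    have "((\<lambda>t. y t \<bullet> y t - w t * w t) has_vector_derivative
        (y s \<bullet> (\<rho> s *\<^sub>R g (x s)) + (\<rho> s *\<^sub>R g (x s)) \<bullet> y s) - (w s * \<rho> s + \<rho> s * w s)) (at s within {0..<T})"
      by (intro has_vector_derivative_diff has_vector_derivative_mult dw' s
          bounded_bilinear.has_vector_derivative[OF bounded_bilinear_inner] dy)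
    then show ?thesis by (simp add: w_def inner_commute)
  qed
  then obtain c where "\<And>t. t \<in> {0..<T} \<Longrightarrow> y t \<bullet> y t - w t * w t = c"
    by (rule has_vector_derivative_zero_constant[OF convex_real_interval(7)]) (assumption, rule that, blast)
  from this[OF t] this[of 0] T_pos show ?thesis
    unfolding \<sigma>2_def power2_norm_eq_inner by (simp add: power2_eq_square)
qed

lemma x_lipschitz:
  assumes "0 \<le> s" "s \<le> t" "t < T" and "\<And>r. s \<le> r \<Longrightarrow> r \<le> t \<Longrightarrow> norm (y r) \<le> B"
  shows "norm (x t - x s) \<le> B * (t - s)"
proof -
  have "norm (x t - x s) \<le> B * norm (t - s)"
  proof (rule differentiable_bound[of "{s..t}" x "\<lambda>r h. h *\<^sub>R y r"])
    fix r assume r: "r \<in> {s..t}"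
    show "(x has_derivative (\<lambda>h. h *\<^sub>R y r)) (at r within {s..t})"
      using dx[of r] r assms unfolding has_vector_derivative_def
      by (rule_tac has_derivative_subset[of _ _ _ "{0..<T}"]) auto
    show "onorm (\<lambda>h. h *\<^sub>R y r) \<le> B"
      using mult_right_mono[OF assms(4)[of r] abs_ge_zero] r
      by (intro onorm_le) (simp add: mult.commute)
  qed (use assms in auto)
  then show ?thesis using assms by simp
qed

text \<open>By constant speed, bounded vertical velocity would bound the horizontal one, and in
  finite time \<open>x\<close> could not escape. Monotonicity turns unboundedness into
  divergence.\<close>

lemma w_unbounded: "\<exists>t0\<in>{0..<T}. \<forall>t\<in>{t0..<T}. B \<le> w t"
proof (rule ccontr)
  assume *: "\<not> ?thesis"
  have wB: "w t < B" if "t \<in> {0..<T}" for t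
  proof (rule ccontr)
    assume "\<not> w t < B"
    then have "\<forall>s\<in>{t..<T}. B \<le> w s" using w_mono[of t] that by force
    then show False using * that by blast
  qed
  define Q where "Q = sqrt (\<sigma>2 + (\<bar>B\<bar> + \<bar>w 0\<bar>)\<^sup>2)"
  have yQ: "norm (y t) \<le> Q" if "t \<in> {0..<T}" for t
  proof -
    have "\<bar>w t\<bar> \<le> \<bar>B\<bar> + \<bar>w 0\<bar>" using wB[OF that] w_mono[of 0 t] that by auto
    then have "(w t)\<^sup>2 \<le> (\<bar>B\<bar> + \<bar>w 0\<bar>)\<^sup>2" by (simp add: abs_le_square_iff[symmetric])
    then show ?thesis unfolding Q_def using constant_speed[OF that] by (intro real_le_rsqrt) simp
  qed
  have Q0: "0 \<le> Q" using order_trans[OF norm_ge_zero yQ[of 0]] T_pos by simp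
  obtain \<delta> where \<delta>: "\<delta> > 0" "\<And>t. 0 \<le> t \<Longrightarrow> T - \<delta> < t \<Longrightarrow> t < T \<Longrightarrow> norm (x 0) + Q * T + 1 \<le> norm (x t)"
    using escape[of "norm (x 0) + Q * T + 1"] by blast
  define t where "t = max 0 (T - \<delta> / 2)"
  have t: "0 \<le> t" "T - \<delta> < t" "t < T" using \<delta>(1) T_pos by (auto simp: t_def)
  have "norm (x t - x 0) \<le> Q * (t - 0)" using t yQ by (intro x_lipschitz) auto
  also have "\<dots> \<le> Q * T" using Q0 t by (intro mult_left_mono) auto
  finally show False using \<delta>(2)[OF t] norm_triangle_ineq[of "x t - x 0" "x 0"] by simp
qed

text \<open>The direction \<open>e\<close> of \<open>y t\<close> satisfies
  \<open>e \<bullet> y t = norm (y t) \<ge> w t\<close>, and \<open>future\<close> carries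
  \<open>w \<le> e \<bullet> y\<close> back from \<open>t\<close> to every earlier time. A limit of
  such directions along times with \<open>w\<close> tending to infinity serves all times at
  once.\<close>

lemma null_direction:
  obtains e where "norm e = 1" "\<And>s. s \<in> {0..<T} \<Longrightarrow> w s \<le> e \<bullet> y s"
proof -
  have "\<forall>n::nat. \<exists>t\<in>{0..<T}. real (Suc n) \<le> w t"
  proof
    fix n :: nat
    obtain t where "t \<in> {0..<T}" "\<forall>s\<in>{t..<T}. real (Suc n) \<le> w s" using w_unbounded by blast
    then show "\<exists>t\<in>{0..<T}. real (Suc n) \<le> w t" by (intro bexI[of _ t]) auto
  qed
  then have "\<forall>n::nat. \<exists>t. t \<in> {0..<T} \<and> real (Suc n) \<le> w t" by blast
  then obtain \<tau> where "\<forall>n::nat. \<tau> n \<in> {0..<T} \<and> real (Suc n) \<le> w (\<tau> n)" by (rule choice[THEN exE])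
  then have \<tau>: "\<And>n. \<tau> n \<in> {0..<T}" "\<And>n. real (Suc n) \<le> w (\<tau> n)" by auto
  have wy: "w t \<le> norm (y t)" for t
    unfolding w_def using norm_cauchy_schwarz[of "g (x t)" "y t"] spacelike[of "x t"]
      mult_right_mono[of "norm (g (x t))" 1 "norm (y t)"] by auto
  define e where "e n = sgn (y (\<tau> n))" for n
  have ypos: "0 < norm (y (\<tau> n))" for n using wy[of "\<tau> n"] \<tau>(2)[of n] by linarith
  then have e1: "e n \<in> sphere 0 1" for n by (simp add: e_def norm_sgn)
  have ey: "e n \<bullet> y (\<tau> n) = norm (y (\<tau> n))" for n
    using ypos[of n] by (simp add: e_def sgn_div_norm power2_eq_square flip: power2_norm_eq_inner)
  obtain l r where lr: "l \<in> sphere 0 1" "strict_mono r" "(e \<circ> r) \<longlonglongrightarrow> l"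
    using seq_compactE[of "sphere (0::'a) 1" e] e1 by (auto simp: compact_eq_seq_compact_metric[symmetric])
  show ?thesis
  proof (rule that[of l])
    show "norm l = 1" using lr by simp
    fix s assume s: "s \<in> {0..<T}"
    have "(\<lambda>n. (e \<circ> r) n \<bullet> y s) \<longlonglongrightarrow> l \<bullet> y s" by (intro tendsto_intros lr)
    moreover have "\<forall>\<^sub>F n in sequentially. w s \<le> (e \<circ> r) n \<bullet> y s"
      using eventually_ge_at_top[of "nat \<lceil>w s\<rceil>"]
    proof eventually_elim
      case (elim n)
      define t where "t = \<tau> (r n)"
      have "w s \<le> real n" using elim by linarith
      also have "real n < real (Suc (r n))" using seq_suble[OF lr(2), of n] by simp
      also have "\<dots> \<le> w t" using \<tau>(2) by (simp add: t_def)
      finally have "w s < w t" .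
      then have "s \<le> t" using w_mono[of t s] s \<tau>(1)[of "r n"] unfolding t_def by force
      then have "norm (y t - y s) \<le> w t - w s"
        unfolding w_def using s \<tau>(1)[of "r n"] by (intro future) (auto simp: t_def)
      moreover have "e (r n) \<bullet> (y t - y s) \<le> 1 * norm (y t - y s)"
        using norm_cauchy_schwarz[of "e (r n)" "y t - y s"] e1[of "r n"] by simp
      moreover have "e (r n) \<bullet> y t = norm (y t)" using ey by (simp add: t_def)
      ultimately show ?case using wy[of t] by (simp add: inner_diff_right)
    qed
    ultimately show "w s \<le> l \<bullet> y s" by (rule tendsto_lowerbound) simp
  qed
qed

lemma \<rho>_nonneg: "0 < t \<Longrightarrow> t < T \<Longrightarrow> 0 \<le> \<rho> t"
proof -
  assume t: "0 < t" "t < T"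
  have "(w has_real_derivative \<rho> t) (at t)"
    using interior_derivative[OF dw'] t by (simp add: has_real_derivative_iff_has_vector_derivative)
  moreover have "mono_on {0..<T} w" using w_mono by (auto intro: mono_onI)
  ultimately show ?thesis
    by (rule_tac mono_on_imp_deriv_nonneg[of "{0..<T}" w]) (use t in \<open>auto simp: interior_atLeastLessThan\<close>)
qed

text \<open>The derivative is \<open>\<rho>\<close> times minus the convexity remainder of
  \<open>p\<close> at \<open>x s\<close>, minus the squared speed.\<close>

lemma pairing_decreasing:
  assumes "0 \<le> t" "t < T"
  shows "(p - x t) \<bullet> y t - (f p - f (x t)) * w t \<le> (p - x 0) \<bullet> y 0 - (f p - f (x 0)) * w 0"
proof -
  have d: "((\<lambda>s. (p - x s) \<bullet> y s - (f p - f (x s)) * w s) has_vector_derivative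
      ((p - x s) \<bullet> (\<rho> s *\<^sub>R g (x s)) + (0 - y s) \<bullet> y s) - ((f p - f (x s)) * \<rho> s + (0 - w s) * w s)) (at s within {0..<T})"
    if s: "s \<in> {0..<T}" for s
    by (intro has_vector_derivative_diff has_vector_derivative_mult dw' s dfx has_vector_derivative_const
          bounded_bilinear.has_vector_derivative[OF bounded_bilinear_inner] dy dx)
  show ?thesis
  proof (rule DERIV_nonpos_imp_decreasing_open[OF assms(1)])
    fix s assume s: "0 < s" "s < t"
    let ?d = "((p - x s) \<bullet> (\<rho> s *\<^sub>R g (x s)) + (0 - y s) \<bullet> y s) - ((f p - f (x s)) * \<rho> s + (0 - w s) * w s)"
    have "((\<lambda>s. (p - x s) \<bullet> y s - (f p - f (x s)) * w s) has_real_derivative ?d) (at s)"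
      using interior_derivative[OF d] s assms by (simp add: has_real_derivative_iff_has_vector_derivative)
    moreover have "?d \<le> 0"
    proof -
      have "?d = \<rho> s * (f (x s) + g (x s) \<bullet> (p - x s) - f p) - ((norm (y s))\<^sup>2 - (w s)\<^sup>2)"
        unfolding power2_norm_eq_inner by (simp add: power2_eq_square inner_commute algebra_simps)
      moreover have "\<rho> s * (f (x s) + g (x s) \<bullet> (p - x s) - f p) \<le> 0"
        using \<rho>_nonneg[of s] convex[of "x s" p] s assms by (simp add: mult_nonneg_nonpos)
      moreover have "(w s)\<^sup>2 \<le> (norm (y s))\<^sup>2"
      proof -
        have "\<bar>w s\<bar> \<le> norm (g (x s)) * norm (y s)" unfolding w_def by (rule Cauchy_Schwarz_ineq2)
        also have "\<dots> \<le> 1 * norm (y s)" using spacelike[of "x s"] by (intro mult_right_mono) auto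
        finally show ?thesis by (simp add: abs_le_square_iff[symmetric])
      qed
      ultimately show ?thesis by linarith
    qed
    ultimately show "\<exists>z. ((\<lambda>s. (p - x s) \<bullet> y s - (f p - f (x s)) * w s) has_real_derivative z) (at s) \<and> z \<le> 0"
      by blast
  next
    have "continuous_on {0..<T} (\<lambda>s. (p - x s) \<bullet> y s - (f p - f (x s)) * w s)"
      unfolding continuous_on_eq_continuous_within using d has_vector_derivative_continuous by blast
    then show "continuous_on {0..t} (\<lambda>s. (p - x s) \<bullet> y s - (f p - f (x s)) * w s)"
      by (rule continuous_on_subset) (use assms in auto)
  qed
qed

text \<open>\<open>b\<close> is the pairing of the curve with the null vector \<open>(e, 1)\<close>,
  and its derivative \<open>\<beta>\<close> is nonnegative and nonincreasing; as \<open>T\<close> is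
  finite, \<open>b\<close> converges. For the support bound, \<open>pairing_decreasing\<close> is
  divided by \<open>w\<close>: all but the \<open>e\<close>-component of the velocity contributes
  bounded terms.\<close>

lemma asymptotic_null_support:
  obtains e L where "norm e = 1" "((\<lambda>t. x t \<bullet> e - f (x t)) \<longlongrightarrow> L) (at_left T)" "\<And>p. p \<bullet> e - f p \<le> L"
proof -
  obtain e where e: "norm e = 1" "\<And>s. s \<in> {0..<T} \<Longrightarrow> w s \<le> e \<bullet> y s" by (rule null_direction) (rule that, assumption, blast)
  have ee: "e \<bullet> e = 1" using e(1) by (simp add: norm_eq_1)
  \<comment> \<open>In the null frame of \<open>e\<close>: \<open>\<beta> (\<beta> + 2 w) + \<bar>c\<bar>\<^sup>2 = \<sigma>2\<close>, so \<open>w \<beta>\<close> and \<open>c\<close> stay bounded as \<open>w\<close> grows.\<close>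
  define \<beta> where "\<beta> s = e \<bullet> y s - w s" for s
  define b where "b s = x s \<bullet> e - f (x s)" for s
  define c where "c s = y s - (e \<bullet> y s) *\<^sub>R e" for s
  have \<beta>0: "0 \<le> \<beta> s" if "s \<in> {0..<T}" for s using e(2)[OF that] by (simp add: \<beta>_def)
  have \<beta>dec: "\<beta> t \<le> \<beta> s" if "0 \<le> s" "s \<le> t" "t < T" for s t
    using norm_cauchy_schwarz[of e "y t - y s"] e(1) future[OF that]
    by (simp add: \<beta>_def w_def inner_diff_right)
  have db: "(b has_vector_derivative \<beta> s) (at s within {0..<T})" if s: "s \<in> {0..<T}" for s
  proof -
    from has_vector_derivative_diff[OF bounded_linear.has_vector_derivative[OF bounded_linear_inner_left dx[OF s]] dfx[OF s]]
    show ?thesis by (simp add: b_def[abs_def] \<beta>_def inner_commute)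
  qed
  have cb: "continuous_on {0..<T} b"
    unfolding continuous_on_eq_continuous_within using db has_vector_derivative_continuous by blast
  have dbi: "(b has_real_derivative \<beta> s) (at s)" if "0 < s" "s < T" for s
    using interior_derivative[OF db] that by (simp add: has_real_derivative_iff_has_vector_derivative)
  have bmono: "b s \<le> b t" if st: "0 \<le> s" "s \<le> t" "t < T" for s t
  proof (rule DERIV_nonneg_imp_increasing_open[OF st(2)])
    show "continuous_on {s..t} b" by (rule continuous_on_subset[OF cb]) (use st in auto)
    show "\<exists>z. (b has_real_derivative z) (at r) \<and> 0 \<le> z" if "s < r" "r < t" for r
      using dbi[of r] \<beta>0[of r] that st by auto
  qed
  have bbound: "b t \<le> b 0 + \<beta> 0 * T" if t: "0 \<le> t" "t < T" for t
  proof -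
    have "b t - \<beta> 0 * t \<le> b 0 - \<beta> 0 * 0"
    proof (rule DERIV_nonpos_imp_decreasing_open[OF t(1)])
      show "continuous_on {0..t} (\<lambda>s. b s - \<beta> 0 * s)"
        by (intro continuous_intros continuous_on_subset[OF cb]) (use t in auto)
      show "\<exists>z. ((\<lambda>s. b s - \<beta> 0 * s) has_real_derivative z) (at r) \<and> z \<le> 0" if "0 < r" "r < t" for r
        using DERIV_diff[OF dbi[of r] DERIV_cmult_Id[of "\<beta> 0" r UNIV]] \<beta>dec[of 0 r] that t
        by (intro exI[of _ "\<beta> r - \<beta> 0"]) auto
    qed
    moreover have "\<beta> 0 * t \<le> \<beta> 0 * T" using t \<beta>0[of 0] by (intro mult_left_mono) auto
    ultimately show ?thesis by simp
  qed
  define L where "L = (SUP t\<in>{0..<T}. b t)"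
  have bdd: "bdd_above (b ` {0..<T})" using bbound by (intro bdd_aboveI2) auto
  have bL: "b t \<le> L" if "t \<in> {0..<T}" for t unfolding L_def using bdd that by (rule cSUP_upper2) simp
  have lim: "(b \<longlongrightarrow> L) (at_left T)"
  proof (rule order_tendstoI)
    fix a assume "a < L"
    then obtain t1 where t1: "t1 \<in> {0..<T}" "a < b t1"
      using bdd T_pos unfolding L_def by (subst (asm) less_cSUP_iff) auto
    have "a < b t" if "t \<in> {t1<..<T}" for t using bmono[of t1 t] t1 that by auto
    then show "\<forall>\<^sub>F t in at_left T. a < b t" using t1 by (intro eventually_at_leftI[of t1]) auto
  next
    fix a assume "L < a"
    have "b t < a" if "t \<in> {0<..<T}" for t using bL[of t] \<open>L < a\<close> that by auto
    then show "\<forall>\<^sub>F t in at_left T. b t < a" using T_pos by (intro eventually_at_leftI[of 0]) auto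
  qed
  have split: "(norm (c s))\<^sup>2 + \<beta> s * (\<beta> s + 2 * w s) = \<sigma>2" if "s \<in> {0..<T}" for s
  proof -
    have "(norm (c s))\<^sup>2 = (norm (y s))\<^sup>2 - (e \<bullet> y s)\<^sup>2"
      unfolding c_def power2_norm_eq_inner
      by (simp add: inner_simps ee inner_commute power2_eq_square algebra_simps)
    then show ?thesis using constant_speed[OF that] by (simp add: \<beta>_def power2_eq_square algebra_simps)
  qed
  obtain t0 where t0: "t0 \<in> {0..<T}" "\<And>t. t \<in> {t0..<T} \<Longrightarrow> 1 \<le> w t" using w_unbounded[of 1] by blast
  define \<sigma> where "\<sigma> = sqrt \<sigma>2"
  have late: "norm (c t) \<le> \<sigma>" "2 * (w t * \<beta> t) \<le> \<sigma>2" if t: "t \<in> {t0..<T}" for t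
  proof -
    have "t \<in> {0..<T}" using t t0 by auto
    note s = split[OF this] and \<beta>t = \<beta>0[OF this]
    have "0 \<le> \<beta> t * (\<beta> t + 2 * w t)" using \<beta>t t0(2)[OF t] by simp
    then show "norm (c t) \<le> \<sigma>" unfolding \<sigma>_def using s by (intro real_le_rsqrt) simp
    have "0 \<le> \<beta> t * \<beta> t" using \<beta>t by simp
    moreover have "\<beta> t * (\<beta> t + 2 * w t) = \<beta> t * \<beta> t + 2 * (w t * \<beta> t)" by (simp add: algebra_simps)
    ultimately show "2 * (w t * \<beta> t) \<le> \<sigma>2" using s zero_le_power2[of "norm (c t)"] by linarith
  qed
  have \<sigma>0: "0 \<le> \<sigma>" using order_trans[OF norm_ge_zero late(1)[of t0]] t0(1) by simp
  \<comment> \<open>The part of \<open>x\<close> orthogonal to \<open>e\<close> moves with velocity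
    \<open>c\<close>, which is bounded by \<open>\<sigma>\<close>, so it stays bounded although
    \<open>x\<close> escapes.\<close>
  define orth where "orth v = v - (e \<bullet> v) *\<^sub>R e" for v
  have orth_lin: "bounded_linear orth"
    unfolding orth_def by (intro bounded_linear_intros)
  have orth_bound: "norm (orth (x t)) \<le> norm (orth (x t0)) + \<sigma> * T" if t: "t \<in> {t0..<T}" for t
  proof -
    have "norm (orth (x t) - orth (x t0)) \<le> \<sigma> * norm (t - t0)"
    proof (rule differentiable_bound[of "{t0..t}" "\<lambda>r. orth (x r)" "\<lambda>r h. h *\<^sub>R c r"])
      fix r assume r: "r \<in> {t0..t}"
      then have "((\<lambda>r. orth (x r)) has_vector_derivative orth (y r)) (at r within {0..<T})"
        using t t0 by (intro bounded_linear.has_vector_derivative[OF orth_lin] dx) auto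
      then show "((\<lambda>r. orth (x r)) has_derivative (\<lambda>h. h *\<^sub>R c r)) (at r within {t0..t})"
        unfolding has_vector_derivative_def c_def orth_def
        by (rule has_derivative_subset) (use t t0 in auto)
      show "onorm (\<lambda>h. h *\<^sub>R c r) \<le> \<sigma>"
        using mult_right_mono[OF late(1)[of r] abs_ge_zero] r t
        by (intro onorm_le) (simp add: mult.commute)
    qed (use t in auto)
    also have "\<dots> \<le> \<sigma> * T" using t t0 \<sigma>0 by (intro mult_left_mono) auto
    finally show ?thesis using norm_triangle_ineq[of "orth (x t) - orth (x t0)" "orth (x t0)"] by simp
  qed
  have "p \<bullet> e - f p \<le> L" for p
  proof (rule ccontr)
    assume "\<not> p \<bullet> e - f p \<le> L"
    define \<epsilon> where "\<epsilon> = p \<bullet> e - f p - L"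
    have \<epsilon>: "0 < \<epsilon>" using \<open>\<not> p \<bullet> e - f p \<le> L\<close> by (simp add: \<epsilon>_def)
    define h0 where "h0 = (p - x 0) \<bullet> y 0 - (f p - f (x 0)) * w 0"
    \<comment> \<open>\<open>C1\<close> bounds the transverse term
      \<open>(p - x t) \<bullet> c t\<close>. \<open>C3\<close> comes from
      \<open>norm (p - x t) \<le> C3 + T * w t\<close>: this may grow like \<open>w\<close>, but it
      is multiplied by \<open>\<beta>\<close>, and
      \<open>w * \<beta> \<le> \<sigma>2 / 2\<close>.\<close>
    define C1 where "C1 = (norm (orth p) + norm (orth (x t0)) + \<sigma> * T) * \<sigma>"
    define C3 where "C3 = norm p + norm (x 0) + T * (norm (y 0) + \<bar>w 0\<bar>)"
    have C3: "0 \<le> C3" using T_pos by (simp add: C3_def)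
    define C where "C = h0 + C1 + (C3 + T) * \<sigma>2 / 2"
    have main: "w t * \<epsilon> \<le> C" if t: "t \<in> {t0..<T}" for t
    proof -
      have tT: "0 \<le> t" "t < T" "t \<in> {0..<T}" using t t0 by auto
      have w1: "1 \<le> w t" using t0(2) t by blast
      define X where "X = (p - x t) \<bullet> e"
      have "orth p - orth (x t) = orth (p - x t)"
        by (simp add: orth_def inner_diff_right algebra_simps)
      moreover have "orth (p - x t) \<bullet> c t = (p - x t) \<bullet> c t"
      proof -
        have "e \<bullet> c t = 0" by (simp add: c_def inner_diff_right ee)
        then show ?thesis by (simp add: orth_def inner_diff_left)
      qed
      ultimately have "\<bar>(p - x t) \<bullet> c t\<bar> \<le> norm (orth p - orth (x t)) * norm (c t)"
        by (metis Cauchy_Schwarz_ineq2)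
      also have "\<dots> \<le> (norm (orth p) + norm (orth (x t0)) + \<sigma> * T) * \<sigma>"
        using orth_bound[OF t] late(1)[OF t] norm_triangle_ineq4[of "orth p" "orth (x t)"] \<sigma>0 T_pos
        by (intro mult_mono) auto
      finally have c1: "\<bar>(p - x t) \<bullet> c t\<bar> \<le> C1" by (simp add: C1_def)
      have ynorm: "norm (y r) \<le> norm (y 0) + \<bar>w 0\<bar> + w t" if "0 \<le> r" "r \<le> t" for r
        using future[of 0 r] w_mono[of r t] norm_triangle_ineq[of "y r - y 0" "y 0"] that tT
        unfolding w_def[symmetric] by simp
      have "norm (x t - x 0) \<le> (norm (y 0) + \<bar>w 0\<bar> + w t) * (t - 0)"
        using tT ynorm by (intro x_lipschitz) auto
      also have "\<dots> \<le> (norm (y 0) + \<bar>w 0\<bar> + w t) * T" using tT w1 by (intro mult_left_mono) auto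
      finally have "norm (x t - x 0) \<le> (norm (y 0) + \<bar>w 0\<bar> + w t) * T" .
      then have xn: "norm (p - x t) \<le> C3 + T * w t"
        using norm_triangle_ineq4[of p "x t"] norm_triangle_ineq[of "x t - x 0" "x 0"]
        by (simp add: C3_def algebra_simps)
      have "- X \<le> norm (p - x t)"
        using norm_cauchy_schwarz[of "p - x t" "- e"] e(1) by (simp add: X_def)
      then have "- X * \<beta> t \<le> (C3 + T * w t) * \<beta> t"
        using xn \<beta>0[OF tT(3)] by (intro mult_right_mono) auto
      also have "\<dots> \<le> ((C3 + T) * w t) * \<beta> t"
        using \<beta>0[OF tT(3)] C3 w1 mult_left_mono[of 1 "w t" C3]
        by (intro mult_right_mono) (auto simp: algebra_simps)
      also have "\<dots> = (C3 + T) * (w t * \<beta> t)" by simp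
      also have "\<dots> \<le> (C3 + T) * (\<sigma>2 / 2)"
        using late(2)[OF t] C3 T_pos by (intro mult_left_mono) auto
      finally have X\<beta>: "- X * \<beta> t \<le> (C3 + T) * \<sigma>2 / 2" by simp
      \<comment> \<open>In this frame the pairing of \<open>p - \<gamma>\<close> with the velocity
        becomes \<open>w\<close> times the excess of \<open>p\<close> over \<open>b t\<close>, plus
        the two bounded terms.\<close>
      have "y t = (w t + \<beta> t) *\<^sub>R e + c t" by (simp add: c_def \<beta>_def)
      then have "(p - x t) \<bullet> y t = X * (w t + \<beta> t) + (p - x t) \<bullet> c t"
        by (simp only: X_def inner_add_right inner_scaleR_right mult.commute[of _ "(p - x t) \<bullet> e"])
      then have "(X - (f p - f (x t))) * w t = ((p - x t) \<bullet> y t - (f p - f (x t)) * w t) - X * \<beta> t - (p - x t) \<bullet> c t"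
        by (simp add: left_diff_distrib distrib_left)
      also have "\<dots> \<le> C"
        using pairing_decreasing[OF tT(1,2), of p] c1 X\<beta> unfolding C_def h0_def by linarith
      finally have "(p \<bullet> e - f p - b t) * w t \<le> C"
        by (simp add: X_def b_def inner_diff_left algebra_simps)
      moreover have "\<epsilon> * w t \<le> (p \<bullet> e - f p - b t) * w t"
        using bL[OF tT(3)] w1 by (intro mult_right_mono) (auto simp: \<epsilon>_def)
      ultimately show ?thesis by (simp add: mult.commute)
    qed
    obtain t1 where t1: "t1 \<in> {0..<T}" "\<And>t. t \<in> {t1..<T} \<Longrightarrow> (\<bar>C\<bar> + 1) / \<epsilon> \<le> w t"
      using w_unbounded[of "(\<bar>C\<bar> + 1) / \<epsilon>"] by blast
    define t where "t = max t0 t1"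
    have "w t * \<epsilon> \<le> C" using t0 t1 by (intro main) (auto simp: t_def)
    moreover have "(\<bar>C\<bar> + 1) / \<epsilon> \<le> w t" using t0 t1 by (intro t1(2)) (auto simp: t_def)
    ultimately show False using \<epsilon> by (simp add: divide_le_eq)
  qed
  then show ?thesis using that[OF e(1) lim[unfolded b_def]] by blast
qed

end

section \<open>From bounded exit lengths to an escaping geodesic\<close>

context convex_spacelike_graph
begin

text \<open>Near-optimal polygons reach circles of radius tending to infinity. Bounded exit lengths
  give a finite supremum \<open>T\<close>, and near-optimality compares arc length along the
  polygons with time up to \<open>\<eta> n\<close>.\<close>

lemma discrete_geodesics:
  assumes D: "\<And>r. exit_length a r \<le> D"
  shows "\<exists>T N u h e. geodesic_approximation f g H T (D + 1) N u h e"
proof -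
  define R where "R n = norm a + 1 + real n" for n
  define e where "e n = inverse (real (Suc n))" for n
  define t where "t n = exit_length a (R n)" for n
  have e: "0 < e n" "e n \<le> 1" for n by (auto simp: e_def field_simps)
  have elim: "e \<longlonglongrightarrow> 0" unfolding e_def using LIMSEQ_inverse_real_of_nat by simp
  define Q where "Q n N u \<longleftrightarrow> near_optimal a (R n) (e n) N u" for n N u
  have "\<forall>n. \<exists>N u. Q n N u"
    unfolding Q_def by (intro allI near_optimal_polygon e) (simp add: R_def)
  then obtain N where "\<forall>n. \<exists>u. Q n (N n) u"
    using choice[of "\<lambda>n N. \<exists>u. Q n N u"] by blast
  then obtain u where Q: "\<And>n. Q n (N n) (u n)"
    using choice[of "\<lambda>n u. Q n (N n) u"] by blast
  have u: "\<And>n. 0 < N n" "\<And>n. u n 0 = a" "\<And>n. norm (u n (N n)) = R n"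
    "\<And>n. energy (N n) (u n) \<le> e n"
    "\<And>n. real (N n) * energy (N n) (u n) \<le> (t n + e n)\<^sup>2"
    "\<And>n j. Suc j < N n \<Longrightarrow> stationary (u n j) (u n (Suc j)) (u n (Suc (Suc j)))"
    using Q unfolding Q_def near_optimal_def t_def by auto
  \<comment> \<open>This step gives total time \<open>N n * h n = t n\<close>; \<open>S n i\<close>
    is the arc length up to vertex \<open>i\<close>.\<close>
  define h where "h n = t n / real (N n)" for n
  define S where "S n i = polygon_length i (u n)" for n i
  define \<eta> where "\<eta> n = sqrt (2 * t n * e n + (e n)\<^sup>2)" for n
  define T where "T = (SUP n. t n)"
  have tpos: "0 < t n" for n unfolding t_def R_def by (intro exit_length_pos) simp
  have tmono: "t m \<le> t n" if "m \<le> n" for m n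
    unfolding t_def R_def using that by (intro exit_length_mono) simp
  have tD: "t n \<le> D" for n unfolding t_def by (rule D)
  have bdd: "bdd_above (range t)" using tD by (intro bdd_aboveI[of _ D]) auto
  have tT: "t n \<le> T" for n unfolding T_def by (intro cSUP_upper bdd) simp
  have Sdiff: "S n k - S n j = (\<Sum>i\<in>{j..<k}. chord (u n i) (u n (Suc i)))" if "j \<le> k" for n j k
    unfolding S_def using that
    by (simp add: lessThan_atLeast0 sum_diff_nat_ivl)
  have chainS: "chain (u n j) (u n k) (S n k - S n j)" if "j \<le> k" for n j k
    unfolding Sdiff[OF that] by (rule chain_of_polygon[OF that])
  \<comment> \<open>The polygon is itself a competitor in the infimum defining the exit
    length.\<close>
  have SN: "t n \<le> S n (N n)" for n
    unfolding t_def using chainS[of 0 "N n" n] u(2,3)[of n]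
    by (intro exit_length_le[of a "u n (N n)"]) (auto simp: S_def)
  have dev: "\<bar>S n i - real i * h n\<bar> \<le> \<eta> n" if "i \<le> N n" for n i
    unfolding S_def h_def \<eta>_def
    using u(1)[of n] SN[of n] tpos[of n] u(5)[of n] that
    by (intro partial_sum_deviation) (auto simp: S_def chord_power2)
  have CS: "(S n (N n))\<^sup>2 \<le> real (N n) * energy (N n) (u n)" for n
    using sum_squared_le_sum_of_squares[of "\<lambda>j. chord (u n j) (u n (Suc j))" "{..<N n}"]
    by (simp add: S_def chord_power2 mult.commute)
  have \<eta>0: "\<eta> \<longlonglongrightarrow> 0"
  proof (rule tendsto_sandwich[of "\<lambda>_. 0"])
    show "(\<lambda>n. sqrt (2 * D * e n + (e n)\<^sup>2)) \<longlonglongrightarrow> 0"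
      using tendsto_real_sqrt[OF tendsto_add[OF tendsto_mult_left[OF elim, of "2 * D"] tendsto_power[OF elim, of 2]]]
      by simp
    show "\<forall>\<^sub>F n in sequentially. \<eta> n \<le> sqrt (2 * D * e n + (e n)\<^sup>2)"
      unfolding \<eta>_def using tD e by (intro always_eventually allI real_sqrt_le_mono add_right_mono mult_right_mono)
        (auto simp: less_imp_le)
    show "\<forall>\<^sub>F n in sequentially. 0 \<le> \<eta> n"
      unfolding \<eta>_def using tpos e by (intro always_eventually allI real_sqrt_ge_zero) (simp add: less_imp_le)
  qed simp
  have hpos: "0 < h n" for n using tpos u(1) by (simp add: h_def)
  have Nh: "real (N n) * h n = t n" for n using u(1)[of n] by (simp add: h_def)
  \<comment> \<open>The length is at least \<open>t n\<close>, so Cauchy-Schwarz gives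
    \<open>(t n)^2 \<le> N n * e n\<close>; dividing by \<open>N n\<close> bounds
    \<open>h n * t n\<close> by \<open>e n\<close>.\<close>
  have h0: "h \<longlonglongrightarrow> 0"
  proof (rule tendsto_sandwich[of "\<lambda>_. 0"])
    have "h n \<le> e n / t 0" for n
    proof -
      have "t n * t n \<le> (S n (N n))\<^sup>2"
        unfolding power2_eq_square using SN[of n] tpos[of n] by (intro mult_mono) auto
      also have "\<dots> \<le> real (N n) * e n"
        by (rule order_trans[OF CS]) (intro mult_left_mono u(4), simp)
      finally have "h n * t n \<le> e n" using u(1)[of n] by (simp add: h_def divide_le_eq mult.commute)
      moreover have "h n * t 0 \<le> h n * t n" using tmono[of 0 n] hpos[of n] by simp
      ultimately show ?thesis using tpos[of 0] by (simp add: le_divide_eq)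
    qed
    then show "\<forall>\<^sub>F n in sequentially. h n \<le> e n / t 0" by simp
    show "(\<lambda>n. e n / t 0) \<longlonglongrightarrow> 0" using tendsto_divide[OF elim tendsto_const, of "t 0"] tpos[of 0] by simp
  qed (auto simp: hpos less_imp_le)
  have "geodesic_approximation f g H T (D + 1) N u h e"
  proof unfold_locales
    show "0 < T" using tT[of 0] tpos[of 0] by linarith
    show "0 < h n" for n by (rule hpos)
    show "h \<longlonglongrightarrow> 0" "e \<longlonglongrightarrow> 0" by fact+
    show "\<exists>r. \<forall>\<^sub>F n in sequentially. \<forall>j. real j * h n \<le> \<tau> \<longrightarrow> j < N n \<and> norm (u n j) \<le> r" if \<tau>: "\<tau> < T" for \<tau>
    proof -
      obtain m where m: "\<tau> < t m"
        using \<tau> less_cSUP_iff[of UNIV t \<tau>] bdd unfolding T_def by auto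
      have "\<forall>\<^sub>F n in sequentially. \<eta> n < t m - \<tau>"
        using \<eta>0 m by (intro order_tendstoD) auto
      moreover have "\<forall>\<^sub>F n in sequentially. n \<ge> m" by (rule eventually_ge_at_top)
      ultimately have "\<forall>\<^sub>F n in sequentially. \<forall>j. real j * h n \<le> \<tau> \<longrightarrow> j < N n \<and> norm (u n j) \<le> R m"
      proof eventually_elim
        case (elim n)
        show ?case
        proof (intro allI impI conjI)
          fix j assume j: "real j * h n \<le> \<tau>"
          then have "real j * h n < real (N n) * h n" using m tmono[OF elim(2)] Nh[of n] by linarith
          then show jN: "j < N n" using hpos[of n] by simp
          show "norm (u n j) \<le> R m"
          proof (rule ccontr)
            \<comment> \<open>Being outside the disc of radius \<open>R m\<close> costs at least
              \<open>t m\<close>, more than \<open>\<tau> + \<eta> n\<close>.\<close>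
            assume "\<not> norm (u n j) \<le> R m"
            then have "t m \<le> S n j"
              unfolding t_def using chainS[of 0 j n] u(2)[of n]
              by (intro exit_length_le[of a "u n j"]) (auto simp: S_def)
            then show False using dev[of j n] jN j elim(1) by linarith
          qed
        qed
      qed
      then show ?thesis by blast
    qed
    show "\<exists>\<delta>>0. \<forall>\<^sub>F n in sequentially. \<forall>j\<le>N n. norm (u n j) \<le> r \<longrightarrow> real j * h n \<le> T - \<delta>" for r
    proof -
      obtain \<kappa> where \<kappa>: "0 < \<kappa>"
        "\<And>x b L. chain x b L \<Longrightarrow> norm x \<le> r \<Longrightarrow> \<kappa> * min 1 (norm (b - x)) \<le> L"
        by (rule chain_lower_bound[of r]) blast
      have "\<forall>\<^sub>F n in sequentially. \<eta> n < \<kappa> / 4"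
        using \<eta>0 \<kappa> by (intro order_tendstoD) auto
      moreover have "\<forall>\<^sub>F n in sequentially. n \<ge> nat \<lceil>r\<rceil>" by (rule eventually_ge_at_top)
      ultimately have "\<forall>\<^sub>F n in sequentially. \<forall>j\<le>N n. norm (u n j) \<le> r \<longrightarrow> real j * h n \<le> T - \<kappa> / 2"
      proof eventually_elim
        case (elim n)
        show ?case
        proof (intro allI impI)
          fix j assume j: "j \<le> N n" "norm (u n j) \<le> r"
          have "r \<le> real n" using elim(2) by linarith
          then have "1 \<le> norm (u n (N n) - u n j)"
            using j(2) u(3)[of n] norm_triangle_ineq2[of "u n (N n)" "u n j"] norm_ge_zero[of a]
            unfolding R_def by linarith
          \<comment> \<open>The end of the polygon is at distance at least 1, so the remaining arc
            length is at least \<open>\<kappa>\<close>. Two time deviations below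
            \<open>\<kappa> / 4\<close> leave \<open>\<kappa> / 2\<close>.\<close>
          then have "\<kappa> \<le> S n (N n) - S n j" using \<kappa>(2)[OF chainS[OF j(1)] j(2)] by simp
          then show "real j * h n \<le> T - \<kappa> / 2"
            using dev[of j n] dev[of "N n" n] j(1) elim(1) Nh[of n] tT[of n] by linarith
        qed
      qed
      then show ?thesis using \<kappa>(1) by (intro exI[of _ "\<kappa> / 2"]) auto
    qed
    show "polygon_length (N n) (u n) \<le> D + 1" for n
    proof -
      have "S n (N n) \<le> t n + e n"
        by (rule power2_le_imp_le[OF order_trans[OF CS u(5)]]) (use tpos[of n] e(1)[of n] in simp)
      then show ?thesis using tD[of n] e(2)[of n] by (simp add: S_def)
    qed
    show "chord2 (u n j) (u n (Suc j)) \<le> e n" if "j < N n" for n j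
      by (rule order_trans[OF member_le_sum u(4)]) (use that in \<open>auto simp: chord2_nonneg\<close>)
  qed (rule u(6))
  then show ?thesis by blast
qed

text \<open>\<open>geodesic_increment\<close> expands only at the earlier time, while a derivative
  needs expansions at \<open>t\<close> on both sides, so Lipschitz bounds on
  \<open>[0, \<tau>]\<close> move the base point. Differentiating \<open>w = g \<bullet> y\<close>
  with \<open>y' = w' g\<close> gives \<open>w' = H y \<bullet> y + (norm g)^2 * w'\<close>, which
  is solved for \<open>w'\<close>: hence the denominator of \<open>\<rho>\<close>.\<close>

lemma geodesic_equation:
  fixes x y :: "real \<Rightarrow> 'a"
  defines "w \<equiv> \<lambda>t. g (x t) \<bullet> y t"
  assumes t: "0 \<le> t" "t < T"
    and xy: "\<And>\<tau>. 0 < \<tau> \<Longrightarrow> \<tau> < T \<Longrightarrow> \<exists>K. \<forall>s t. 0 \<le> s \<longrightarrow> s \<le> t \<longrightarrow> t \<le> \<tau> \<longrightarrow> geodesic_increment K x y s t"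
  defines "\<rho> \<equiv> (H (x t) (y t) \<bullet> y t) / (1 - (norm (g (x t)))\<^sup>2)"
  shows "(x has_vector_derivative y t) (at t within {0..<T})"
    and "(y has_vector_derivative \<rho> *\<^sub>R g (x t)) (at t within {0..<T})"
    and "(w has_vector_derivative \<rho>) (at t within {0..<T})"
proof -
  define \<tau> where "\<tau> = (t + T) / 2"
  have \<tau>: "0 < \<tau>" "\<tau> < T" "t < \<tau>" using t by (auto simp: \<tau>_def)
  obtain K where K: "\<And>s t. 0 \<le> s \<Longrightarrow> s \<le> t \<Longrightarrow> t \<le> \<tau> \<Longrightarrow>
       norm (y t - y s) \<le> K * (t - s) \<and>
       norm (x t - x s - (t - s) *\<^sub>R y s) \<le> K * (t - s)\<^sup>2 \<and>
       norm (y t - y s - (w t - w s) *\<^sub>R g (x s)) \<le> K * (t - s)\<^sup>2"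
    using xy[OF \<tau>(1,2)] unfolding geodesic_increment_def w_def by blast
  have "norm (y \<tau> - y 0) \<le> K * (\<tau> - 0)" using K[of 0 \<tau>] \<tau> by simp
  from order_trans[OF norm_ge_zero this] have "0 \<le> K * \<tau>" by simp
  then have K0: "0 \<le> K" using \<tau> by (simp add: zero_le_mult_iff)
  define Q where "Q = norm (y 0) + K * \<tau>"
  have ybound: "norm (y s) \<le> Q" if "0 \<le> s" "s \<le> \<tau>" for s
  proof -
    have "norm (y s - y 0) \<le> K * \<tau>"
      using K[of 0 s] that mult_left_mono[of s \<tau> K] K0 by auto
    then show ?thesis unfolding Q_def using norm_triangle_ineq[of "y s - y 0" "y 0"] by simp
  qed
  have Q0: "0 \<le> Q" using ybound[of 0] \<tau> norm_ge_zero[of "y 0"] by linarith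
  have xlip1: "norm (x t - x s) \<le> (Q + K * \<tau>) * (t - s)" if st: "0 \<le> s" "s \<le> t" "t \<le> \<tau>" for s t
  proof -
    have "norm (x t - x s) \<le> norm (x t - x s - (t - s) *\<^sub>R y s) + norm ((t - s) *\<^sub>R y s)"
      using norm_triangle_ineq[of "x t - x s - (t - s) *\<^sub>R y s" "(t - s) *\<^sub>R y s"] by simp
    also have "\<dots> \<le> K * (t - s)\<^sup>2 + (t - s) * Q"
      using K[OF st] ybound[of s] st by (intro add_mono) (auto intro: mult_left_mono)
    also have "K * (t - s)\<^sup>2 \<le> (K * \<tau>) * (t - s)"
      unfolding power2_eq_square mult.assoc using K0 st by (intro mult_left_mono mult_right_mono) auto
    finally show ?thesis by (simp add: algebra_simps)
  qed
  define P where "P = Q + K * \<tau>"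
  have P0: "0 \<le> P" using Q0 K0 \<tau> by (simp add: P_def)
  have xlip: "norm (x t - x s) \<le> P * \<bar>t - s\<bar>" if "0 \<le> s" "s \<le> \<tau>" "0 \<le> t" "t \<le> \<tau>" for s t
    using xlip1[of s t] xlip1[of t s] that by (cases "s \<le> t") (auto simp: P_def norm_minus_commute)
  define r where "r = norm (x 0) + P * \<tau>"
  have xbound: "x s \<in> cball 0 r" if "0 \<le> s" "s \<le> \<tau>" for s
  proof -
    have "norm (x s - x 0) \<le> P * \<tau>" using xlip[of 0 s] that \<tau> mult_left_mono[of s \<tau> P] P0 by auto
    then show ?thesis unfolding r_def using norm_triangle_ineq[of "x s - x 0" "x 0"] by simp
  qed
  obtain L where L: "L > 0" "\<And>x y. x \<in> cball 0 r \<Longrightarrow> y \<in> cball 0 r \<Longrightarrow> norm (g x - g y) \<le> L * norm (x - y)"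
    using gradient_lipschitz[of r] by blast
  have glip: "norm (g (x t) - g (x s)) \<le> L * P * \<bar>t - s\<bar>" if "0 \<le> s" "s \<le> \<tau>" "0 \<le> t" "t \<le> \<tau>" for s t
  proof -
    have "norm (g (x t) - g (x s)) \<le> L * norm (x t - x s)" using L(2) xbound that by blast
    also have "\<dots> \<le> L * (P * \<bar>t - s\<bar>)" using xlip[OF that] L(1) by (intro mult_left_mono) auto
    finally show ?thesis by (simp add: mult.assoc)
  qed
  have ylip: "norm (y t - y s) \<le> K * \<bar>t - s\<bar>" if "0 \<le> s" "s \<le> \<tau>" "0 \<le> t" "t \<le> \<tau>" for s t
    using K[of s t] K[of t s] that by (cases "s \<le> t") (auto simp: norm_minus_commute)
  define J where "J = L * P * Q + K"
  have wdiff: "w s - w t = (g (x s) - g (x t)) \<bullet> y s + g (x t) \<bullet> (y s - y t)" for s t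
    by (simp add: w_def inner_diff_left inner_diff_right)
  have wlip: "\<bar>w s - w t\<bar> \<le> J * \<bar>s - t\<bar>" if "0 \<le> s" "s \<le> \<tau>" "0 \<le> t" "t \<le> \<tau>" for s t
  proof -
    have "\<bar>(g (x s) - g (x t)) \<bullet> y s\<bar> \<le> norm (g (x s) - g (x t)) * norm (y s)" by (rule Cauchy_Schwarz_ineq2)
    also have "\<dots> \<le> (L * P * \<bar>s - t\<bar>) * Q"
      using glip[of t s] ybound[of s] that L P0 by (intro mult_mono) auto
    finally have 1: "\<bar>(g (x s) - g (x t)) \<bullet> y s\<bar> \<le> (L * P * \<bar>s - t\<bar>) * Q" .
    have "\<bar>g (x t) \<bullet> (y s - y t)\<bar> \<le> norm (g (x t)) * norm (y s - y t)" by (rule Cauchy_Schwarz_ineq2)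
    also have "\<dots> \<le> 1 * (K * \<bar>s - t\<bar>)"
      using ylip[of t s] that spacelike[of "x t"] by (intro mult_mono) auto
    finally have 2: "\<bar>g (x t) \<bullet> (y s - y t)\<bar> \<le> K * \<bar>s - t\<bar>" by simp
    have "\<bar>w s - w t\<bar> \<le> (L * P * \<bar>s - t\<bar>) * Q + K * \<bar>s - t\<bar>"
      unfolding wdiff using 1 2 by linarith
    then show ?thesis by (simp add: J_def algebra_simps)
  qed
  define C where "C = 2 * K + J * (L * P)"
  have J0: "0 \<le> J" unfolding J_def using L(1) P0 Q0 K0 by simp
  have KC: "K \<le> C" unfolding C_def using K0 J0 L(1) P0 by simp
  have KC2: "K * (s - t)\<^sup>2 \<le> C * (s - t)\<^sup>2" for s using KC by (intro mult_right_mono) auto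
  \<comment> \<open>For \<open>s < t\<close> the expansion at \<open>s\<close> is rewritten at
    \<open>t\<close>; the change of \<open>y\<close> over the interval costs a second term of the
    same order.\<close>
  have xq: "norm (x s - x t - (s - t) *\<^sub>R y t) \<le> 2 * K * (s - t)\<^sup>2" if s: "s \<in> {0..<T}" "s \<le> \<tau>" for s
  proof (cases "t \<le> s")
    case True
    have "K * (s - t)\<^sup>2 \<le> 2 * K * (s - t)\<^sup>2" using K0 by (intro mult_right_mono) auto
    moreover have "norm (x s - x t - (s - t) *\<^sub>R y t) \<le> K * (s - t)\<^sup>2" using K[OF t(1) True s(2)] by blast
    ultimately show ?thesis by linarith
  next
    case False
    then have st: "0 \<le> s" "s \<le> t" "t \<le> \<tau>" using s \<tau> by auto
    have "x s - x t - (s - t) *\<^sub>R y t = (t - s) *\<^sub>R (y t - y s) - (x t - x s - (t - s) *\<^sub>R y s)"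
      by (simp add: algebra_simps)
    then have "norm (x s - x t - (s - t) *\<^sub>R y t) \<le> norm ((t - s) *\<^sub>R (y t - y s)) + norm (x t - x s - (t - s) *\<^sub>R y s)"
      by (metis norm_triangle_ineq4)
    also have "\<dots> \<le> (t - s) * (K * (t - s)) + K * (t - s)\<^sup>2"
      using K[OF st] st by (intro add_mono) (auto intro: mult_left_mono)
    also have "\<dots> = 2 * K * (s - t)\<^sup>2" by (simp add: power2_eq_square algebra_simps)
    finally show ?thesis .
  qed
  show dx: "(x has_vector_derivative y t) (at t within {0..<T})"
    by (rule has_vector_derivative_of_quadratic_bound[OF \<tau>(3) xq])
  define e where "e s = y s - y t - (w s - w t) *\<^sub>R g (x t)" for s
  have eq: "norm (e s) \<le> C * (s - t)\<^sup>2" if s: "s \<in> {0..<T}" "s \<le> \<tau>" for s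
  proof (cases "t \<le> s")
    case True
    then show ?thesis using K[OF t(1) True s(2)] KC2[of s] by (simp add: e_def)
  next
    case False
    then have st: "0 \<le> s" "s \<le> t" "t \<le> \<tau>" using s \<tau> by auto
    have "e s = (w t - w s) *\<^sub>R (g (x t) - g (x s)) - (y t - y s - (w t - w s) *\<^sub>R g (x s))"
      by (simp add: e_def algebra_simps)
    then have "norm (e s) \<le> norm ((w t - w s) *\<^sub>R (g (x t) - g (x s))) + norm (y t - y s - (w t - w s) *\<^sub>R g (x s))"
      by (metis norm_triangle_ineq4)
    also have "\<dots> \<le> (J * \<bar>t - s\<bar>) * (L * P * \<bar>t - s\<bar>) + K * (t - s)\<^sup>2"
      using K[OF st] wlip[of t s] glip[of s t] st s(2) J0 unfolding norm_scaleR real_norm_def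
      by (intro add_mono mult_mono) auto
    also have "\<dots> = (J * (L * P) + K) * (s - t)\<^sup>2" using st by (simp add: power2_eq_square algebra_simps)
    also have "\<dots> \<le> C * (s - t)\<^sup>2" using K0 by (intro mult_right_mono) (auto simp: C_def)
    finally show ?thesis .
  qed
  define a where "a = 1 - (norm (g (x t)))\<^sup>2"
  have a: "0 < a" using spacelike[of "x t"] by (simp add: a_def power_less_one_iff)
  \<comment> \<open>Up to quadratic errors \<open>w\<close> moves like
    \<open>g (x s) \<bullet> y t / a\<close> with \<open>y t\<close> frozen, and the latter is
    differentiable by the chain rule.\<close>
  have "((\<lambda>s. w s - ((g (x s)) \<bullet> y t) / a) has_vector_derivative 0) (at t within {0..<T})"
  proof (rule has_vector_derivative_of_quadratic_bound[OF \<tau>(3)])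
    fix s assume s: "s \<in> {0..<T}" "s \<le> \<tau>"
    have g2: "(norm (g (x t)))\<^sup>2 = 1 - a" by (simp add: a_def)
    have "g (x t) \<bullet> (y s - y t) = (w s - w t) * (1 - a) + g (x t) \<bullet> e s"
      unfolding g2[symmetric] power2_norm_eq_inner by (simp add: e_def inner_diff_right)
    then have "a * (w s - w t) = (g (x s) - g (x t)) \<bullet> y s + g (x t) \<bullet> e s"
    proof -
      have "(w s - w t) * (1 - a) = (w s - w t) - a * (w s - w t)" by (simp add: algebra_simps)
      then show ?thesis
        using wdiff[of s t] \<open>g (x t) \<bullet> (y s - y t) = (w s - w t) * (1 - a) + g (x t) \<bullet> e s\<close> by linarith
    qed
    then have "a * (w s - w t) - (g (x s) - g (x t)) \<bullet> y t = (g (x s) - g (x t)) \<bullet> (y s - y t) + g (x t) \<bullet> e s"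
      by (simp add: inner_diff_right)
    moreover have "\<bar>(g (x s) - g (x t)) \<bullet> (y s - y t)\<bar> \<le> (L * P * \<bar>s - t\<bar>) * (K * \<bar>s - t\<bar>)"
      by (rule order_trans[OF Cauchy_Schwarz_ineq2])
        (use glip[of t s] ylip[of t s] s t \<tau> L P0 K0 in \<open>auto intro!: mult_mono\<close>)
    moreover have "\<bar>g (x t) \<bullet> e s\<bar> \<le> 1 * (C * (s - t)\<^sup>2)"
      by (rule order_trans[OF Cauchy_Schwarz_ineq2], rule mult_mono)
        (use eq[OF s] spacelike[of "x t"] in auto)
    ultimately have "\<bar>a * (w s - w t) - (g (x s) - g (x t)) \<bullet> y t\<bar> \<le> (L * P * \<bar>s - t\<bar>) * (K * \<bar>s - t\<bar>) + C * (s - t)\<^sup>2"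
      by linarith
    also have "\<dots> = (L * P * K + C) * (s - t)\<^sup>2" by (simp add: algebra_simps flip: power2_eq_square)
    finally have "\<bar>a * ((w s - g (x s) \<bullet> y t / a) - (w t - g (x t) \<bullet> y t / a))\<bar> \<le> (L * P * K + C) * (s - t)\<^sup>2"
      using a by (simp add: algebra_simps inner_diff_left)
    then have "a * norm (w s - g (x s) \<bullet> y t / a - (w t - g (x t) \<bullet> y t / a) - (s - t) *\<^sub>R 0) \<le> (L * P * K + C) * (s - t)\<^sup>2"
      using a by (simp add: abs_mult)
    then show "norm (w s - g (x s) \<bullet> y t / a - (w t - g (x t) \<bullet> y t / a) - (s - t) *\<^sub>R 0) \<le> ((L * P * K + C) / a) * (s - t)\<^sup>2"
      using a by (simp add: field_simps)
  qed
  moreover have "((\<lambda>s. (g (x s) \<bullet> y t) / a) has_vector_derivative \<rho>) (at t within {0..<T})"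
  proof -
    have "((\<lambda>s. g (x s)) has_derivative (\<lambda>k. H (x t) (k *\<^sub>R y t))) (at t within {0..<T})"
      using has_derivative_compose[OF dx[unfolded has_vector_derivative_def] has_hessian[of "x t"]] .
    moreover have "H (x t) (k *\<^sub>R y t) = k *\<^sub>R H (x t) (y t)" for k
      using has_derivative_linear[OF has_hessian] by (rule linear_cmul)
    ultimately have "((\<lambda>s. g (x s)) has_vector_derivative H (x t) (y t)) (at t within {0..<T})"
      by (simp add: has_vector_derivative_def)
    from bounded_linear.has_vector_derivative[OF bounded_linear_inner_left this, of "y t"]
    have "((\<lambda>s. g (x s) \<bullet> y t) has_vector_derivative H (x t) (y t) \<bullet> y t) (at t within {0..<T})" .
    from bounded_linear.has_vector_derivative[OF bounded_linear_divide this, of a]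
    show ?thesis by (simp add: \<rho>_def a_def)
  qed
  ultimately have "((\<lambda>s. (w s - (g (x s) \<bullet> y t) / a) + (g (x s) \<bullet> y t) / a) has_vector_derivative 0 + \<rho>) (at t within {0..<T})"
    by (rule has_vector_derivative_add)
  then show dw: "(w has_vector_derivative \<rho>) (at t within {0..<T})" by simp
  \<comment> \<open>The remainder \<open>e\<close> is quadratic, so the derivative of
    \<open>y\<close> is dictated by that of \<open>w\<close>.\<close>
  have "((\<lambda>s. y s - w s *\<^sub>R g (x t)) has_vector_derivative 0) (at t within {0..<T})"
  proof (rule has_vector_derivative_of_quadratic_bound[OF \<tau>(3)])
    fix s assume "s \<in> {0..<T}" "s \<le> \<tau>"
    moreover have "y s - w s *\<^sub>R g (x t) - (y t - w t *\<^sub>R g (x t)) - (s - t) *\<^sub>R 0 = e s"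
      by (simp add: e_def algebra_simps)
    ultimately show "norm (y s - w s *\<^sub>R g (x t) - (y t - w t *\<^sub>R g (x t)) - (s - t) *\<^sub>R 0) \<le> C * (s - t)\<^sup>2"
      using eq by simp
  qed
  moreover have "((\<lambda>s. w s *\<^sub>R g (x t)) has_vector_derivative \<rho> *\<^sub>R g (x t)) (at t within {0..<T})"
    by (rule bounded_linear.has_vector_derivative[OF bounded_linear_scaleR_left dw])
  ultimately have "((\<lambda>s. (y s - w s *\<^sub>R g (x t)) + w s *\<^sub>R g (x t)) has_vector_derivative 0 + \<rho> *\<^sub>R g (x t)) (at t within {0..<T})"
    by (rule has_vector_derivative_add)
  then show "(y has_vector_derivative \<rho> *\<^sub>R g (x t)) (at t within {0..<T})" by simp
qed

lemma escaping_geodesic_exists: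
  assumes D: "\<And>r. exit_length a r \<le> D"
  shows "\<exists>T x y \<rho>. escaping_geodesic f g H T x y \<rho>"
proof -
  obtain T N u h e where "geodesic_approximation f g H T (D + 1) N u h e"
    using discrete_geodesics[OF D] by blast
  then interpret geodesic_approximation f g H T "D + 1" N u h e .
  obtain x y where xy:
    "\<And>\<tau>. 0 < \<tau> \<Longrightarrow> \<tau> < T \<Longrightarrow> \<exists>K. \<forall>s t. 0 \<le> s \<longrightarrow> s \<le> t \<longrightarrow> t \<le> \<tau> \<longrightarrow> geodesic_increment K x y s t"
    and esc: "\<And>r. \<exists>\<delta>>0. \<forall>t. 0 \<le> t \<longrightarrow> T - \<delta> < t \<longrightarrow> t < T \<longrightarrow> r \<le> norm (x t)"
    by (rule limit_curve) (rule that, assumption+)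
  define \<rho> where "\<rho> t = (H (x t) (y t) \<bullet> y t) / (1 - (norm (g (x t)))\<^sup>2)" for t
  have d: "(x has_vector_derivative y t) (at t within {0..<T})"
    "(y has_vector_derivative \<rho> t *\<^sub>R g (x t)) (at t within {0..<T})"
    "((\<lambda>t. g (x t) \<bullet> y t) has_vector_derivative \<rho> t) (at t within {0..<T})" if "t \<in> {0..<T}" for t
    using that geodesic_equation[of t T x y, OF _ _ xy] by (auto simp: \<rho>_def)
  have cx: "continuous_on {0..<T} x" and cy: "continuous_on {0..<T} y"
    unfolding continuous_on_eq_continuous_within using d has_vector_derivative_continuous by blast+
  have "continuous_on {0..<T} ((\<lambda>p. H (fst p) (snd p)) \<circ> (\<lambda>t. (x t, y t)))"
    by (intro continuous_on_compose continuous_on_Pair cx cy continuous_on_subset[OF continuous_hessian]) auto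
  then have cH: "continuous_on {0..<T} (\<lambda>t. H (x t) (y t))" by (simp add: o_def)
  have "1 - (norm (g z))\<^sup>2 \<noteq> 0" for z
  proof -
    have "(norm (g z))\<^sup>2 < 1" using spacelike[of z] by (simp add: power_less_one_iff)
    then show ?thesis by simp
  qed
  then have c\<rho>: "continuous_on {0..<T} \<rho>"
    unfolding \<rho>_def by (intro continuous_intros cH cx cy) auto
  have mono: "norm (y t - y s) \<le> g (x t) \<bullet> y t - g (x s) \<bullet> y s" if "0 \<le> s" "s \<le> t" "t < T" for s t
  proof -
    have "0 < (t + T) / 2" "(t + T) / 2 < T" "t \<le> (t + T) / 2" using that by auto
    then show ?thesis using xy[of "(t + T) / 2"] that(1,2) unfolding geodesic_increment_def by blast
  qed
  have "escaping_geodesic f g H T x y \<rho>"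
    by unfold_locales (fact T_pos d c\<rho> mono esc)+
  then show ?thesis by blast
qed

end

section \<open>Lengths of paths and the induced metric\<close>

definition flat :: "real^2 \<Rightarrow> real^3" where "flat v = vector [v$1, v$2, 0]"
definition proj :: "real^3 \<Rightarrow> real^2" where "proj p = vector [p$1, p$2]"
definition lift :: "(real^2 \<Rightarrow> real) \<Rightarrow> real^2 \<Rightarrow> real^3" where "lift f u = vector [u$1, u$2, f u]"
definition e3 :: "real^3" where "e3 = axis 3 1"

lemma flat_nth [simp]: "flat v $ 1 = v $ 1" "flat v $ 2 = v $ 2" "flat v $ 3 = 0"
  by (simp_all add: flat_def vector_3)

lemma e3_nth [simp]: "e3 $ 1 = 0" "e3 $ 2 = 0" "e3 $ 3 = 1"
  by (simp_all add: e3_def axis_def)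

lemma proj_nth [simp]: "proj p $ 1 = p $ 1" "proj p $ 2 = p $ 2"
  by (simp_all add: proj_def)

lemma lift_nth [simp]: "lift f u $ 1 = u $ 1" "lift f u $ 2 = u $ 2" "lift f u $ 3 = f u"
  by (simp_all add: lift_def vector_3)

lemma lift_eq: "lift f u = flat u + f u *\<^sub>R e3"
  by (simp add: vec_eq_iff forall_3)

lemma bounded_linear_flat: "bounded_linear flat"
  by (intro linear_conv_bounded_linear[THEN iffD1] linearI) (simp_all add: vec_eq_iff forall_3)

lemma bounded_linear_proj: "bounded_linear proj"
  by (intro linear_conv_bounded_linear[THEN iffD1] linearI) (simp_all add: vec_eq_iff forall_2)

lemma proj_lift [simp]: "proj (lift f u) = u"
  by (simp add: vec_eq_iff forall_2)

lemma graph_surface_eq: "graph_surface f = range (lift f)"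
  by (simp add: graph_surface_def lift_def)

lemma lift_proj: "p \<in> graph_surface f \<Longrightarrow> lift f (proj p) = p"
  by (auto simp: graph_surface_eq)

lemma inner_2: "(u::real^2) \<bullet> v = u$1 * v$1 + u$2 * v$2"
  by (simp add: inner_vec_def sum_2)

lemma lorentz_flat: "lorentz (flat u + a *\<^sub>R e3) (flat v + b *\<^sub>R e3) = u \<bullet> v - a * b"
  by (simp add: lorentz_def inner_2)

lemma lorentz_scale: "lorentz (c *\<^sub>R v) (c *\<^sub>R v) = c\<^sup>2 * lorentz v v"
  by (simp add: lorentz_def power2_eq_square algebra_simps)

lemma continuous_on_lorentz [continuous_intros]:
  "continuous_on A p \<Longrightarrow> continuous_on A q \<Longrightarrow> continuous_on A (\<lambda>x. lorentz (p x) (q x))"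
  unfolding lorentz_def by (intro continuous_intros)

text \<open>The cosets are the level sets of the pairing with \<open>n\<close>. As
  \<open>n $ 3 = 1\<close>, the level set of \<open>c\<close> contains
  \<open>- c *\<^sub>R e3\<close>, so convergence of the pairing gives convergent representatives in
  the ambient space, and preimages of open sets of the quotient are open.\<close>

lemma asymptotic_to_level_set:
  fixes n :: "real^3"
  assumes n: "n $ 3 = 1" and P: "P = {p. lorentz p n = L}"
    and lim: "((\<lambda>t. lorentz (\<gamma> t) n) \<longlongrightarrow> L) (at_left T)"
  shows "asymptotic_to \<gamma> T P"
proof -
  define W where "W = parallel_subspace P"
  have scale: "lorentz (- c *\<^sub>R e3) n = c" for c using n by (simp add: lorentz_def)
  have diff: "lorentz (p - q) n = lorentz p n - lorentz q n" for p q
    by (simp add: lorentz_def algebra_simps)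
  have add: "lorentz (p + q) n = lorentz p n + lorentz q n" for p q
    by (simp add: lorentz_def algebra_simps)
  have W: "W = {v. lorentz v n = 0}"
  proof (intro set_eqI iffI)
    fix v assume "v \<in> {v. lorentz v n = 0}"
    then have "(- L *\<^sub>R e3) + v \<in> P" "- L *\<^sub>R e3 \<in> P" unfolding P mem_Collect_eq add scale by simp_all
    moreover have "v = ((- L *\<^sub>R e3) + v) - (- L *\<^sub>R e3)" by simp
    ultimately show "v \<in> W" unfolding W_def parallel_subspace_def by blast
  qed (auto simp: W_def parallel_subspace_def P diff)
  have coset: "coset_of W p = {q. lorentz q n = lorentz p n}" for p
  proof (intro set_eqI iffI)
    fix q assume "q \<in> {q. lorentz q n = lorentz p n}"
    then have "q - p \<in> W" by (simp add: W diff)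
    then show "q \<in> coset_of W p" unfolding coset_of_def by (intro image_eqI[of _ _ "q - p"]) auto
  qed (auto simp: coset_of_def W add)
  have P_coset: "coset_of W (- L *\<^sub>R e3) = P" unfolding coset P scale ..
  show ?thesis
    unfolding asymptotic_to_def W_def[symmetric] limitin_def
  proof (intro conjI allI impI)
    have "coset_of W -` range (coset_of W) = UNIV" by auto
    then have "openin (quotient_topology W) (range (coset_of W))"
      by (simp add: openin_quotient_topology)
    then show "P \<in> topspace (quotient_topology W)"
      using openin_subset P_coset by blast
    fix U assume "openin (quotient_topology W) U \<and> P \<in> U"
    then have U: "open (coset_of W -` U)" "- L *\<^sub>R e3 \<in> coset_of W -` U"
      using P_coset by (auto simp: openin_quotient_topology)
    have "((\<lambda>t. - lorentz (\<gamma> t) n *\<^sub>R e3) \<longlongrightarrow> - L *\<^sub>R e3) (at_left T)"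
      by (intro tendsto_intros lim)
    from topological_tendstoD[OF this U]
    show "\<forall>\<^sub>F t in at_left T. coset_of W (\<gamma> t) \<in> U"
      by eventually_elim (simp only: vimage_eq coset scale)
  qed
qed

section \<open>Lorentzian length under reversal and concatenation\<close>

definition speed :: "(real \<Rightarrow> real^3) \<Rightarrow> real \<Rightarrow> real" where
  "speed \<gamma> t = sqrt (lorentz (vector_derivative \<gamma> (at t)) (vector_derivative \<gamma> (at t)))"

lemma lorentz_length_speed: "lorentz_length I \<gamma> = (\<integral>\<^sup>+t\<in>I. ennreal (speed \<gamma> t) \<partial>lborel)"
  by (simp add: lorentz_length_def speed_def)

text \<open>Agreement is asked only near \<open>t\<close> because a joined path coincides with each
  of its pieces only locally.\<close>

lemma speed_affine:
  assumes \<gamma>: "\<gamma> differentiable at (a + c * t)" and eq: "eventually (\<lambda>s. \<delta> s = \<gamma> (a + c * s)) (nhds t)"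
  shows "speed \<delta> t = \<bar>c\<bar> * speed \<gamma> (a + c * t)"
proof -
  have "(\<gamma> has_vector_derivative vector_derivative \<gamma> (at (a + c * t))) (at (a + c * t))"
    using \<gamma> by (simp add: vector_derivative_works)
  moreover have "((\<lambda>s. a + c * s) has_vector_derivative c) (at t)"
    by (auto intro!: derivative_eq_intros simp flip: has_real_derivative_iff_has_vector_derivative)
  ultimately have "((\<gamma> \<circ> (\<lambda>s. a + c * s)) has_vector_derivative c *\<^sub>R vector_derivative \<gamma> (at (a + c * t))) (at t)"
    by (intro vector_diff_chain_at)
  then have "(\<delta> has_vector_derivative c *\<^sub>R vector_derivative \<gamma> (at (a + c * t))) (at t)"
  proof -
    obtain U where U: "open U" "t \<in> U" "\<And>s. s \<in> U \<Longrightarrow> \<delta> s = \<gamma> (a + c * s)"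
      using eq unfolding eventually_nhds by blast
    show ?thesis
      by (rule has_vector_derivative_transform_within_open[OF
            \<open>((\<gamma> \<circ> (\<lambda>s. a + c * s)) has_vector_derivative c *\<^sub>R vector_derivative \<gamma> (at (a + c * t))) (at t)\<close> U(1,2)])
        (simp add: U(3))
  qed
  then have "vector_derivative \<delta> (at t) = c *\<^sub>R vector_derivative \<gamma> (at (a + c * t))"
    by (rule vector_derivative_at)
  then show ?thesis by (simp add: speed_def lorentz_scale real_sqrt_mult)
qed

text \<open>At break points \<open>vector_derivative\<close> may take an arbitrary value; the
  indicator removes these finitely many times, leaving a measurable integrand on the whole line to
  which substitution applies.\<close>

definition regular_set :: "(real \<Rightarrow> real^3) \<Rightarrow> real set \<Rightarrow> bool" where
  "regular_set \<gamma> Z \<longleftrightarrow> open Z \<and> Z \<subseteq> {0<..<1} \<and> finite ({0..1} - Z) \<and>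
     (\<forall>t\<in>Z. \<gamma> differentiable at t) \<and> continuous_on Z (speed \<gamma>) \<and>
     (\<lambda>t. ennreal (indicator Z t * speed \<gamma> t)) \<in> borel_measurable borel \<and>
     lorentz_length {0..1} \<gamma> = (\<integral>\<^sup>+t. ennreal (indicator Z t * speed \<gamma> t) \<partial>lborel)"

lemma regular_setD:
  assumes "regular_set \<gamma> Z"
  shows "open Z" "Z \<subseteq> {0<..<1}" "finite ({0..1} - Z)" "\<And>t. t \<in> Z \<Longrightarrow> \<gamma> differentiable at t"
    "(\<lambda>t. ennreal (indicator Z t * speed \<gamma> t)) \<in> borel_measurable borel"
    "lorentz_length {0..1} \<gamma> = (\<integral>\<^sup>+t. ennreal (indicator Z t * speed \<gamma> t) \<partial>lborel)"
    "continuous_on Z (speed \<gamma>)"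
  using assms by (auto simp: regular_set_def)

lemma valid_path_regular_set:
  assumes "valid_path \<gamma>"
  obtains Z where "regular_set \<gamma> Z"
proof -
  obtain S where S: "finite S" "\<gamma> C1_differentiable_on ({0..1} - S)"
    using assms by (auto simp: valid_path_def piecewise_C1_differentiable_on_def)
  define Z where "Z = {0<..<1} - S"
  have Z: "open Z" unfolding Z_def using S(1) by (intro open_Diff finite_imp_closed) auto
  have sub: "Z \<subseteq> {0..1} - S" by (auto simp: Z_def)
  have "continuous_on Z (\<lambda>t. vector_derivative \<gamma> (at t))"
    using S(2) sub unfolding C1_differentiable_on_eq by (blast intro: continuous_on_subset)
  then have c: "continuous_on Z (speed \<gamma>)"
    unfolding speed_def by (intro continuous_intros)
  have fin: "finite ({0..1} - Z)"
    by (rule finite_subset[of _ "S \<union> {0, 1}"]) (use S(1) in \<open>auto simp: Z_def\<close>)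
  have meas: "(\<lambda>t. ennreal (indicator Z t * speed \<gamma> t)) \<in> borel_measurable borel"
    using borel_measurable_continuous_on_indicator[OF _ c] Z by simp
  have "AE t in lborel. t \<notin> {0..1} - Z"
    using fin by (intro AE_not_in finite_imp_null_set_lborel)
  then have "lorentz_length {0..1} \<gamma> = (\<integral>\<^sup>+t. ennreal (indicator Z t * speed \<gamma> t) \<partial>lborel)"
    unfolding lorentz_length_speed
  proof (intro nn_integral_cong_AE, eventually_elim)
    case (elim t)
    then show ?case by (cases "t \<in> Z") (auto simp: Z_def indicator_def)
  qed
  moreover have "\<gamma> differentiable at t" if "t \<in> Z" for t
    using S(2) sub that unfolding C1_differentiable_on_eq by blast
  ultimately show ?thesis using that[of Z] Z fin c meas by (auto simp: regular_set_def Z_def)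
qed

lemma lorentz_length_reversepath:
  assumes "valid_path \<gamma>"
  shows "lorentz_length {0..1} (reversepath \<gamma>) = lorentz_length {0..1} \<gamma>"
proof -
  obtain Z where "regular_set \<gamma> Z" by (rule valid_path_regular_set[OF assms])
  note Z = regular_setD[OF this]
  have "finite ((\<lambda>t. 1 - t) ` ({0..1} - Z))" using Z(3) by simp
  then have "AE t in lborel. t \<notin> (\<lambda>t. 1 - t) ` ({0..1} - Z)"
    by (intro AE_not_in finite_imp_null_set_lborel)
  then have "lorentz_length {0..1} (reversepath \<gamma>) = (\<integral>\<^sup>+t. ennreal (indicator Z (1 + (-1) * t) * speed \<gamma> (1 + (-1) * t)) \<partial>lborel)"
    unfolding lorentz_length_speed
  proof (intro nn_integral_cong_AE, eventually_elim)
    case (elim t)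
    show ?case
    proof (cases "t \<in> {0..1}")
      case True
      have "1 - t \<in> Z"
      proof (rule ccontr)
        assume "1 - t \<notin> Z"
        then have "t \<in> (\<lambda>t. 1 - t) ` ({0..1} - Z)" using True by (intro image_eqI[of _ _ "1 - t"]) auto
        then show False using elim by simp
      qed
      moreover have "speed (reversepath \<gamma>) t = \<bar>-1\<bar> * speed \<gamma> (1 + (-1) * t)"
        by (rule speed_affine) (use Z(4) \<open>1 - t \<in> Z\<close> in \<open>auto simp: reversepath_def\<close>)
      ultimately show ?thesis using True by simp
    next
      case False
      then have "1 - t \<notin> Z" using Z(2) by auto
      then show ?thesis using False by simp
    qed
  qed
  also have "\<dots> = lorentz_length {0..1} \<gamma>"
    unfolding Z(6) using nn_integral_real_affine[OF Z(5), of "-1" 1] by simp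
  finally show ?thesis .
qed

lemma lorentz_length_join:
  assumes "valid_path \<gamma>1" "valid_path \<gamma>2"
  shows "lorentz_length {0..1} (\<gamma>1 +++ \<gamma>2) = lorentz_length {0..1} \<gamma>1 + lorentz_length {0..1} \<gamma>2"
proof -
  obtain O1 where "regular_set \<gamma>1 O1" by (rule valid_path_regular_set[OF assms(1)])
  note O1 = regular_setD[OF this]
  obtain O2 where "regular_set \<gamma>2 O2" by (rule valid_path_regular_set[OF assms(2)])
  note O2 = regular_setD[OF this]
  \<comment> \<open>Extended by zero, the two speeds become disjointly supported after rescaling, so
    the length of the join is one integral of a sum.\<close>
  define s1 where "s1 t = ennreal (indicator O1 t * speed \<gamma>1 t)" for t
  define s2 where "s2 t = ennreal (indicator O2 t * speed \<gamma>2 t)" for t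
  have meas: "s1 \<in> borel_measurable borel" "s2 \<in> borel_measurable borel"
    using O1(5) O2(5) by (simp_all add: s1_def[abs_def] s2_def[abs_def])
  have m: "(\<lambda>t. s1 (0 + 2 * t)) \<in> borel_measurable borel" "(\<lambda>t. s2 (-1 + 2 * t)) \<in> borel_measurable borel"
    by (rule measurable_compose[OF _ meas(1)], simp) (rule measurable_compose[OF _ meas(2)], simp)
  define X where "X = (\<lambda>t. t / 2) ` ({0..1} - O1) \<union> (\<lambda>t. (t + 1) / 2) ` ({0..1} - O2)"
  have "finite X" using O1(3) O2(3) by (simp add: X_def)
  then have "AE t in lborel. t \<notin> X" by (intro AE_not_in finite_imp_null_set_lborel)
  then have "lorentz_length {0..1} (\<gamma>1 +++ \<gamma>2) = (\<integral>\<^sup>+t. 2 * s1 (0 + 2 * t) + 2 * s2 (-1 + 2 * t) \<partial>lborel)"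
    unfolding lorentz_length_speed
  proof (intro nn_integral_cong_AE, eventually_elim)
    case (elim t)
    have n1: "2 * t \<in> O1" if "0 \<le> t" "t \<le> 1/2"
    proof (rule ccontr)
      assume "2 * t \<notin> O1"
      then have "t \<in> (\<lambda>t. t / 2) ` ({0..1} - O1)" using that by (intro image_eqI[of _ _ "2 * t"]) auto
      then show False using elim by (simp add: X_def)
    qed
    have n2: "-1 + 2 * t \<in> O2" if "1/2 \<le> t" "t \<le> 1"
    proof (rule ccontr)
      assume "-1 + 2 * t \<notin> O2"
      then have "t \<in> (\<lambda>t. (t + 1) / 2) ` ({0..1} - O2)" using that by (intro image_eqI[of _ _ "-1 + 2 * t"]) auto
      then show False using elim by (simp add: X_def)
    qed
    consider "t < 0 \<or> 1 < t" | "0 \<le> t" "t \<le> 1/2" | "1/2 < t" "t \<le> 1" by linarith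
    then show ?case
    proof cases
      case 1
      then have "2 * t \<notin> O1" "-1 + 2 * t \<notin> O2" using O1(2) O2(2) by auto
      then show ?thesis using 1 by (auto simp: s1_def s2_def)
    next
      case 2
      then have in1: "2 * t \<in> O1" by (rule n1)
      then have lt: "t < 1/2" and "-1 + 2 * t \<notin> O2" using O1(2) O2(2) 2 by auto
      have "speed (\<gamma>1 +++ \<gamma>2) t = \<bar>2\<bar> * speed \<gamma>1 (0 + 2 * t)"
      proof (rule speed_affine)
        show "\<gamma>1 differentiable at (0 + 2 * t)" using O1(4) in1 by simp
        show "\<forall>\<^sub>F s in nhds t. (\<gamma>1 +++ \<gamma>2) s = \<gamma>1 (0 + 2 * s)"
          using eventually_nhds_in_open[of "{..<1/2}" t] lt
          by (auto simp: joinpaths_def elim!: eventually_mono)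
      qed
      then show ?thesis using 2 in1 \<open>-1 + 2 * t \<notin> O2\<close>
        by (simp add: s1_def s2_def ennreal_mult'' ennreal_mult')
    next
      case 3
      then have in2: "-1 + 2 * t \<in> O2" by (intro n2) auto
      have "2 * t \<notin> O1" using O1(2) 3 by auto
      have "speed (\<gamma>1 +++ \<gamma>2) t = \<bar>2\<bar> * speed \<gamma>2 (-1 + 2 * t)"
      proof (rule speed_affine)
        show "\<gamma>2 differentiable at (-1 + 2 * t)" using O2(4) in2 by simp
        show "\<forall>\<^sub>F s in nhds t. (\<gamma>1 +++ \<gamma>2) s = \<gamma>2 (-1 + 2 * s)"
          using eventually_nhds_in_open[of "{1/2<..}" t] 3
          by (auto simp: joinpaths_def elim!: eventually_mono)
      qed
      then show ?thesis using 3 in2 \<open>2 * t \<notin> O1\<close>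
        by (simp add: s1_def s2_def ennreal_mult'' ennreal_mult')
    qed
  qed
  also have "\<dots> = (\<integral>\<^sup>+t. 2 * s1 (0 + 2 * t) \<partial>lborel) + (\<integral>\<^sup>+t. 2 * s2 (-1 + 2 * t) \<partial>lborel)"
    using m by (intro nn_integral_add) simp_all
  also have "(\<integral>\<^sup>+t. 2 * s1 (0 + 2 * t) \<partial>lborel) = (\<integral>\<^sup>+t. s1 t \<partial>lborel)"
    using m(1) nn_integral_real_affine[OF meas(1), of 2 0] by (subst nn_integral_cmult) simp_all
  also have "(\<integral>\<^sup>+t. 2 * s2 (-1 + 2 * t) \<partial>lborel) = (\<integral>\<^sup>+t. s2 t \<partial>lborel)"
    using m(2) nn_integral_real_affine[OF meas(2), of 2 "-1"] by (subst nn_integral_cmult) simp_all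
  finally show ?thesis unfolding O1(6) O2(6) s1_def s2_def .
qed

section \<open>Paths in the graph compared with chains\<close>

locale planar_graph = convex_spacelike_graph f g H
  for f :: "real^2 \<Rightarrow> real" and g H
begin

lemma chord2_eq_lorentz: "chord2 a b = lorentz (lift f b - lift f a) (lift f b - lift f a)"
proof -
  have "lift f b - lift f a = flat (b - a) + (f b - f a) *\<^sub>R e3"
    by (simp add: vec_eq_iff forall_3)
  then show ?thesis unfolding chord2_def power2_norm_eq_inner by (simp add: lorentz_flat power2_eq_square)
qed

lemma lift_has_vector_derivative:
  assumes "(c has_vector_derivative v) (at t within A)"
  shows "((\<lambda>t. lift f (c t)) has_vector_derivative flat v + (g (c t) \<bullet> v) *\<^sub>R e3) (at t within A)"
proof -
  have "((\<lambda>t. f (c t)) has_vector_derivative g (c t) \<bullet> v) (at t within A)"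
    using has_derivative_compose[OF assms[unfolded has_vector_derivative_def] has_gradient[of "c t"]]
    by (simp add: has_vector_derivative_def)
  then show ?thesis
    unfolding lift_eq
    by (intro has_vector_derivative_add bounded_linear.has_vector_derivative[OF bounded_linear_flat assms]
        bounded_linear.has_vector_derivative[OF bounded_linear_scaleR_left])
qed

text \<open>Only continuity is available at a break point. The comparison by \<open>Bolzano\<close> therefore carries as
  error term a small multiple of the increment of \<open>G\<close>, which jumps at the break points.\<close>

lemma chain_of_path:
  assumes \<gamma>: "valid_path \<gamma>" "path_image \<gamma> \<subseteq> graph_surface f" and l: "lorentz_length {0..1} \<gamma> < ennreal l"
  shows "\<exists>L\<le>l. chain (proj (pathstart \<gamma>)) (proj (pathfinish \<gamma>)) L"
proof -
  obtain Z where "regular_set \<gamma> Z" by (rule valid_path_regular_set[OF \<gamma>(1)])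
  note Z = regular_setD[OF this]
  define m where "m t = ennreal (indicator Z t * speed \<gamma> t)" for t
  have meas [measurable]: "m \<in> borel_measurable borel" using Z(5) by (simp add: m_def[abs_def])
  define I where "I a b = (\<integral>\<^sup>+t. m t * indicator {a<..b} t \<partial>lborel)" for a b
  have I_le: "I a b \<le> lorentz_length {0..1} \<gamma>" for a b
    unfolding I_def Z(6) m_def[symmetric] by (intro nn_integral_mono) (simp add: indicator_def)
  have fin: "I a b < top" for a b
    by (rule less_trans[OF le_less_trans[OF I_le l] ennreal_less_top])
  define F where "F a b = enn2real (I a b)" for a b
  have F_add: "F a c = F a b + F b c" if "a \<le> b" "b \<le> c" for a b c
  proof -
    have "I a c = (\<integral>\<^sup>+t. m t * indicator {a<..b} t + m t * indicator {b<..c} t \<partial>lborel)"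
      unfolding I_def using that by (intro nn_integral_cong) (auto simp: indicator_def)
    also have "\<dots> = I a b + I b c" unfolding I_def by (intro nn_integral_add) auto
    finally show ?thesis unfolding F_def using fin by (simp add: enn2real_plus)
  qed
  define B where "B = {0..1} - Z"
  have B: "finite B" using Z(3) by (simp add: B_def)
  define G where "G t = t + (\<Sum>s\<in>B. sgn (t - s))" for t :: real
  have sgn_mono: "sgn (a - s) \<le> sgn (b - s)" if "a \<le> b" for a b s :: real
    using that by (auto simp: sgn_if)
  have G_mono: "b - a \<le> G b - G a" if "a \<le> b" for a b
    unfolding G_def using sum_mono[of B "\<lambda>s. sgn (a - s)" "\<lambda>s. sgn (b - s)"] sgn_mono[OF that] by simp
  have G_jump: "1 \<le> G b - G a" if "x \<in> B" "a \<le> x" "x \<le> b" "a < b" for a b x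
  proof -
    have "1 \<le> sgn (b - x) - sgn (a - x)" using that by (auto simp: sgn_if)
    also have "\<dots> \<le> (\<Sum>s\<in>B. sgn (b - s) - sgn (a - s))"
      using sgn_mono[of a b] that B by (intro member_le_sum) auto
    finally show ?thesis using that by (simp add: G_def sum_subtractf)
  qed
  define p where "p t = proj (\<gamma> t)" for t
  have lift_p: "lift f (p t) = \<gamma> t" if "t \<in> {0..1}" for t
    unfolding p_def using \<gamma>(2) that by (intro lift_proj) (auto simp: path_image_def)
  have "path \<gamma>" using \<gamma>(1) by (rule valid_path_imp_path)
  then have cp: "continuous_on {0..1} p"
    unfolding p_def path_def by (rule bounded_linear.continuous_on[OF bounded_linear_proj])
  have main: "\<exists>L\<le>F 0 1 + e * (G 1 - G 0). chain (p 0) (p 1) L" if e: "0 < e" for e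
  proof -
    define Q where "Q a b \<longleftrightarrow> (\<exists>L\<le>F a b + e * (G b - G a). chain (p a) (p b) L)" for a b
    \<comment> \<open>\<open>Bolzano\<close> also tests intervals reaching outside
      \<open>[0, 1]\<close>; the guard makes \<open>P\<close> vacuous there.\<close>
    define P where "P a b \<longleftrightarrow> (0 \<le> a \<longrightarrow> a \<le> b \<longrightarrow> b \<le> 1 \<longrightarrow> Q a b)" for a b
    have "P 0 1"
    proof (rule Bolzano[of 0 1 P])
      fix a b c assume P: "P a b" "P b c" "a \<le> b" "b \<le> c"
      show "P a c"
        unfolding P_def
      proof (intro impI)
        assume "0 \<le> a" "a \<le> c" "c \<le> 1"
        then obtain L L' where L: "L \<le> F a b + e * (G b - G a)" "chain (p a) (p b) L"
          "L' \<le> F b c + e * (G c - G b)" "chain (p b) (p c) L'"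
          using P unfolding P_def Q_def by auto
        have "chain (p a) (p c) (L + L')" using chain_trans[OF L(4,2)] .
        moreover have "L + L' \<le> F a c + e * (G c - G a)"
          using L(1,3) F_add[OF P(3,4)] by (simp add: algebra_simps)
        ultimately show "Q a c" unfolding Q_def by blast
      qed
    next
      fix x :: real assume x: "0 \<le> x" "x \<le> 1"
      show "\<exists>d>0. \<forall>a b. a \<le> x \<and> x \<le> b \<and> b - a < d \<longrightarrow> P a b"
      proof (cases "x \<in> B")
        case True
        obtain d where d: "d > 0" "\<And>t. t \<in> {0..1} \<Longrightarrow> dist t x < d \<Longrightarrow> dist (p t) (p x) < e / 2"
          using cp[unfolded continuous_on_iff, rule_format, of x "e / 2"] x e by auto
        have "P a b" if ab: "a \<le> x" "x \<le> b" "b - a < d" for a b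
          unfolding P_def
        proof (intro impI)
          assume 01: "0 \<le> a" "a \<le> b" "b \<le> 1"
          show "Q a b"
          proof (cases "a = b")
            case True
            then show ?thesis unfolding Q_def by (intro exI[of _ 0]) (auto simp: F_def chain_refl)
          next
            case False
            have "dist (p a) (p x) < e / 2" "dist (p b) (p x) < e / 2"
              using d(2)[of a] d(2)[of b] ab 01 by (auto simp: dist_real_def)
            then have "norm (p b - p a) \<le> e"
              using dist_triangle_half_l[of "p b" "p x" e "p a"] by (simp add: dist_norm)
            then have "chord (p a) (p b) \<le> e" using chord_le_norm[of "p a" "p b"] by linarith
            moreover have "e * 1 \<le> e * (G b - G a)"
              using G_jump[OF True ab(1,2)] False 01 e by (intro mult_left_mono) auto
            moreover have "0 \<le> F a b" by (simp add: F_def)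
            ultimately have "chord (p a) (p b) \<le> F a b + e * (G b - G a)" by linarith
            then show ?thesis unfolding Q_def using chain_single by blast
          qed
        qed
        then show ?thesis using d(1) by blast
      next
        case False
        then have xZ: "x \<in> Z" using x by (simp add: B_def)
        define D where "D = vector_derivative \<gamma> (at x)"
        have D: "(\<gamma> has_vector_derivative D) (at x)"
          using Z(4)[OF xZ] by (simp add: D_def vector_derivative_works)
        have "continuous_on UNIV (\<lambda>v. sqrt (lorentz v v))" by (intro continuous_intros)
        then have "\<exists>\<eta>>0. \<forall>v\<in>UNIV. dist v D < \<eta> \<longrightarrow> dist (sqrt (lorentz v v)) (sqrt (lorentz D D)) < e / 2"
          using half_gt_zero[OF e] unfolding continuous_on_iff by blast
        then obtain \<eta> where \<eta>: "\<eta> > 0" "\<And>v. dist v D < \<eta> \<Longrightarrow> dist (sqrt (lorentz v v)) (sqrt (lorentz D D)) < e / 2"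
          by auto
        obtain d1 where d1: "d1 > 0" "\<And>t. \<bar>t - x\<bar> < d1 \<Longrightarrow> norm (\<gamma> t - \<gamma> x - (t - x) *\<^sub>R D) \<le> \<eta> / 2 * \<bar>t - x\<bar>"
          using D[unfolded has_vector_derivative_def has_derivative_at_alt, THEN conjunct2, rule_format, of "\<eta> / 2"] \<eta>(1)
          by auto
        have "continuous (at x) (speed \<gamma>)" using Z(7,1) xZ by (simp add: continuous_on_eq_continuous_at)
        then obtain d2 where d2: "d2 > 0" "\<And>t. dist t x < d2 \<Longrightarrow> dist (speed \<gamma> t) (speed \<gamma> x) < e / 2"
          using e half_gt_zero[OF e] unfolding continuous_at_eps_delta dist_real_def by blast
        obtain d3 where d3: "d3 > 0" "\<And>t. dist t x < d3 \<Longrightarrow> t \<in> Z"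
          using Z(1) xZ unfolding open_dist by blast
        define d where "d = min d1 (min d2 d3)"
        have d: "0 < d" using d1 d2 d3 by (simp add: d_def)
        have "P a b" if ab: "a \<le> x" "x \<le> b" "b - a < d" for a b
          unfolding P_def
        proof (intro impI)
          assume 01: "0 \<le> a" "a \<le> b" "b \<le> 1"
          show "Q a b"
          proof (cases "a = b")
            case True
            then show ?thesis unfolding Q_def by (intro exI[of _ 0]) (auto simp: F_def chain_refl)
          next
            case False
            then have lt: "a < b" using 01 by simp
            \<comment> \<open>The interval straddles \<open>x\<close>, so its difference quotient
              approximates the derivative at \<open>x\<close> even when neither end is
              \<open>x\<close>.\<close>
            define q where "q = (1 / (b - a)) *\<^sub>R (\<gamma> b - \<gamma> a)"
            have "\<gamma> b - \<gamma> a - (b - a) *\<^sub>R D = (\<gamma> b - \<gamma> x - (b - x) *\<^sub>R D) - (\<gamma> a - \<gamma> x - (a - x) *\<^sub>R D)"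
              by (simp add: algebra_simps)
            then have "norm (\<gamma> b - \<gamma> a - (b - a) *\<^sub>R D) \<le> norm (\<gamma> b - \<gamma> x - (b - x) *\<^sub>R D) + norm (\<gamma> a - \<gamma> x - (a - x) *\<^sub>R D)"
              by (simp only: norm_triangle_ineq4)
            also have "\<dots> \<le> \<eta> / 2 * \<bar>b - x\<bar> + \<eta> / 2 * \<bar>a - x\<bar>"
              using ab by (intro add_mono d1(2)) (auto simp: d_def)
            also have "\<dots> = \<eta> / 2 * (b - a)" using ab by (simp add: field_simps)
            also have "\<dots> < \<eta> * (b - a)" using \<eta>(1) lt by (intro mult_strict_right_mono) auto
            finally have "norm ((b - a) *\<^sub>R (q - D)) < \<eta> * (b - a)"
              using lt by (simp add: q_def algebra_simps)
            then have "dist q D < \<eta>" using lt by (simp add: dist_norm mult.commute)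
            from \<eta>(2)[OF this] have q: "sqrt (lorentz q q) \<le> speed \<gamma> x + e / 2"
              unfolding dist_real_def speed_def D_def[symmetric] by linarith
            have "\<gamma> b - \<gamma> a = (b - a) *\<^sub>R q" using lt by (simp add: q_def)
            then have "chord2 (p a) (p b) = (b - a)\<^sup>2 * lorentz q q"
              using lift_p[of a] lift_p[of b] 01 lorentz_scale by (simp add: chord2_eq_lorentz)
            then have "chord (p a) (p b) = (b - a) * sqrt (lorentz q q)"
              using lt by (simp add: chord_def real_sqrt_mult)
            also have "\<dots> \<le> (b - a) * (speed \<gamma> x + e / 2)" using q lt by (intro mult_left_mono) auto
            finally have upper: "chord (p a) (p b) \<le> (b - a) * (speed \<gamma> x + e / 2)" .
            have "(b - a) * (speed \<gamma> x - e / 2) \<le> F a b"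
            \<comment> \<open>A negative constant would be truncated to 0 by \<open>ennreal\<close>,
              so that case is handled apart.\<close>
            proof (cases "0 \<le> speed \<gamma> x - e / 2")
              case True
              have "ennreal ((b - a) * (speed \<gamma> x - e / 2)) = (\<integral>\<^sup>+t. ennreal (speed \<gamma> x - e / 2) * indicator {a<..b} t \<partial>lborel)"
                using True lt
                by (subst nn_integral_cmult_indicator) (simp_all add: mult.commute flip: ennreal_mult)
              also have "\<dots> \<le> I a b"
                unfolding I_def
              proof (intro nn_integral_mono)
                fix t
                show "ennreal (speed \<gamma> x - e / 2) * indicator {a<..b} t \<le> m t * indicator {a<..b} t"
                proof (cases "t \<in> {a<..b}")
                  case True
                  then have "dist t x < d2" "dist t x < d3" using ab by (auto simp: d_def dist_real_def)
                  then have "t \<in> Z" "dist (speed \<gamma> t) (speed \<gamma> x) < e / 2" using d3(2) d2(2) by blast+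
                  then have "t \<in> Z" "speed \<gamma> x - e / 2 \<le> speed \<gamma> t" unfolding dist_real_def by linarith+
                  then show ?thesis using True by (simp add: m_def ennreal_leI)
                qed simp
              qed
              finally have "enn2real (ennreal ((b - a) * (speed \<gamma> x - e / 2))) \<le> F a b"
                unfolding F_def using fin by (intro enn2real_mono)
              then show ?thesis using True lt by simp
            next
              case False
              then have "(b - a) * (speed \<gamma> x - e / 2) \<le> 0" using lt by (simp add: mult_nonneg_nonpos)
              also have "0 \<le> F a b" by (simp add: F_def)
              finally show ?thesis .
            qed
            moreover have "e * (b - a) \<le> e * (G b - G a)"
              using G_mono[OF 01(2)] e by (intro mult_left_mono) auto
            ultimately have "chord (p a) (p b) \<le> F a b + e * (G b - G a)"
              using upper by (simp add: field_simps)
            then show ?thesis unfolding Q_def using chain_single by blast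
          qed
        qed
        then show ?thesis using d by blast
      qed
    qed simp
    then show ?thesis by (simp add: P_def Q_def)
  qed
  have Fl: "F 0 1 < l"
  proof -
    have "ennreal (F 0 1) < ennreal l"
      unfolding F_def using le_less_trans[OF I_le l] fin[of 0 1] by simp
    then show ?thesis by (simp add: ennreal_less_iff F_def)
  qed
  have GG: "0 < G 1 - G 0" using G_mono[of 0 1] by simp
  \<comment> \<open>With this choice the accumulated error is exactly the slack
    \<open>l - F 0 1\<close>.\<close>
  define e where "e = (l - F 0 1) / (G 1 - G 0)"
  have "0 < e" using Fl GG by (simp add: e_def)
  from main[OF this] have "\<exists>L\<le>l. chain (p 0) (p 1) L" using GG by (simp add: e_def)
  then show ?thesis by (simp add: p_def pathstart_def pathfinish_def)
qed

section \<open>The induced distance and its metric space\<close>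

abbreviation paths :: "real^3 \<Rightarrow> real^3 \<Rightarrow> (real \<Rightarrow> real^3) set" where
  "paths p q \<equiv> {\<gamma>. valid_path \<gamma> \<and> path_image \<gamma> \<subseteq> graph_surface f \<and> pathstart \<gamma> = p \<and> pathfinish \<gamma> = q}"

abbreviation dist_on :: "real^3 \<Rightarrow> real^3 \<Rightarrow> real" where
  "dist_on \<equiv> induced_dist (graph_surface f)"

lemma lifted_segment:
  obtains \<gamma> where "\<gamma> \<in> paths (lift f a) (lift f b)" "lorentz_length {0..1} \<gamma> \<le> ennreal (norm (b - a))"
proof -
  define \<gamma> where "\<gamma> t = lift f (linepath a b t)" for t
  define D where "D t = flat (b - a) + (g (linepath a b t) \<bullet> (b - a)) *\<^sub>R e3" for t
  have d: "(\<gamma> has_vector_derivative D t) (at t)" for t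
    unfolding \<gamma>_def D_def by (intro lift_has_vector_derivative has_vector_derivative_linepath_within)
  have "continuous_on {0..1} D"
    unfolding D_def by (intro continuous_intros continuous_on_linepath)
  then have "\<gamma> C1_differentiable_on {0..1}"
    unfolding C1_differentiable_on_def using d by blast
  then have "valid_path \<gamma>"
    unfolding valid_path_def by (rule C1_differentiable_imp_piecewise)
  then have mem: "\<gamma> \<in> paths (lift f a) (lift f b)"
    by (auto simp: \<gamma>_def graph_surface_eq path_image_def pathstart_def pathfinish_def linepath_def)
  have "speed \<gamma> t \<le> norm (b - a)" for t
  proof -
    have "speed \<gamma> t = sqrt ((b - a) \<bullet> (b - a) - (g (linepath a b t) \<bullet> (b - a)) * (g (linepath a b t) \<bullet> (b - a)))"
      unfolding speed_def vector_derivative_at[OF d] D_def lorentz_flat ..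
    also have "\<dots> \<le> sqrt ((b - a) \<bullet> (b - a))" by (intro real_sqrt_le_mono) simp
    finally show ?thesis by (simp add: norm_eq_sqrt_inner)
  qed
  then have "ennreal (speed \<gamma> t) * indicator {0..1} t \<le> ennreal (norm (b - a)) * indicator {0..1} t" for t :: real
    by (cases "t \<in> {0..1::real}") (auto intro: ennreal_leI)
  then have "lorentz_length {0..1} \<gamma> \<le> (\<integral>\<^sup>+t. ennreal (norm (b - a)) * indicator {0..1::real} t \<partial>lborel)"
    unfolding lorentz_length_speed by (intro nn_integral_mono) blast
  also have "\<dots> = ennreal (norm (b - a))" by (simp add: nn_integral_cmult_indicator)
  finally show ?thesis by (rule that[OF mem])
qed

text \<open>\<open>enn2real\<close> sends infinity to 0, so only finiteness makes
  \<open>induced_dist\<close> the actual infimum.\<close>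

lemma INF_length_finite:
  assumes "p \<in> graph_surface f" "q \<in> graph_surface f"
  shows "(INF \<gamma>\<in>paths p q. lorentz_length {0..1} \<gamma>) < top"
proof -
  obtain \<gamma> where "\<gamma> \<in> paths p q" "lorentz_length {0..1} \<gamma> \<le> ennreal (norm (proj q - proj p))"
    using lifted_segment[of "proj p" "proj q"] assms by (auto simp: lift_proj)
  then show ?thesis
    by (intro le_less_trans[OF INF_lower2 ennreal_less_top])
qed

lemma induced_dist_le:
  assumes "\<gamma> \<in> paths p q" "lorentz_length {0..1} \<gamma> \<le> ennreal l" "0 \<le> l"
  shows "dist_on p q \<le> l"
proof -
  have "(INF \<gamma>\<in>paths p q. lorentz_length {0..1} \<gamma>) \<le> ennreal l"
    by (rule INF_lower2[OF assms(1)]) (rule assms(2))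
  then have "dist_on p q \<le> enn2real (ennreal l)"
    unfolding induced_dist_def by (intro enn2real_mono) auto
  then show ?thesis using assms(3) by simp
qed

lemma induced_dist_less:
  assumes "p \<in> graph_surface f" "q \<in> graph_surface f" "dist_on p q < l"
  obtains \<gamma> where "\<gamma> \<in> paths p q" "lorentz_length {0..1} \<gamma> < ennreal l"
proof -
  have "(INF \<gamma>\<in>paths p q. lorentz_length {0..1} \<gamma>) = ennreal (dist_on p q)"
    unfolding induced_dist_def using INF_length_finite[OF assms(1,2)] by simp
  also have "\<dots> < ennreal l"
    using assms(3) by (simp add: ennreal_less_iff induced_dist_def)
  finally show ?thesis using that unfolding INF_less_iff by blast
qed

lemma chain_of_induced_dist:
  assumes "dist_on (lift f a) (lift f b) < l"
  shows "\<exists>L\<le>l. chain a b L"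
proof -
  have "lift f a \<in> graph_surface f" "lift f b \<in> graph_surface f" by (auto simp: graph_surface_eq)
  then obtain \<gamma> where "\<gamma> \<in> paths (lift f a) (lift f b)" "lorentz_length {0..1} \<gamma> < ennreal l"
    using induced_dist_less assms by blast
  then show ?thesis using chain_of_path[of \<gamma> l] by auto
qed

lemma induced_dist_le_norm: "dist_on (lift f a) (lift f b) \<le> norm (b - a)"
  by (rule lifted_segment[of a b]) (rule induced_dist_le, auto)

lemma induced_dist_commute_le:
  assumes "p \<in> graph_surface f" "q \<in> graph_surface f"
  shows "dist_on q p \<le> dist_on p q"
proof (rule field_le_epsilon)
  fix e :: real assume "0 < e"
  then have "dist_on p q < dist_on p q + e" by simp
  then obtain \<gamma> where \<gamma>: "\<gamma> \<in> paths p q" "lorentz_length {0..1} \<gamma> < ennreal (dist_on p q + e)"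
    using induced_dist_less[OF assms] by blast
  show "dist_on q p \<le> dist_on p q + e"
  proof (rule induced_dist_le)
    show "reversepath \<gamma> \<in> paths q p" using \<gamma>(1) by (auto intro: valid_path_imp_reverse)
    show "lorentz_length {0..1} (reversepath \<gamma>) \<le> ennreal (dist_on p q + e)"
      using \<gamma> by (simp add: lorentz_length_reversepath less_imp_le)
    show "0 \<le> dist_on p q + e" using \<open>0 < e\<close> by (simp add: induced_dist_def)
  qed
qed

lemma induced_dist_triangle:
  assumes "p \<in> graph_surface f" "q \<in> graph_surface f" "r \<in> graph_surface f"
  shows "dist_on p r \<le> dist_on p q + dist_on q r"
proof (rule field_le_epsilon)
  fix e :: real assume e: "0 < e"
  have "dist_on p q < dist_on p q + e / 2" "dist_on q r < dist_on q r + e / 2" using e by auto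
  note less = this
  obtain \<gamma>1 where \<gamma>1: "\<gamma>1 \<in> paths p q" "lorentz_length {0..1} \<gamma>1 < ennreal (dist_on p q + e / 2)"
    by (rule induced_dist_less[OF assms(1,2) less(1)])
  obtain \<gamma>2 where \<gamma>2: "\<gamma>2 \<in> paths q r" "lorentz_length {0..1} \<gamma>2 < ennreal (dist_on q r + e / 2)"
    by (rule induced_dist_less[OF assms(2,3) less(2)])
  have nonneg: "0 \<le> dist_on p q" "0 \<le> dist_on q r" by (simp_all add: induced_dist_def)
  show "dist_on p r \<le> dist_on p q + dist_on q r + e"
  proof (rule induced_dist_le)
    show "\<gamma>1 +++ \<gamma>2 \<in> paths p r"
      using \<gamma>1(1) \<gamma>2(1) path_image_join_subset[of \<gamma>1 \<gamma>2] by (auto intro!: valid_path_join)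
    have "lorentz_length {0..1} (\<gamma>1 +++ \<gamma>2) = lorentz_length {0..1} \<gamma>1 + lorentz_length {0..1} \<gamma>2"
      using \<gamma>1 \<gamma>2 by (intro lorentz_length_join) auto
    also have "\<dots> \<le> ennreal (dist_on p q + e / 2) + ennreal (dist_on q r + e / 2)"
      using \<gamma>1(2) \<gamma>2(2) by (intro add_mono less_imp_le)
    also have "\<dots> = ennreal ((dist_on p q + e / 2) + (dist_on q r + e / 2))"
      using nonneg e by (intro ennreal_plus[symmetric]) auto
    finally show "lorentz_length {0..1} (\<gamma>1 +++ \<gamma>2) \<le> ennreal (dist_on p q + dist_on q r + e)"
      by (simp add: add_ac)
    show "0 \<le> dist_on p q + dist_on q r + e" using nonneg e by simp
  qed
qed

lemma induced_dist_lower_bound: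
  obtains \<kappa> where "0 < \<kappa>"
    "\<And>a b. norm a \<le> r \<Longrightarrow> \<kappa> * min 1 (norm (b - a)) \<le> dist_on (lift f a) (lift f b)"
proof -
  obtain \<kappa> where \<kappa>: "0 < \<kappa>" "\<And>a b L. chain a b L \<Longrightarrow> norm a \<le> r \<Longrightarrow> \<kappa> * min 1 (norm (b - a)) \<le> L"
    by (rule chain_lower_bound[of r]) (rule that, assumption, blast)
  show ?thesis
  proof (rule that[OF \<kappa>(1)], rule field_le_epsilon)
    fix a b :: "real^2" and e :: real assume "norm a \<le> r" "0 < e"
    then obtain L where "L \<le> dist_on (lift f a) (lift f b) + e" "chain a b L"
      using chain_of_induced_dist[of a b "dist_on (lift f a) (lift f b) + e"] by auto
    then show "\<kappa> * min 1 (norm (b - a)) \<le> dist_on (lift f a) (lift f b) + e"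
      using \<kappa>(2)[of a b L] \<open>norm a \<le> r\<close> by linarith
  qed
qed

lemma Metric_space_induced_dist: "Metric_space (graph_surface f) dist_on"
proof
  show "0 \<le> dist_on p q" for p q by (simp add: induced_dist_def)
  show dist_comm: "dist_on p q = dist_on q p" for p q
  proof (cases "p \<in> graph_surface f \<and> q \<in> graph_surface f")
    case True
    then show ?thesis by (intro antisym induced_dist_commute_le) auto
  next
    \<comment> \<open>\<open>Metric_space\<close> demands symmetry also off the surface; there no
      path exists in either direction and both sides are the same default value.\<close>
    case False
    have "x \<in> graph_surface f \<and> y \<in> graph_surface f" if "\<gamma> \<in> paths x y" for \<gamma> x y
      using that pathstart_in_path_image[of \<gamma>] pathfinish_in_path_image[of \<gamma>] by auto
    then have empty: "paths p q = {}" "paths q p = {}" using False by blast+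
    show ?thesis unfolding induced_dist_def empty ..
  qed
  fix p q r assume pq: "p \<in> graph_surface f" "q \<in> graph_surface f"
  then obtain a b where ab: "p = lift f a" "q = lift f b" by (auto simp: graph_surface_eq)
  show "dist_on p q = 0 \<longleftrightarrow> p = q"
  proof
    assume 0: "dist_on p q = 0"
    obtain \<kappa> where \<kappa>: "0 < \<kappa>"
      "\<And>a' b. norm a' \<le> norm a \<Longrightarrow> \<kappa> * min 1 (norm (b - a')) \<le> dist_on (lift f a') (lift f b)"
      by (rule induced_dist_lower_bound[of "norm a"]) (rule that, assumption, blast)
    have "\<kappa> * min 1 (norm (b - a)) \<le> \<kappa> * 0" using \<kappa>(2)[of a b] 0 ab by simp
    then have "min 1 (norm (b - a)) \<le> 0" using \<kappa>(1) by (simp only: mult_le_cancel_left_pos)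
    then have "norm (b - a) \<le> 0" by linarith
    then show "p = q" using ab by simp
  next
    assume "p = q"
    then show "dist_on p q = 0"
      using induced_dist_le_norm[of a a] ab by (simp add: induced_dist_def order_antisym)
  qed
  show "dist_on p r \<le> dist_on p q + dist_on q r" if "r \<in> graph_surface f"
    by (rule induced_dist_triangle[OF pq that])
qed

text \<open>If the projections of a Cauchy sequence stayed in a disc, the lower bound of the
  distance would make them Euclidean Cauchy and the sequence would converge. So a sequence without
  limit runs off to infinity while a tail stays within distance 1 of its first point, whence
  \<open>D = 1\<close>.\<close>

lemma incomplete_imp_exit_length_bounded:
  assumes "\<not> complete_surface (graph_surface f)"
  obtains a D where "\<And>r. exit_length a r \<le> D"
proof -
  interpret M: Metric_space "graph_surface f" dist_on by (rule Metric_space_induced_dist)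
  obtain \<sigma> where \<sigma>: "M.MCauchy \<sigma>" "\<nexists>x. limitin M.mtopology \<sigma> x sequentially"
    using assms unfolding complete_surface_def M.mcomplete_def by blast
  define s where "s n = proj (\<sigma> n)" for n
  have \<sigma>_lift: "\<sigma> n = lift f (s n)" for n
    using \<sigma>(1) unfolding M.MCauchy_def s_def by (simp add: lift_proj range_subsetD)
  have cauchy: "\<exists>N. \<forall>m n. N \<le> m \<longrightarrow> N \<le> n \<longrightarrow> dist_on (\<sigma> m) (\<sigma> n) < e" if "0 < e" for e
    using \<sigma>(1) that unfolding M.MCauchy_def by blast
  obtain N where N: "\<And>n. n \<ge> N \<Longrightarrow> dist_on (\<sigma> N) (\<sigma> n) < 1" using cauchy[of 1] by auto
  have unbounded: "\<exists>n\<ge>N. r \<le> norm (s n)" for r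
  proof (rule ccontr)
    assume "\<not> ?thesis"
    then have r: "norm (s n) \<le> r" if "n \<ge> N" for n using that by (meson linear)
    obtain \<kappa> where \<kappa>: "0 < \<kappa>"
      "\<And>a b. norm a \<le> r \<Longrightarrow> \<kappa> * min 1 (norm (b - a)) \<le> dist_on (lift f a) (lift f b)"
      by (rule induced_dist_lower_bound[of r]) (rule that, assumption, blast)
    have "Cauchy s"
    proof (rule metric_CauchyI)
      fix e :: real assume e: "0 < e"
      then have "0 < \<kappa> * min 1 e" using \<kappa>(1) by simp
      from cauchy[OF this] obtain N' where
        N': "\<And>m n. N' \<le> m \<Longrightarrow> N' \<le> n \<Longrightarrow> dist_on (\<sigma> m) (\<sigma> n) < \<kappa> * min 1 e" by blast
      show "\<exists>M. \<forall>m\<ge>M. \<forall>n\<ge>M. dist (s m) (s n) < e"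
      proof (intro exI[of _ "max N N'"] allI impI)
        fix m n assume mn: "max N N' \<le> m" "max N N' \<le> n"
        have "\<kappa> * min 1 (norm (s n - s m)) \<le> dist_on (\<sigma> m) (\<sigma> n)"
          unfolding \<sigma>_lift using r[of m] mn by (intro \<kappa>(2)) auto
        also have "\<dots> < \<kappa> * min 1 e" using N' mn by simp
        finally have "min 1 (norm (s n - s m)) < min 1 e" using \<kappa>(1) by (simp only: mult_less_cancel_left_pos)
        then have "norm (s n - s m) < e" by linarith
        then show "dist (s m) (s n) < e" by (simp add: dist_norm norm_minus_commute)
      qed
    qed
    then obtain x where x: "s \<longlonglongrightarrow> x" using Cauchy_convergent_iff convergent_def by blast
    have "(\<lambda>n. dist_on (\<sigma> n) (lift f x)) \<longlonglongrightarrow> 0"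
    proof (rule Lim_null_comparison)
      show "\<forall>\<^sub>F n in sequentially. norm (dist_on (\<sigma> n) (lift f x)) \<le> norm (x - s n)"
        unfolding \<sigma>_lift using induced_dist_le_norm by (simp add: induced_dist_def)
      show "(\<lambda>n. norm (x - s n)) \<longlonglongrightarrow> 0" using tendsto_norm[OF tendsto_diff[OF tendsto_const x, of x]] by simp
    qed
    then have "limitin M.mtopology \<sigma> (lift f x) sequentially"
      unfolding M.limitin_metric_dist_null by (auto simp: graph_surface_eq \<sigma>_lift)
    then show False using \<sigma>(2) by blast
  qed
  have "exit_length (s N) r \<le> 1" for r
  proof -
    obtain n where n: "n \<ge> N" "r \<le> norm (s n)" using unbounded by blast
    have "dist_on (lift f (s N)) (lift f (s n)) < 1" using N[OF n(1)] by (simp add: \<sigma>_lift)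
    then obtain L where "L \<le> 1" "chain (s N) (s n) L" using chain_of_induced_dist by blast
    then show ?thesis using exit_length_le[of "s N" "s n" L r] n(2) by linarith
  qed
  then show ?thesis by (rule that)
qed

section \<open>Incompleteness at a null direction\<close>

lemma tangent_vector:
  assumes "v \<in> tangent_space_at (graph_surface f) (lift f u)"
  shows "v = flat (proj v) + (g u \<bullet> proj v) *\<^sub>R e3"
proof -
  obtain c where c: "range c \<subseteq> graph_surface f" "c 0 = lift f u" "(c has_vector_derivative v) (at 0)"
    using assms unfolding tangent_space_at_def by blast
  have "((\<lambda>s. proj (c s)) has_vector_derivative proj v) (at 0)"
    by (rule bounded_linear.has_vector_derivative[OF bounded_linear_proj c(3)])
  \<comment> \<open>A curve in the graph is the lift of its own projection, so the derivative can be
    computed in two ways.\<close>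
  from lift_has_vector_derivative[OF this]
  have "(c has_vector_derivative flat (proj v) + (g u \<bullet> proj v) *\<^sub>R e3) (at 0)"
    using c(1,2) by (simp add: lift_proj range_subsetD)
  then show ?thesis using c(3) vector_derivative_unique_at by blast
qed

text \<open>The bound \<open>L\<close> is sharp because the pairing approaches it along the
  curve.\<close>

lemma null_support_eq:
  assumes "e = vector [cos \<theta>, sin \<theta>]"
    and "((\<lambda>t. x t \<bullet> e - f (x t)) \<longlongrightarrow> L) (at_left (T::real))" "\<And>p. p \<bullet> e - f p \<le> L"
  shows "null_support (graph_surface f) \<theta> = ereal L"
    and "\<And>u. lorentz (lift f u) (null_vec \<theta>) = u \<bullet> e - f u"
proof -
  show *: "lorentz (lift f u) (null_vec \<theta>) = u \<bullet> e - f u" for u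
    by (simp add: lorentz_def null_vec_def vector_3 inner_2 assms(1))
  show "null_support (graph_surface f) \<theta> = ereal L"
    unfolding null_support_def
  proof (rule antisym)
    show "(SUP p\<in>graph_surface f. ereal (lorentz p (null_vec \<theta>))) \<le> ereal L"
      using assms(3) by (intro SUP_least) (auto simp: graph_surface_eq *)
    show "ereal L \<le> (SUP p\<in>graph_surface f. ereal (lorentz p (null_vec \<theta>)))"
    proof (rule tendsto_upperbound)
      show "((\<lambda>t. ereal (x t \<bullet> e - f (x t))) \<longlongrightarrow> ereal L) (at_left T)"
        using assms(2) by (rule tendsto_ereal)
      show "\<forall>\<^sub>F t in at_left T. ereal (x t \<bullet> e - f (x t)) \<le> (SUP p\<in>graph_surface f. ereal (lorentz p (null_vec \<theta>)))"
        by (intro always_eventually allI SUP_upper2[of "lift f (x t)" for t]) (auto simp: graph_surface_eq *)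
    qed simp
  qed
qed

lemma exit_length_bounded_imp_incomplete_at:
  assumes "\<And>r. exit_length a r \<le> D"
  shows "\<exists>\<theta>. incomplete_at (graph_surface f) \<theta>"
proof -
  obtain T x y \<rho> where "escaping_geodesic f g H T x y \<rho>"
    using escaping_geodesic_exists[OF assms] by blast
  then interpret escaping_geodesic f g H T x y \<rho> .
  define \<gamma> where "\<gamma> t = lift f (x t)" for t
  define \<gamma>' where "\<gamma>' t = flat (y t) + w t *\<^sub>R e3" for t
  \<comment> \<open>A multiple of \<open>(g, 1)\<close>, which pairs to 0 with every tangent vector
    \<open>(v, g \<bullet> v)\<close>.\<close>
  define \<gamma>'' where "\<gamma>'' t = flat (\<rho> t *\<^sub>R g (x t)) + \<rho> t *\<^sub>R e3" for t
  have \<gamma>S: "\<gamma> t \<in> graph_surface f" for t by (simp add: \<gamma>_def graph_surface_eq)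
  have d1: "(\<gamma> has_vector_derivative \<gamma>' t) (at t within {0..<T})" if "t \<in> {0..<T}" for t
    unfolding \<gamma>_def \<gamma>'_def w_def by (rule lift_has_vector_derivative[OF dx[OF that]])
  have d2: "(\<gamma>' has_vector_derivative \<gamma>'' t) (at t within {0..<T})" if "t \<in> {0..<T}" for t
    unfolding \<gamma>'_def \<gamma>''_def
    by (intro has_vector_derivative_add bounded_linear.has_vector_derivative[OF bounded_linear_flat dy[OF that]]
        bounded_linear.has_vector_derivative[OF bounded_linear_scaleR_left dw'[OF that]])
  have cx: "continuous_on {0..<T} x"
    unfolding continuous_on_eq_continuous_within using dx has_vector_derivative_continuous by blast
  have c\<gamma>: "continuous_on {0..<T} \<gamma>"
    unfolding continuous_on_eq_continuous_within using d1 has_vector_derivative_continuous by blast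
  have "continuous_on {0..<T} \<gamma>''"
    unfolding \<gamma>''_def
    by (intro continuous_intros bounded_linear.continuous_on[OF bounded_linear_flat] continuous_\<rho> cx)
  moreover have "lorentz (\<gamma>'' t) v = 0" if "v \<in> tangent_space_at (graph_surface f) (\<gamma> t)" for t v
  proof -
    have "v = flat (proj v) + (g (x t) \<bullet> proj v) *\<^sub>R e3"
      using that unfolding \<gamma>_def by (rule tangent_vector)
    then have "lorentz (\<gamma>'' t) v = lorentz (\<gamma>'' t) (flat (proj v) + (g (x t) \<bullet> proj v) *\<^sub>R e3)" by simp
    also have "\<dots> = 0" unfolding \<gamma>''_def lorentz_flat by simp
    finally show ?thesis .
  qed
  ultimately have geo: "geodesic_in (graph_surface f) T \<gamma>"
    unfolding geodesic_in_def using d1 d2 \<gamma>S by blast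
  have proper: "proper_map (top_of_set {0..<T}) (top_of_set (graph_surface f)) \<gamma>"
  proof (rule compact_imp_proper_map)
    show "k_space (top_of_set (graph_surface f))"
      by (intro metrizable_imp_k_space metrizable_space_subtopology metrizable_space_euclidean)
    show "kc_space (top_of_set (graph_surface f))"
      by (intro Hausdorff_imp_kc_space Hausdorff_space_subtopology Hausdorff_space_euclidean)
    show "\<gamma> \<in> topspace (top_of_set {0..<T}) \<rightarrow> topspace (top_of_set (graph_surface f))"
      using \<gamma>S by auto
    show "continuous_map (top_of_set {0..<T}) (top_of_set (graph_surface f)) \<gamma> \<or> kc_space (top_of_set {0..<T})"
      by (intro disjI2 Hausdorff_imp_kc_space Hausdorff_space_subtopology Hausdorff_space_euclidean)
    fix K assume "compactin (top_of_set (graph_surface f)) K"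
    then have K: "compact K" by (simp add: compactin_subtopology)
    have "compact (proj ` K)"
      by (intro compact_continuous_image K bounded_linear.continuous_on[OF bounded_linear_proj] continuous_on_id)
    then have "\<exists>R. \<forall>p\<in>K. norm (proj p) \<le> R"
      by (auto dest!: compact_imp_bounded simp: bounded_iff)
    then obtain R where R: "\<And>p. p \<in> K \<Longrightarrow> norm (proj p) \<le> R" by blast
    obtain \<delta> where \<delta>: "\<delta> > 0" "\<And>t. 0 \<le> t \<Longrightarrow> T - \<delta> < t \<Longrightarrow> t < T \<Longrightarrow> R + 1 \<le> norm (x t)"
      using escape[of "R + 1"] by blast
    \<comment> \<open>A compact set has bounded projection, so the curve visits it only up to
      \<open>T - \<delta>\<close>; the preimage is then closed in a compact interval.\<close>
    have early: "t \<le> T - \<delta>" if "t \<in> {0..<T}" "\<gamma> t \<in> K" for t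
      using R[OF that(2)] \<delta>(2)[of t] that(1) by (force simp: \<gamma>_def)
    have "{t \<in> {0..<T}. \<gamma> t \<in> K} = {0..T - \<delta>} \<inter> \<gamma> -` K"
      using early \<delta>(1) by auto
    moreover have "closed ({0..T - \<delta>} \<inter> \<gamma> -` K)"
      by (intro continuous_closed_preimage continuous_on_subset[OF c\<gamma>] compact_imp_closed K)
        (use \<delta>(1) in auto)
    ultimately have "compact {t \<in> {0..<T}. \<gamma> t \<in> K}"
      by (simp add: compact_eq_bounded_closed bounded_Int)
    then show "compactin (top_of_set {0..<T}) {t \<in> topspace (top_of_set {0..<T}). \<gamma> t \<in> K}"
      by (auto simp: compactin_subtopology)
  qed
  have finite: "lorentz_length {0..<T} \<gamma> < \<infinity>"
  proof -
    have sp: "speed \<gamma> t = sqrt \<sigma>2" if "t \<in> {0<..<T}" for t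
    proof -
      have "(\<gamma> has_vector_derivative \<gamma>' t) (at t)"
        using interior_derivative[OF d1] that by simp
      then have "speed \<gamma> t = sqrt (y t \<bullet> y t - w t * w t)"
        unfolding speed_def by (simp add: vector_derivative_at \<gamma>'_def lorentz_flat)
      then show ?thesis
        using constant_speed[of t] that unfolding power2_norm_eq_inner by (simp add: power2_eq_square)
    qed
    \<comment> \<open>Time 0 is excluded because the two-sided derivative there depends on values of
      \<open>x\<close> at negative times, about which nothing is known.\<close>
    have "AE t in lborel. t \<noteq> (0::real)" by (rule AE_lborel_singleton)
    then have "lorentz_length {0..<T} \<gamma> \<le> (\<integral>\<^sup>+t. ennreal (sqrt \<sigma>2) * indicator {0..<T} t \<partial>lborel)"
      unfolding lorentz_length_speed
    proof (intro nn_integral_mono_AE, eventually_elim)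
      case (elim t)
      then show ?case using sp[of t] by (auto simp: indicator_def)
    qed
    also have "\<dots> = ennreal (sqrt \<sigma>2) * ennreal T"
      using T_pos by (subst nn_integral_cmult_indicator) simp_all
    also have "\<dots> < \<infinity>" by (simp add: ennreal_mult_less_top)
    finally show ?thesis .
  qed
  obtain e L where e: "norm e = 1" "((\<lambda>t. x t \<bullet> e - f (x t)) \<longlongrightarrow> L) (at_left T)" "\<And>p. p \<bullet> e - f p \<le> L"
    by (rule asymptotic_null_support) (rule that, assumption, assumption, blast)
  have "(e$1)\<^sup>2 + (e$2)\<^sup>2 = 1"
    using e(1) by (simp add: norm_eq_1 inner_2 power2_eq_square)
  then obtain \<theta> where \<theta>: "e$1 = cos \<theta>" "e$2 = sin \<theta>" by (rule sincos_total_2pi)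
  have ev: "e = vector [cos \<theta>, sin \<theta>]" using \<theta> by (simp add: vec_eq_iff forall_2)
  note ns = null_support_eq[OF ev e(2,3)]
  define P where "P = {p. lorentz p (null_vec \<theta>) = L}"
  have "is_null_support_plane (graph_surface f) \<theta> P"
    by (simp add: is_null_support_plane_def ns(1) P_def)
  moreover have "asymptotic_to \<gamma> T P"
  proof (rule asymptotic_to_level_set[OF _ P_def])
    show "null_vec \<theta> $ 3 = 1" by (simp add: null_vec_def vector_3)
    show "((\<lambda>t. lorentz (\<gamma> t) (null_vec \<theta>)) \<longlongrightarrow> L) (at_left T)"
      unfolding \<gamma>_def ns(2) by (rule e(2))
  qed
  ultimately show ?thesis
    unfolding incomplete_at_def using T_pos geo proper finite by blast
qed

end

section \<open>Gradient and Hessian of a convex spacelike function of class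
  \<open>C^2\<close>\<close>

lemma C2_imp_planar_graph:
  assumes C2: "C2_function f" and conv: "convex_on UNIV f"
    and sp: "\<And>u. onorm (frechet_derivative f (at u)) < 1"
  obtains g H where "planar_graph f g H"
proof -
  obtain f' :: "real^2 \<Rightarrow> (real^2) \<Rightarrow>\<^sub>L real" and f'' :: "real^2 \<Rightarrow> (real^2) \<Rightarrow>\<^sub>L ((real^2) \<Rightarrow>\<^sub>L real)"
    where f': "\<And>u. (f has_derivative blinfun_apply (f' u)) (at u)"
      and f'': "\<And>u. (f' has_derivative blinfun_apply (f'' u)) (at u)" and cont: "continuous_on UNIV f''"
    using C2 unfolding C2_function_def by blast
  \<comment> \<open>The Riesz vector of a functional, which turns the derivative into a
    gradient.\<close>
  define V :: "((real^2) \<Rightarrow>\<^sub>L real) \<Rightarrow> real^2" where "V A = (\<Sum>i\<in>Basis. blinfun_apply A i *\<^sub>R i)" for A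
  have V_inner: "V A \<bullet> h = blinfun_apply A h" for A h
  proof -
    have "blinfun_apply A h = blinfun_apply A (\<Sum>i\<in>Basis. (h \<bullet> i) *\<^sub>R i)" by (simp add: euclidean_representation)
    also have "\<dots> = V A \<bullet> h"
      by (simp add: V_def blinfun.sum_right blinfun.scaleR_right inner_sum_left inner_commute[of h] mult.commute)
    finally show ?thesis by simp
  qed
  have V: "bounded_linear V"
    unfolding V_def by (intro bounded_linear_sum bounded_linear_scaleR_const blinfun.bounded_linear_left)
  define g where "g u = V (f' u)" for u
  define H where "H u h = V (blinfun_apply (f'' u) h)" for u h
  have "planar_graph f g H"
  proof
    show df: "(f has_derivative (\<lambda>h. g u \<bullet> h)) (at u)" for u
      using f'[of u] by (simp add: g_def V_inner)
    show "(g has_derivative H u) (at u)" for u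
      unfolding g_def H_def by (rule bounded_linear.has_derivative[OF V f''])
    show "\<exists>L>0. \<forall>x\<in>cball 0 r. \<forall>y\<in>cball 0 r. norm (g x - g y) \<le> L * norm (x - y)" for r
    proof -
      have "compact ((\<lambda>u. norm (f'' u)) ` cball 0 r)"
        by (intro compact_continuous_image continuous_intros continuous_on_subset[OF cont]) auto
      then have "\<exists>B. \<forall>u\<in>cball 0 r. norm (f'' u) \<le> B"
        by (auto dest!: compact_imp_bounded simp: bounded_iff)
      then obtain B where B: "\<And>u. u \<in> cball 0 r \<Longrightarrow> norm (f'' u) \<le> B" by blast
      have lip: "norm (f' x - f' y) \<le> B * norm (x - y)" if "x \<in> cball 0 r" "y \<in> cball 0 r" for x y
        using that B
        by (intro differentiable_bound[of "cball 0 r" f' "\<lambda>u. blinfun_apply (f'' u)"])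
          (auto simp: norm_blinfun.rep_eq[symmetric] intro: has_derivative_at_withinI f'')
      obtain K where K: "0 < K" "\<And>A. norm (V A) \<le> norm A * K"
        using bounded_linear.pos_bounded[OF V] by blast
      have "norm (g x - g y) \<le> (K * \<bar>B\<bar> + 1) * norm (x - y)" if "x \<in> cball 0 r" "y \<in> cball 0 r" for x y
      proof -
        have "norm (g x - g y) = norm (V (f' x - f' y))"
          by (simp add: g_def bounded_linear.linear[OF V] linear_diff)
        also have "\<dots> \<le> norm (f' x - f' y) * K" by (rule K)
        also have "\<dots> \<le> (\<bar>B\<bar> * norm (x - y)) * K"
          using K(1) by (intro mult_right_mono order_trans[OF lip[OF that]]) auto
        also have "\<dots> \<le> (K * \<bar>B\<bar> + 1) * norm (x - y)" by (simp add: algebra_simps)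
        finally show ?thesis .
      qed
      moreover have "0 < K * \<bar>B\<bar> + 1" using K(1) by (simp add: add_nonneg_pos)
      ultimately show ?thesis by blast
    qed
    have "continuous_on UNIV (\<lambda>p. blinfun_apply (f'' (fst p)) (snd p))"
      by (intro blinfun.continuous_on continuous_intros continuous_on_compose2[OF cont]) auto
    then show "continuous_on UNIV (\<lambda>p. H (fst p) (snd p))"
      unfolding H_def by (rule bounded_linear.continuous_on[OF V])
    show "norm (g u) < 1" for u
    proof -
      have fd: "frechet_derivative f (at u) = (\<lambda>h. g u \<bullet> h)"
        using frechet_derivative_at[OF df] by simp
      \<comment> \<open>Testing the operator norm on the gradient itself gives
        \<open>(norm (g u))^2 \<le> onorm * norm (g u)\<close>.\<close>
      have "norm (g u \<bullet> g u) \<le> onorm (\<lambda>h. g u \<bullet> h) * norm (g u)"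
        by (rule onorm[OF has_derivative_bounded_linear[OF df]])
      then have "norm (g u) * norm (g u) \<le> onorm (\<lambda>h. g u \<bullet> h) * norm (g u)"
        by (simp add: dot_square_norm power2_eq_square)
      moreover have "onorm (\<lambda>h. g u \<bullet> h) < 1" using sp[of u] fd by simp
      ultimately show ?thesis
        by (cases "g u = 0") auto
    qed
    show "f x + g x \<bullet> (y - x) \<le> f y" for x y
    proof -
      \<comment> \<open>Restriction to the line through \<open>x\<close> and \<open>y\<close>
        reduces the support inequality to the one-dimensional tangent bound.\<close>
      define \<phi> where "\<phi> t = f (x + t *\<^sub>R (y - x))" for t
      have "convex_on UNIV \<phi>"
      proof (rule convex_onI)
        fix t a b :: real assume t: "0 < t" "t < 1"
        have "x + ((1 - t) *\<^sub>R a + t *\<^sub>R b) *\<^sub>R (y - x)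
            = (1 - t) *\<^sub>R (x + a *\<^sub>R (y - x)) + t *\<^sub>R (x + b *\<^sub>R (y - x))"
          by (simp add: algebra_simps)
        then show "\<phi> ((1 - t) *\<^sub>R a + t *\<^sub>R b) \<le> (1 - t) * \<phi> a + t * \<phi> b"
          unfolding \<phi>_def using convex_onD[OF conv, of t] t by simp
      qed simp
      moreover have "(\<phi> has_field_derivative g x \<bullet> (y - x)) (at 0)"
      proof -
        have "((\<lambda>t. x + t *\<^sub>R (y - x)) has_derivative (\<lambda>h. h *\<^sub>R (y - x))) (at 0)"
          by (auto intro!: derivative_eq_intros)
        from has_derivative_compose[OF this, of f "\<lambda>h. g x \<bullet> h"] df[of x]
        have "(\<phi> has_derivative (\<lambda>h. h * (g x \<bullet> (y - x)))) (at 0)"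
          by (simp add: \<phi>_def[abs_def])
        then show ?thesis by (simp add: has_field_derivative_def mult_commute_abs)
      qed
      ultimately have "\<phi> 1 - \<phi> 0 \<ge> (g x \<bullet> (y - x)) * (1 - 0)"
        by (intro convex_on_imp_above_tangent[of UNIV \<phi>]) auto
      then show ?thesis by (simp add: \<phi>_def)
    qed
  qed
  then show ?thesis by (rule that)
qed

theorem corollaryF:
  fixes S :: "(real^3) set"
  assumes "convex_entire_spacelike_surface S"
    and "\<forall>\<theta>::real. complete_at S \<theta>"
  shows "complete_surface S"
proof -
  obtain f where f: "S = graph_surface f" "C2_function f" "convex_on UNIV f"
    "\<And>u. onorm (frechet_derivative f (at u)) < 1"
    using assms(1) unfolding convex_entire_spacelike_surface_def by blast
  obtain g H where "planar_graph f g H" by (rule C2_imp_planar_graph[OF f(2-4)])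
  then interpret planar_graph f g H .
  show ?thesis
  proof (rule ccontr)
    assume "\<not> complete_surface S"
    then obtain a D where "\<And>r. exit_length a r \<le> D"
      using incomplete_imp_exit_length_bounded unfolding f(1) by blast
    then show False
      using exit_length_bounded_imp_incomplete_at assms(2) unfolding complete_at_def f(1) by blast
  qed
qed

end
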